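(* Fix $j\in[d]$. Let $\psi_{\max}(Q_{j,j})$ and $\psi_{\min}(Q_{j,j})$ be the largest and smallest eigenvalues of $Q_{j,j}$. If $h_j\le 1/\{2\psi_{\max}(Q_{j,j})\}$ and $h_j^2\le 1/\{10\,\operatorname{tr}(Q_{j,j}^2)\}$, then $$\|K_j-P_j\|\le 1-c_0\,h_j\,\psi_{\min}(Q_{j,j}),$$ where $c_0\approx 3.1\times10^{-6}>0$ is a universal constant.
   Context: Let $\Pi=\mathcal N(\mu,Q^{-1})$ on $\mathbb R^N$ with density $\pi$, where $\mu=(\mu_1,\dots,\mu_d)\in\mathbb R^N$ and $Q$ is a positive definite precision matrix. Coordinates are split into $d$ blocks of sizes $N_1,\dots,N_d$ with $\sum_{j=1}^d N_j=N$; write $[d]=\{1,\dots,d\}$, $x=(x_1,\dots,x_d)$ with $x_j\in\mathbb R^{N_j}$, $x_{-j}=(x_k)_{k\ne j}$, $\mu_{-j}=(\mu_k)_{k\ne j}$, and $Q=(Q_{j,k})_{j,k\in[d]}$ with $Q_{j,k}\in\mathbb R^{N_j\times N_k}$, and $Q_{j,-j}=(Q_{j,k})_{k\ne j}$. The conditional distribution of $x_j$ given $x_{-j}$ under $\Pi$ is $\Pi_j(\cdot\mid x_{-j})=\mathcal N(m_j(x_{-j}),Q_{j,j}^{-1})$ with $m_j(x_{-j})=\mu_j-Q_{j,j}^{-1}Q_{j,-j}(x_{-j}-\mu_{-j})$. Block MALA (Metropolis-adjusted Langevin algorithm) update $K_j$ with step size $h_j>0$: from $x$, propose $y=(y_j,x_{-j})$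 with $y_j\mid x\sim\mathcal N(x_j+h_j\nabla_j\log\pi(x),\,2h_jI_{N_j})$, where $\nabla_j$ is the gradient in $x_j$; accept $y$ with probability $\min\{1,\pi(y)r_j(y,x)/(\pi(x)r_j(x,y))\}$, where $r_j(x,y)$ is the corresponding proposal density; otherwise stay at $x$. $K_j$ denotes the resulting Markov kernel on $\mathbb R^N$, acting on $L^2(\Pi)$ by $(K_jf)(x)=\int f(y)\,K_j(x,\mathrm dy)$. The corresponding Gibbs update is the conditional expectation operator $(P_jf)(x)=\int f(y_j,x_{-j})\,\Pi_j(\mathrm dy_j\mid x_{-j})$. $\|\cdot\|$ is the operator norm on $L^2(\Pi)$. *)

theory Defs
  imports
    "HOL-Probability.Probability"
    "Jordan_Normal_Form.Gauss_Jordan_Elimination"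
    "Jordan_Normal_Form.Spectral_Radius"
begin

text \<open>
  The dimensions d and N_1, ..., N_d are values rather than types, so that a constant can be
  chosen uniformly in them. Blocks are numbered by {1..d}. A point x of R^N is the family of its
  blocks: x j i is coordinate i of the block x_j, with i < n j = N_j, so that replacing block j
  by z is x(j := z). The matrix Q is the family of its blocks Q j k, of size N_j x N_k.
\<close>

definition block_space :: "nat \<Rightarrow> (nat \<Rightarrow> real) measure" where
  "block_space m = (\<Pi>\<^sub>M i\<in>{..<m}. lborel)"

definition state_space :: "nat \<Rightarrow> (nat \<Rightarrow> nat) \<Rightarrow> (nat \<Rightarrow> nat \<Rightarrow> real) measure" where
  "state_space d n = (\<Pi>\<^sub>M j\<in>{1..d}. block_space (n j))"

definition block_form ::
  "nat \<Rightarrow> (nat \<Rightarrow> nat) \<Rightarrow> (nat \<Rightarrow> nat \<Rightarrow> real mat) \<Rightarrow> (nat \<Rightarrow> nat \<Rightarrow> real) \<Rightarrow> real" where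
  "block_form d n Q v = (\<Sum>j\<in>{1..d}. \<Sum>k\<in>{1..d}.
     scalar_prod (Matrix.vec (n j) (v j)) (Q j k *\<^sub>v Matrix.vec (n k) (v k)))"

definition block_pos_def :: "nat \<Rightarrow> (nat \<Rightarrow> nat) \<Rightarrow> (nat \<Rightarrow> nat \<Rightarrow> real mat) \<Rightarrow> bool" where
  "block_pos_def d n Q \<longleftrightarrow>
     (\<forall>j\<in>{1..d}. \<forall>k\<in>{1..d}. Q j k \<in> carrier_mat (n j) (n k) \<and> Q k j = transpose_mat (Q j k)) \<and>
     (\<forall>v. (\<exists>j\<in>{1..d}. \<exists>i<n j. v j i \<noteq> 0) \<longrightarrow> block_form d n Q v > 0)"

definition mat_trace :: "real mat \<Rightarrow> real" where
  "mat_trace A = (\<Sum>i<dim_row A. A $$ (i, i))"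

text \<open>
  The Gaussian density whose exponent is -q/2, with respect to the Lebesgue measure M. For
  positive definite q the integral is finite and positive, and it equals the usual
  normalising constant (2 pi)^(N/2) det(Q)^(-1/2).
\<close>

definition gauss_density :: "'a measure \<Rightarrow> ('a \<Rightarrow> real) \<Rightarrow> 'a \<Rightarrow> real" where
  "gauss_density M q x = exp (- q x / 2) / (\<integral>z. exp (- q z / 2) \<partial>M)"

definition target_density ::
  "nat \<Rightarrow> (nat \<Rightarrow> nat) \<Rightarrow> (nat \<Rightarrow> nat \<Rightarrow> real) \<Rightarrow> (nat \<Rightarrow> nat \<Rightarrow> real mat) \<Rightarrow>
   (nat \<Rightarrow> nat \<Rightarrow> real) \<Rightarrow> real" where
  "target_density d n \<mu> Q =
     gauss_density (state_space d n) (\<lambda>x. block_form d n Q (\<lambda>j i. x j i - \<mu> j i))"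

definition target ::
  "nat \<Rightarrow> (nat \<Rightarrow> nat) \<Rightarrow> (nat \<Rightarrow> nat \<Rightarrow> real) \<Rightarrow> (nat \<Rightarrow> nat \<Rightarrow> real mat) \<Rightarrow>
   (nat \<Rightarrow> nat \<Rightarrow> real) measure" where
  "target d n \<mu> Q = density (state_space d n) (\<lambda>x. ennreal (target_density d n \<mu> Q x))"

definition cond_mean ::
  "nat \<Rightarrow> (nat \<Rightarrow> nat) \<Rightarrow> (nat \<Rightarrow> nat \<Rightarrow> real) \<Rightarrow> (nat \<Rightarrow> nat \<Rightarrow> real mat) \<Rightarrow> nat \<Rightarrow>
   (nat \<Rightarrow> nat \<Rightarrow> real) \<Rightarrow> real vec" where
  "cond_mean d n \<mu> Q j x = Matrix.vec (n j) (\<mu> j) - the (mat_inverse (Q j j)) *\<^sub>v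
     Matrix.vec (n j) (\<lambda>i. \<Sum>k\<in>{1..d} - {j}.
       vec_index (Q j k *\<^sub>v Matrix.vec (n k) (\<lambda>l. x k l - \<mu> k l)) i)"

definition cond_dist ::
  "nat \<Rightarrow> (nat \<Rightarrow> nat) \<Rightarrow> (nat \<Rightarrow> nat \<Rightarrow> real) \<Rightarrow> (nat \<Rightarrow> nat \<Rightarrow> real mat) \<Rightarrow> nat \<Rightarrow>
   (nat \<Rightarrow> nat \<Rightarrow> real) \<Rightarrow> (nat \<Rightarrow> real) measure" where
  "cond_dist d n \<mu> Q j x = density (block_space (n j))
     (\<lambda>z. ennreal (gauss_density (block_space (n j))
        (\<lambda>z. let u = Matrix.vec (n j) z - cond_mean d n \<mu> Q j x
             in scalar_prod u (Q j j *\<^sub>v u)) z))"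

definition gibbs_op ::
  "nat \<Rightarrow> (nat \<Rightarrow> nat) \<Rightarrow> (nat \<Rightarrow> nat \<Rightarrow> real) \<Rightarrow> (nat \<Rightarrow> nat \<Rightarrow> real mat) \<Rightarrow> nat \<Rightarrow>
   ((nat \<Rightarrow> nat \<Rightarrow> real) \<Rightarrow> real) \<Rightarrow> (nat \<Rightarrow> nat \<Rightarrow> real) \<Rightarrow> real" where
  "gibbs_op d n \<mu> Q j f x = (\<integral>z. f (x(j := z)) \<partial>cond_dist d n \<mu> Q j x)"

definition grad_log_density ::
  "nat \<Rightarrow> (nat \<Rightarrow> nat) \<Rightarrow> (nat \<Rightarrow> nat \<Rightarrow> real) \<Rightarrow> (nat \<Rightarrow> nat \<Rightarrow> real mat) \<Rightarrow> nat \<Rightarrow>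
   (nat \<Rightarrow> nat \<Rightarrow> real) \<Rightarrow> nat \<Rightarrow> real" where
  "grad_log_density d n \<mu> Q j x i =
     deriv (\<lambda>t. ln (target_density d n \<mu> Q (x(j := (x j)(i := t))))) (x j i)"

text \<open>The density at y_j of N(x_j + h grad_j log pi(x), 2 h I): the coordinates are independent.\<close>

definition proposal_density ::
  "nat \<Rightarrow> (nat \<Rightarrow> nat) \<Rightarrow> (nat \<Rightarrow> nat \<Rightarrow> real) \<Rightarrow> (nat \<Rightarrow> nat \<Rightarrow> real mat) \<Rightarrow> nat \<Rightarrow> real \<Rightarrow>
   (nat \<Rightarrow> nat \<Rightarrow> real) \<Rightarrow> (nat \<Rightarrow> nat \<Rightarrow> real) \<Rightarrow> real" where
  "proposal_density d n \<mu> Q j h x y = (\<Prod>i<n j.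
     normal_density (x j i + h * grad_log_density d n \<mu> Q j x i) (sqrt (2 * h)) (y j i))"

definition accept_prob ::
  "nat \<Rightarrow> (nat \<Rightarrow> nat) \<Rightarrow> (nat \<Rightarrow> nat \<Rightarrow> real) \<Rightarrow> (nat \<Rightarrow> nat \<Rightarrow> real mat) \<Rightarrow> nat \<Rightarrow> real \<Rightarrow>
   (nat \<Rightarrow> nat \<Rightarrow> real) \<Rightarrow> (nat \<Rightarrow> nat \<Rightarrow> real) \<Rightarrow> real" where
  "accept_prob d n \<mu> Q j h x y = min 1
     (target_density d n \<mu> Q y * proposal_density d n \<mu> Q j h y x /
      (target_density d n \<mu> Q x * proposal_density d n \<mu> Q j h x y))"

text \<open>The law of the next state: acceptance is decided by an independent uniform variable u.\<close>

definition mala_kernel ::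
  "nat \<Rightarrow> (nat \<Rightarrow> nat) \<Rightarrow> (nat \<Rightarrow> nat \<Rightarrow> real) \<Rightarrow> (nat \<Rightarrow> nat \<Rightarrow> real mat) \<Rightarrow> nat \<Rightarrow> real \<Rightarrow>
   (nat \<Rightarrow> nat \<Rightarrow> real) \<Rightarrow> (nat \<Rightarrow> nat \<Rightarrow> real) measure" where
  "mala_kernel d n \<mu> Q j h x = distr
     (density (block_space (n j)) (\<lambda>z. ennreal (proposal_density d n \<mu> Q j h x (x(j := z))))
       \<Otimes>\<^sub>M uniform_measure lborel {0..1::real})
     (state_space d n)
     (\<lambda>(z, u). if u \<le> accept_prob d n \<mu> Q j h x (x(j := z)) then x(j := z) else x)"

definition mala_op ::
  "nat \<Rightarrow> (nat \<Rightarrow> nat) \<Rightarrow> (nat \<Rightarrow> nat \<Rightarrow> real) \<Rightarrow> (nat \<Rightarrow> nat \<Rightarrow> real mat) \<Rightarrow> nat \<Rightarrow> real \<Rightarrow>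
   ((nat \<Rightarrow> nat \<Rightarrow> real) \<Rightarrow> real) \<Rightarrow> (nat \<Rightarrow> nat \<Rightarrow> real) \<Rightarrow> real" where
  "mala_op d n \<mu> Q j h f x = (\<integral>y. f y \<partial>mala_kernel d n \<mu> Q j h x)"

text \<open>
  Elements of L^2 are represented by square-integrable functions; all operators of interest
  respect equality almost everywhere. The operator norm is infinite if the operator does not map
  L^2 into itself, because the Bochner integral in L2_norm is 0 outside L^2.
\<close>

definition L2_functions :: "'a measure \<Rightarrow> ('a \<Rightarrow> real) set" where
  "L2_functions M = {f \<in> borel_measurable M. integrable M (\<lambda>x. (f x)\<^sup>2)}"

definition L2_norm :: "'a measure \<Rightarrow> ('a \<Rightarrow> real) \<Rightarrow> real" where
  "L2_norm M f = sqrt (\<integral>x. (f x)\<^sup>2 \<partial>M)"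

definition L2_opnorm :: "'a measure \<Rightarrow> (('a \<Rightarrow> real) \<Rightarrow> ('a \<Rightarrow> real)) \<Rightarrow> ereal" where
  "L2_opnorm M T = (SUP f\<in>{f \<in> L2_functions M. L2_norm M f \<le> 1}.
     if T f \<in> L2_functions M then ereal (L2_norm M (T f)) else \<infinity>)"

end

theory Submission
  imports Defs
begin

text \<open>
  Given the other blocks, the chain moves in one block with target \<open>N(c, A^-1)\<close>, where \<open>A = Q j j\<close>; after
  recentring, the target density is \<open>\<pi>(x) \<propto> exp (-x'Ax/2)\<close> and the kernel does not depend on the other
  blocks. With the proposal density \<open>r\<close> one has \<open>\<pi>(x) r(x, y) = S(x, y) w(x)\<close>, where
  \<open>S(x, y) \<propto> exp (-|x - y|\<^sup>2/4h - x'Ay/2)\<close> is symmetric and \<open>w(x) = exp (-h|Ax|\<^sup>2/4)\<close>, so a proposal is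
  accepted with probability \<open>min 1 (w(y)/w(x))\<close>.

  The kernel is a nonnegative operator, because \<open>S\<close> is a Gaussian in the difference of its arguments
  and \<open>min (w(x)) (w(y))\<close> is a mixture of products of indicators. The norm in question is therefore
  governed by the spectral gap alone.

  For the gap, let \<open>g(x)\<close> be the mean of \<open>f\<close> under the proposals from \<open>x\<close> accepted with the smaller Barker
  probability \<open>w(y)/(w(x) + w(y))\<close>. Since \<open>h\<^sup>2 tr(A\<^sup>2) \<le> 1/10\<close>, this probability has mean at least \<open>1/10\<close> from every
  point. Both \<open>(f - g)\<^sup>2\<close> and \<open>h|\<nabla>g|\<^sup>2\<close> are bounded by a constant times the local Dirichlet energy, the
  latter by the Cauchy-Schwarz inequality applied to the score of the kernel, and the Gaussian
  Poincare inequality bounds the variance of \<open>g\<close> by \<open>|\<nabla>g|\<^sup>2/\<psi>\<close>, where \<open>\<psi>\<close> is the smallest eigenvalue of \<open>A\<close>.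
\<close>

section \<open>Lebesgue measure on a block\<close>

text \<open>Barker's rule replaces the Metropolis minimum because it is smooth in \<open>x\<close>,
  so that the smoothed function has a gradient, and because \<open>barker_le_accept\<close> lets the
  Dirichlet form of the chain dominate its energy. The obstacle is the score of the accepted kernel:
  one term is proportional to A^2 x and unbounded in \<open>x\<close>. It carries the factor
  \<open>1 - barker x y\<close>, and where A^2 x is large the drift makes |Ay|^2 fall below |Ax|^2,
  so rejection is rare; \<open>integral_reject_le\<close> makes this quantitative without any
  dependence on the dimension. Gaussian second moments are only bounded, by way of exponential
  moments, which takes translation invariance but no determinant and no diagonalisation; the price
  is the factor 4/3 in \<open>second_moment_of_subgaussian\<close>. On the full space the difference
  of the two operators acts inside each fibre of fixed other blocks, where the Gibbs update is the
  expectation; a bound uniform over the fibres integrates to the norm bound. The gap obtained is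
  \<open>h * \<psi> / 8600\<close>, and 1/8600 is about 1.16e-4.\<close>

interpretation lborel_product: product_sigma_finite "\<lambda>_::nat. lborel :: real measure"
  by standard

lemma sets_block_space[measurable_cong]: "sets (block_space m) = sets (\<Pi>\<^sub>M i\<in>{..<m}. borel)"
  unfolding block_space_def by (intro sets_PiM_cong) auto

lemma space_block_space: "space (block_space m) = extensional {..<m}"
  by (simp add: block_space_def space_PiM PiE_def)

lemma sigma_finite_block_space: "sigma_finite_measure (block_space m)"
  unfolding block_space_def by (rule lborel_product.sigma_finite) simp

lemma measurable_block_component[measurable]:
  "i < m \<Longrightarrow> (\<lambda>x. x i) \<in> borel_measurable (block_space m)"
  by (simp add: block_space_def)

lemma measurable_restrict_block_space[measurable (raw)]:
  assumes "\<And>i. i < m \<Longrightarrow> (\<lambda>x. f x i) \<in> borel_measurable N"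
  shows "(\<lambda>x. \<lambda>i\<in>{..<m}. f x i) \<in> measurable N (block_space m)"
  unfolding block_space_def using assms by (intro measurable_restrict) auto

text \<open>Product measures are determined on boxes, and on a box the claim splits into the
  invariance of \<open>lborel\<close> in each coordinate.\<close>

lemma distr_block_space_translate:
  "distr (block_space m) (block_space m) (\<lambda>x. \<lambda>i\<in>{..<m}. x i + c i) = block_space m"
  (is "?D = _")
proof -
  have "?D = PiM {..<m} (\<lambda>_. lborel)"
  proof (rule lborel_product.PiM_eqI)
    show "sets ?D = sets (PiM {..<m} (\<lambda>_. lborel))"
      by (simp add: block_space_def)
  next
    fix A :: "nat \<Rightarrow> real set" assume A: "\<And>i. i \<in> {..<m} \<Longrightarrow> A i \<in> sets lborel"
    have pre: "(\<lambda>t. t + c i) -` A i \<in> sets lborel" if "i < m" for i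
      using A[of i] that measurable_sets[of "\<lambda>t. t + c i" lborel borel "A i"] by simp
    have inv: "emeasure lborel ((\<lambda>t. t + c i) -` A i) = emeasure lborel (A i)" if "i < m" for i
    proof -
      have "emeasure lborel (A i) = emeasure (distr lborel borel ((+) (c i))) (A i)"
        by (simp add: lborel_distr_plus)
      also have "\<dots> = emeasure lborel ((\<lambda>t. t + c i) -` A i)"
        using A[of i] that by (subst emeasure_distr) (auto simp: add.commute vimage_def)
      finally show ?thesis by simp
    qed
    have "(\<lambda>x. \<lambda>i\<in>{..<m}. x i + c i) -` (Pi\<^sub>E {..<m} A) \<inter> space (block_space m)
        = Pi\<^sub>E {..<m} (\<lambda>i. (\<lambda>t. t + c i) -` A i)"
      by (auto simp: space_block_space PiE_def Pi_def)
    moreover have "Pi\<^sub>E {..<m} A \<in> sets (block_space m)"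
      using A unfolding block_space_def by (intro sets_PiM_I_finite) auto
    ultimately have "emeasure ?D (Pi\<^sub>E {..<m} A) = emeasure (block_space m) (Pi\<^sub>E {..<m} (\<lambda>i. (\<lambda>t. t + c i) -` A i))"
      by (subst emeasure_distr) simp_all
    also have "\<dots> = (\<Prod>i\<in>{..<m}. emeasure lborel ((\<lambda>t. t + c i) -` A i))"
      unfolding block_space_def using pre by (intro lborel_product.emeasure_PiM) auto
    finally show "emeasure ?D (Pi\<^sub>E {..<m} A) = (\<Prod>i\<in>{..<m}. emeasure lborel (A i))"
      using inv by simp
  qed simp
  then show ?thesis by (simp add: block_space_def)
qed

lemma nn_integral_block_space_translate:
  assumes [measurable]: "F \<in> borel_measurable (block_space m)"
  shows "(\<integral>\<^sup>+x. F (\<lambda>i\<in>{..<m}. x i + c i) \<partial>block_space m) = (\<integral>\<^sup>+x. F x \<partial>block_space m)"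
  by (subst (2) distr_block_space_translate[symmetric, of _ c], subst nn_integral_distr) auto

lemma integral_block_space_translate:
  fixes F :: "_ \<Rightarrow> real"
  assumes [measurable]: "F \<in> borel_measurable (block_space m)"
  shows "(\<integral>x. F (\<lambda>i\<in>{..<m}. x i + c i) \<partial>block_space m) = (\<integral>x. F x \<partial>block_space m)"
  by (subst (2) distr_block_space_translate[symmetric, of _ c], subst integral_distr) auto

lemma pair_sigma_finite_block_space: "pair_sigma_finite (block_space m) (block_space m)"
  by (simp add: pair_sigma_finite_def sigma_finite_block_space)

section \<open>Shears and rotations of a pair of points\<close>

lemma nn_integral_shear_fst:
  assumes [measurable]: "F \<in> borel_measurable (block_space m \<Otimes>\<^sub>M block_space m)"
  shows "(\<integral>\<^sup>+p. F (\<lambda>i\<in>{..<m}. fst p i + c * snd p i, snd p) \<partial>(block_space m \<Otimes>\<^sub>M block_space m))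
    = (\<integral>\<^sup>+p. F p \<partial>(block_space m \<Otimes>\<^sub>M block_space m))" (is "?l = _")
proof -
  interpret pair_sigma_finite "block_space m" "block_space m" by (rule pair_sigma_finite_block_space)
  have "?l = (\<integral>\<^sup>+y. (\<integral>\<^sup>+x. F (\<lambda>i\<in>{..<m}. x i + c * y i, y) \<partial>block_space m) \<partial>block_space m)"
    by (subst nn_integral_snd[symmetric]) simp_all
  \<comment> \<open>For fixed \<open>y\<close> the shear is a translation of \<open>x\<close>, so
    Fubini replaces a change of variables.\<close>
  also have "\<dots> = (\<integral>\<^sup>+y. (\<integral>\<^sup>+x. F (x, y) \<partial>block_space m) \<partial>block_space m)"
    by (intro nn_integral_cong
        nn_integral_block_space_translate[where c="\<lambda>i. c * _ i" and F="\<lambda>x. F (x, _)"]) measurable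
  also have "\<dots> = (\<integral>\<^sup>+p. F p \<partial>(block_space m \<Otimes>\<^sub>M block_space m))"
    by (rule nn_integral_snd) simp
  finally show ?thesis .
qed

lemma nn_integral_shear_snd:
  assumes [measurable]: "F \<in> borel_measurable (block_space m \<Otimes>\<^sub>M block_space m)"
  shows "(\<integral>\<^sup>+p. F (fst p, \<lambda>i\<in>{..<m}. snd p i + c * fst p i) \<partial>(block_space m \<Otimes>\<^sub>M block_space m))
    = (\<integral>\<^sup>+p. F p \<partial>(block_space m \<Otimes>\<^sub>M block_space m))" (is "?l = _")
proof -
  interpret sigma_finite_measure "block_space m" by (rule sigma_finite_block_space)
  have "?l = (\<integral>\<^sup>+y. (\<integral>\<^sup>+x. F (y, \<lambda>i\<in>{..<m}. x i + c * y i) \<partial>block_space m) \<partial>block_space m)"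
    by (subst nn_integral_fst[symmetric]) simp_all
  also have "\<dots> = (\<integral>\<^sup>+y. (\<integral>\<^sup>+x. F (y, x) \<partial>block_space m) \<partial>block_space m)"
    by (intro nn_integral_cong
        nn_integral_block_space_translate[where c="\<lambda>i. c * _ i" and F="\<lambda>x. F (_, x)"]) measurable
  also have "\<dots> = (\<integral>\<^sup>+p. F p \<partial>(block_space m \<Otimes>\<^sub>M block_space m))"
    by (rule nn_integral_fst) simp
  finally show ?thesis .
qed

text \<open>As \<open>t\<close> runs from 0 to pi/2 the first component moves from the first point
  to the second, and the second component is its velocity. One rotation thus supplies both the point
  and the direction for a gradient.\<close>

definition rotate_pair ::
  "nat \<Rightarrow> real \<Rightarrow> (nat \<Rightarrow> real) \<times> (nat \<Rightarrow> real) \<Rightarrow> (nat \<Rightarrow> real) \<times> (nat \<Rightarrow> real)" where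
  "rotate_pair m t p = (\<lambda>i\<in>{..<m}. cos t * fst p i + sin t * snd p i,
                        \<lambda>i\<in>{..<m}. cos t * snd p i - sin t * fst p i)"

lemma measurable_rotate_pair[measurable]:
  "rotate_pair m t \<in> measurable (block_space m \<Otimes>\<^sub>M block_space m) (block_space m \<Otimes>\<^sub>M block_space m)"
  unfolding rotate_pair_def by measurable

text \<open>A plane rotation by an angle other than \<open>\<pi>\<close> is a product of three shears.\<close>

lemma nn_integral_rotate_pair:
  assumes [measurable]: "F \<in> borel_measurable (block_space m \<Otimes>\<^sub>M block_space m)"
    and c: "cos (t / 2) \<noteq> 0"
  shows "(\<integral>\<^sup>+p. F (rotate_pair m t p) \<partial>(block_space m \<Otimes>\<^sub>M block_space m))
    = (\<integral>\<^sup>+p. F p \<partial>(block_space m \<Otimes>\<^sub>M block_space m))"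
proof -
  \<comment> \<open>The three shears are by tan(t/2), - sin t and tan(t/2); assumption
    \<open>c\<close> makes the tangent meaningful.\<close>
  define a b where "a = tan (t / 2)" and "b = - sin t"
  let ?M = "block_space m \<Otimes>\<^sub>M block_space m"
  define s1 where "s1 = (\<lambda>p::(nat \<Rightarrow> real) \<times> (nat \<Rightarrow> real). (\<lambda>i\<in>{..<m}. fst p i + a * snd p i, snd p))"
  define s2 where "s2 = (\<lambda>p::(nat \<Rightarrow> real) \<times> (nat \<Rightarrow> real). (fst p, \<lambda>i\<in>{..<m}. snd p i + b * fst p i))"
  have [measurable]: "s1 \<in> measurable ?M ?M" "s2 \<in> measurable ?M ?M"
    unfolding s1_def s2_def by measurable
  have st: "sin t = 2 * sin (t/2) * cos (t/2)" and ct: "cos t = 1 - 2 * sin (t/2)^2"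
    using sin_double[of "t/2"] cos_double_sin[of "t/2"] by simp_all
  have 1: "1 + a * b = cos t"
    using c unfolding a_def b_def st ct tan_def by (simp add: power2_eq_square)
  have "a * (1 + cos t) = sin t"
    using c unfolding a_def st tan_def cos_double_cos[of "t/2", simplified] by (simp add:
        power2_eq_square field_simps)
  then have 2: "a + a * (1 + a * b) = sin t"
    using 1 by (simp add: algebra_simps)
  have eq: "s1 (s2 (s1 p)) = rotate_pair m t p" if "p \<in> space ?M" for p
  proof -
    obtain x y where p: "p = (x, y)" by (cases p)
    have A: "fst (s1 (s2 (s1 p))) i = cos t * x i + sin t * y i" if "i < m" for i
    proof -
      have "fst (s1 (s2 (s1 p))) i = (1 + a * b) * x i + (a + a * (1 + a * b)) * y i"
        using that by (simp add: s1_def s2_def p algebra_simps)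
      then show ?thesis by (simp only: 1 2[unfolded 1])
    qed
    have B: "snd (s1 (s2 (s1 p))) i = cos t * y i - sin t * x i" if "i < m" for i
    proof -
      have "snd (s1 (s2 (s1 p))) i = (1 + a * b) * y i + b * x i"
        using that by (simp add: s1_def s2_def p algebra_simps)
      then show ?thesis by (simp only: 1) (simp add: b_def)
    qed
    have "fst (s1 (s2 (s1 p))) \<in> extensional {..<m}" "snd (s1 (s2 (s1 p))) \<in> extensional {..<m}"
      by (simp_all add: s1_def s2_def)
    then show ?thesis using A B
      by (intro prod_eqI) (auto intro!: extensionalityI[of _ "{..<m}"] simp: rotate_pair_def p)
  qed
  have "(\<integral>\<^sup>+p. F (rotate_pair m t p) \<partial>?M) = (\<integral>\<^sup>+p. F (s1 (s2 (s1 p))) \<partial>?M)"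
    by (intro nn_integral_cong) (simp add: eq)
  also have "\<dots> = (\<integral>\<^sup>+p. F (s1 (s2 p)) \<partial>?M)"
    unfolding s1_def[of] using nn_integral_shear_fst[of "\<lambda>p. F (s1 (s2 p))" m a]
    by (simp add: s1_def)
  also have "\<dots> = (\<integral>\<^sup>+p. F (s1 p) \<partial>?M)"
    using nn_integral_shear_snd[of "\<lambda>p. F (s1 p)" m b] by (simp add: s2_def)
  also have "\<dots> = (\<integral>\<^sup>+p. F p \<partial>?M)"
    using nn_integral_shear_fst[of F m a] by (simp add: s1_def)
  finally show ?thesis .
qed

section \<open>Symmetric kernels on L2\<close>

text \<open>The core of the Cauchy-Schwarz arguments for possibly degenerate forms and for weighted
  integrals. With \<open>a = 0\<close> it also serves as a first-order condition at a
  minimum.\<close>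

lemma quadratic_nonneg_discriminant:
  fixes a b c :: real
  assumes "\<And>t. 0 \<le> a + 2 * t * b + t\<^sup>2 * c"
  shows "b\<^sup>2 \<le> a * c"
proof (cases "c = 0")
  case True
  have "b = 0"
  proof (rule ccontr)
    assume "b \<noteq> 0"
    \<comment> \<open>At this point the linear function takes the value -1.\<close>
    then show False using assms[of "- (a + 1) / (2 * b)"] True by (simp add: field_simps)
  qed
  then show ?thesis using True by simp
next
  case False
  have "c > 0"
  proof (rule ccontr)
    assume "\<not> c > 0"
    with False have c: "c < 0" by simp
    \<comment> \<open>The quotient makes \<open>c * t + 2 * b\<close> at most
      \<open>- \<bar>a\<bar> - 1\<close>; the added 1 keeps \<open>t \<ge> 1\<close>, so that
      multiplying by \<open>t\<close> preserves this bound.\<close>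
    define t where "t = (\<bar>a\<bar> + 2 * \<bar>b\<bar> + 1) / (- c) + 1"
    have t: "t \<ge> 1" using c unfolding t_def by (simp add: divide_nonneg_neg divide_le_0_iff)
    have "- c * t \<ge> \<bar>a\<bar> + 2 * \<bar>b\<bar> + 1"
      using c unfolding t_def by (simp add: field_simps)
    then have "t * (c * t + 2 * b) \<le> t * (- \<bar>a\<bar> - 1)"
      using t by (intro mult_left_mono) auto
    also have "\<dots> \<le> 1 * (- \<bar>a\<bar> - 1)" using t by (intro mult_right_mono_neg) auto
    finally have "a + 2 * t * b + t\<^sup>2 * c < 0"
      by (simp add: algebra_simps power2_eq_square)
    then show False using assms[of t] by simp
  qed
  then show ?thesis using assms[of "- b / c"]
    by (simp add: field_simps power2_eq_square)
qed

text \<open>When the product is integrable, the integral is the square of that of \<open>u\<close>;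
  otherwise the Bochner integral has its default value 0.\<close>

lemma (in sigma_finite_measure) integral_tensor_square_nonneg:
  fixes u :: "'a \<Rightarrow> real"
  shows "0 \<le> (\<integral>p. u (fst p) * u (snd p) \<partial>(M \<Otimes>\<^sub>M M))"
proof (cases "integrable (M \<Otimes>\<^sub>M M) (\<lambda>p. u (fst p) * u (snd p))")
  case True
  interpret pair_sigma_finite M M by standard
  have "(\<integral>p. u (fst p) * u (snd p) \<partial>(M \<Otimes>\<^sub>M M)) = (\<integral>x. (\<integral>y. u x * u y \<partial>M) \<partial>M)"
    using integral_fst'[OF True] by simp
  also have "\<dots> = (\<integral>x. u x \<partial>M) * (\<integral>x. u x \<partial>M)"
    by simp
  finally show ?thesis by simp
qed (simp add: not_integrable_integral_eq)

lemma abs_mult_le_sum_squares: "\<bar>a * b\<bar> \<le> a\<^sup>2 + b\<^sup>2" for a b :: real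
proof -
  have "0 \<le> \<bar>a\<bar> * \<bar>b\<bar>" by simp
  then show ?thesis
    using sum_squares_bound[of "\<bar>a\<bar>" "\<bar>b\<bar>"] unfolding abs_mult power2_abs by linarith
qed

text \<open>A reversible chain that may hold: \<open>s\<close> is the density of accepted moves
  relative to the stationary law, and the missing mass is the probability of staying put. Symmetry
  of \<open>s\<close> is detailed balance.\<close>

locale symmetric_kernel = prob_space +
  fixes s :: "'a \<Rightarrow> 'a \<Rightarrow> real"
  assumes s_measurable[measurable]: "(\<lambda>p. s (fst p) (snd p)) \<in> borel_measurable (M \<Otimes>\<^sub>M M)"
    and s_nonneg: "s x y \<ge> 0"
    and s_sym: "s x y = s y x"
    and s_mass: "x \<in> space M \<Longrightarrow> (\<integral>\<^sup>+y. s x y \<partial>M) \<le> 1"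
begin

definition mass :: "'a \<Rightarrow> real" where "mass x = (\<integral>y. s x y \<partial>M)"

definition step :: "('a \<Rightarrow> real) \<Rightarrow> 'a \<Rightarrow> real" where
  "step f x = (\<integral>y. s x y * f y \<partial>M) + (1 - mass x) * f x"

definition kform :: "('a \<Rightarrow> real) \<Rightarrow> ('a \<Rightarrow> real) \<Rightarrow> real" where
  "kform f g = (\<integral>p. s (fst p) (snd p) * f (fst p) * g (snd p) \<partial>(M \<Otimes>\<^sub>M M))"

definition dirichlet :: "('a \<Rightarrow> real) \<Rightarrow> real" where
  "dirichlet f = (\<integral>p. s (fst p) (snd p) * (f (fst p) - f (snd p))\<^sup>2 \<partial>(M \<Otimes>\<^sub>M M)) / 2"

text \<open>The bilinear form of \<open>step\<close> minus the projection onto constants, which is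
  what the difference of the two updates becomes within one fibre.\<close>

definition centred_form :: "('a \<Rightarrow> real) \<Rightarrow> ('a \<Rightarrow> real) \<Rightarrow> real" where
  "centred_form f g = kform f g + (\<integral>x. (1 - mass x) * (f x * g x) \<partial>M) - (\<integral>x. f x \<partial>M) * (\<integral>x. g x \<partial>M)"

sublocale pair: pair_sigma_finite M M by standard

lemma measurable_s_section[measurable]:
  "x \<in> space M \<Longrightarrow> (\<lambda>y. s x y) \<in> borel_measurable M"
proof -
  assume "x \<in> space M"
  then have "(\<lambda>y. s (fst (x, y)) (snd (x, y))) \<in> borel_measurable M"
    by (intro measurable_compose[OF measurable_Pair1' s_measurable])
  then show ?thesis by simp
qed

lemma integrable_s_section: "x \<in> space M \<Longrightarrow> integrable M (\<lambda>y. s x y)"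
  using s_mass[of x] by (intro integrableI_nonneg) (auto simp: s_nonneg intro: le_less_trans)

lemma measurable_mass[measurable]: "mass \<in> borel_measurable M"
proof -
  have "(\<lambda>x. \<integral>y. s (fst (x, y)) (snd (x, y)) \<partial>M) \<in> borel_measurable M"
    by (intro borel_measurable_lebesgue_integral) simp
  then show ?thesis unfolding mass_def[abs_def] by simp
qed

lemma mass_nonneg: "0 \<le> mass x"
  unfolding mass_def by (intro Bochner_Integration.integral_nonneg) (simp add: s_nonneg)

lemma mass_le_1: "x \<in> space M \<Longrightarrow> mass x \<le> 1"
  unfolding mass_def using s_mass[of x] integrable_s_section[of x]
  by (simp add: nn_integral_eq_integral s_nonneg)

lemma L2_D: "f \<in> L2_functions M \<Longrightarrow> f \<in> borel_measurable M"
  "f \<in> L2_functions M \<Longrightarrow> integrable M (\<lambda>x. (f x)\<^sup>2)"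
  by (auto simp: L2_functions_def)

lemma integrable_mult_L2:
  assumes "f \<in> L2_functions M" "g \<in> L2_functions M"
  shows "integrable M (\<lambda>x. f x * g x)"
proof (rule Bochner_Integration.integrable_bound[of _ "\<lambda>x. (f x)\<^sup>2 + (g x)\<^sup>2"])
  note [measurable] = assms[THEN L2_D(1)]
  show "(\<lambda>x. f x * g x) \<in> borel_measurable M" by measurable
  show "integrable M (\<lambda>x. (f x)\<^sup>2 + (g x)\<^sup>2)" using assms by (simp add: L2_functions_def)
  from abs_mult_le_sum_squares show "AE x in M. norm (f x * g x) \<le> norm ((f x)\<^sup>2 + (g x)\<^sup>2)" by simp
qed

lemma const_L2: "(\<lambda>_. c) \<in> L2_functions M"
  by (simp add: L2_functions_def)

lemma integrable_L2: "f \<in> L2_functions M \<Longrightarrow> integrable M f"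
  using integrable_mult_L2[OF _ const_L2[of 1], of f] by simp

lemma add_mult_L2:
  assumes "f \<in> L2_functions M" "g \<in> L2_functions M"
  shows "(\<lambda>x. f x + t * g x) \<in> L2_functions M"
proof -
  note [measurable] = assms[THEN L2_D(1)]
  have "integrable M (\<lambda>x. (f x)\<^sup>2 + 2 * t * (f x * g x) + t\<^sup>2 * (g x)\<^sup>2)"
    using assms integrable_mult_L2[OF assms] by (simp add: L2_functions_def)
  also have "(\<lambda>x. (f x)\<^sup>2 + 2 * t * (f x * g x) + t\<^sup>2 * (g x)\<^sup>2) = (\<lambda>x. (f x + t * g x)\<^sup>2)"
    by (auto simp: power2_eq_square algebra_simps)
  finally show ?thesis by (simp add: L2_functions_def)
qed

lemma integrable_s_fst:
  assumes "f \<in> L2_functions M"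
  shows "integrable (M \<Otimes>\<^sub>M M) (\<lambda>p. s (fst p) (snd p) * (f (fst p))\<^sup>2)"
proof (rule integrableI_nonneg)
  note [measurable] = assms[THEN L2_D(1)]
  show "(\<lambda>p. s (fst p) (snd p) * (f (fst p))\<^sup>2) \<in> borel_measurable (M \<Otimes>\<^sub>M M)" by measurable
  have "(\<integral>\<^sup>+p. ennreal (s (fst p) (snd p) * (f (fst p))\<^sup>2) \<partial>(M \<Otimes>\<^sub>M M))
      = (\<integral>\<^sup>+x. (\<integral>\<^sup>+y. ennreal (s x y * (f x)\<^sup>2) \<partial>M) \<partial>M)"
    by (subst nn_integral_fst[symmetric]) simp_all
  also have "\<dots> = (\<integral>\<^sup>+x. (\<integral>\<^sup>+y. s x y \<partial>M) * ennreal ((f x)\<^sup>2) \<partial>M)"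
    by (intro nn_integral_cong) (simp add: ennreal_mult s_nonneg nn_integral_multc)
  also have "\<dots> \<le> (\<integral>\<^sup>+x. 1 * ennreal ((f x)\<^sup>2) \<partial>M)"
    by (intro nn_integral_mono mult_right_mono s_mass) auto
  also have "\<dots> < \<infinity>"
    using assms by (simp add: L2_functions_def nn_integral_eq_integral)
  finally show "(\<integral>\<^sup>+p. ennreal (s (fst p) (snd p) * (f (fst p))\<^sup>2) \<partial>(M \<Otimes>\<^sub>M M)) < \<infinity>" .
qed (simp add: s_nonneg)

lemma integrable_s_snd:
  assumes "f \<in> L2_functions M"
  shows "integrable (M \<Otimes>\<^sub>M M) (\<lambda>p. s (fst p) (snd p) * (f (snd p))\<^sup>2)"
  using pair.integrable_product_swap[OF integrable_s_fst[OF assms]]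
  by (simp add: case_prod_unfold s_sym[of "snd _"])

lemma integrable_kform:
  assumes "f \<in> L2_functions M" "g \<in> L2_functions M"
  shows "integrable (M \<Otimes>\<^sub>M M) (\<lambda>p. s (fst p) (snd p) * f (fst p) * g (snd p))"
proof (rule Bochner_Integration.integrable_bound)
  note [measurable] = assms[THEN L2_D(1)]
  show "integrable (M \<Otimes>\<^sub>M M) (\<lambda>p. s (fst p) (snd p) * (f (fst p))\<^sup>2 + s (fst p) (snd p) * (g (snd p))\<^sup>2)"
    using integrable_s_fst[OF assms(1)] integrable_s_snd[OF assms(2)] by simp
  show "(\<lambda>p. s (fst p) (snd p) * f (fst p) * g (snd p)) \<in> borel_measurable (M \<Otimes>\<^sub>M M)" by measurable
  have "norm (c * a * b) \<le> norm (c * a\<^sup>2 + c * b\<^sup>2)" if "c \<ge> 0" for a b c :: real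
    using that mult_left_mono[OF abs_mult_le_sum_squares, of c a b]
    by (simp add: abs_mult ring_distribs mult.assoc)
  then show "AE p in M \<Otimes>\<^sub>M M. norm (s (fst p) (snd p) * f (fst p) * g (snd p))
      \<le> norm (s (fst p) (snd p) * (f (fst p))\<^sup>2 + s (fst p) (snd p) * (g (snd p))\<^sup>2)"
    by (simp add: s_nonneg)
qed

lemma integrable_rejection:
  assumes "f \<in> L2_functions M" "g \<in> L2_functions M"
  shows "integrable M (\<lambda>x. mass x * (f x * g x))" "integrable M (\<lambda>x. (1 - mass x) * (f x * g x))"
proof -
  note [measurable] = assms[THEN L2_D(1)]
  show 1: "integrable M (\<lambda>x. mass x * (f x * g x))"
  proof (rule Bochner_Integration.integrable_bound[OF integrable_mult_L2[OF assms]])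
    show "AE x in M. norm (mass x * (f x * g x)) \<le> norm (f x * g x)"
      by (rule AE_I2) (simp add: abs_mult mass_nonneg mass_le_1 mult_left_le_one_le)
  qed measurable
  show "integrable M (\<lambda>x. (1 - mass x) * (f x * g x))"
    using Bochner_Integration.integrable_diff[OF integrable_mult_L2[OF assms] 1] by (simp add: algebra_simps)
qed

lemma kform_sym: "f \<in> L2_functions M \<Longrightarrow> g \<in> L2_functions M \<Longrightarrow> kform f g = kform g f"
  unfolding kform_def
  using pair.integral_product_swap[of "\<lambda>p. s (fst p) (snd p) * f (fst p) * g (snd p)"]
    borel_measurable_integrable[OF integrable_kform[of f g]]
  by (simp add: case_prod_unfold s_sym[of "snd _"] mult_ac)

lemma centred_form_expand:
  assumes f: "f \<in> L2_functions M" and g: "g \<in> L2_functions M"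
  shows "centred_form (\<lambda>x. f x + t * g x) (\<lambda>x. f x + t * g x)
    = centred_form f f + 2 * t * centred_form f g + t\<^sup>2 * centred_form g g"
proof -
  let ?k = "\<lambda>f g p. s (fst p) (snd p) * f (fst p) * g (snd p)"
  let ?r = "\<lambda>f g x. (1 - mass x) * (f x * g x)"
  have "kform (\<lambda>x. f x + t * g x) (\<lambda>x. f x + t * g x)
      = (\<integral>p. ?k f f p + t * ?k f g p + t * ?k g f p + t\<^sup>2 * ?k g g p \<partial>(M \<Otimes>\<^sub>M M))"
    unfolding kform_def by (intro Bochner_Integration.integral_cong) (auto simp: algebra_simps power2_eq_square)
  also have "\<dots> = kform f f + t * kform f g + t * kform g f + t\<^sup>2 * kform g g"
    unfolding kform_def using integrable_kform[OF f f] integrable_kform[OF f g] integrable_kform[OF g f]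
        integrable_kform[OF g g]
    by simp
  finally have 1: "kform (\<lambda>x. f x + t * g x) (\<lambda>x. f x + t * g x) = kform f f + 2 * t * kform f g + t\<^sup>2 * kform g g"
    using kform_sym[OF f g] by simp
  have "(\<integral>x. ?r (\<lambda>x. f x + t * g x) (\<lambda>x. f x + t * g x) x \<partial>M) = (\<integral>x. ?r f f x + 2 * t * ?r f g x + t\<^sup>2 * ?r g g x \<partial>M)"
    by (intro Bochner_Integration.integral_cong) (auto simp: algebra_simps power2_eq_square)
  also have "\<dots> = (\<integral>x. ?r f f x \<partial>M) + 2 * t * (\<integral>x. ?r f g x \<partial>M) + t\<^sup>2 * (\<integral>x. ?r g g x \<partial>M)"
    using integrable_rejection(2)[OF f f] integrable_rejection(2)[OF f g] integrable_rejection(2)[OF g g] by simp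
  finally have 2: "(\<integral>x. ?r (\<lambda>x. f x + t * g x) (\<lambda>x. f x + t * g x) x \<partial>M)
    = (\<integral>x. ?r f f x \<partial>M) + 2 * t * (\<integral>x. ?r f g x \<partial>M) + t\<^sup>2 * (\<integral>x. ?r g g x \<partial>M)" .
  have 3: "(\<integral>x. f x + t * g x \<partial>M) = (\<integral>x. f x \<partial>M) + t * (\<integral>x. g x \<partial>M)"
    using integrable_L2[OF f] integrable_L2[OF g] by simp
  show ?thesis unfolding centred_form_def 1 2 3
    by (simp add: algebra_simps power2_eq_square)
qed

lemma kform_one: "f \<in> L2_functions M \<Longrightarrow> kform f (\<lambda>_. 1) = (\<integral>x. mass x * f x \<partial>M)"
  using pair.integral_fst'[OF integrable_kform[OF _ const_L2[of 1]], of f]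
  unfolding kform_def mass_def by (simp add: mult.commute)

lemma dirichlet_eq:
  assumes f: "f \<in> L2_functions M"
  shows "dirichlet f = (\<integral>x. mass x * (f x * f x) \<partial>M) - kform f f"
    and "integrable (M \<Otimes>\<^sub>M M) (\<lambda>p. s (fst p) (snd p) * (f (fst p) - f (snd p))\<^sup>2)"
proof -
  let ?a = "\<lambda>p. s (fst p) (snd p) * (f (fst p))\<^sup>2" and ?b = "\<lambda>p. s (fst p) (snd p) * (f (snd p))\<^sup>2"
  let ?k = "\<lambda>p. s (fst p) (snd p) * f (fst p) * f (snd p)"
  note int = integrable_s_fst[OF f] integrable_s_snd[OF f] integrable_kform[OF f f]
  have eq: "s (fst p) (snd p) * (f (fst p) - f (snd p))\<^sup>2 = ?a p + ?b p - 2 * ?k p" for p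
    by (simp add: power2_eq_square algebra_simps)
  show "integrable (M \<Otimes>\<^sub>M M) (\<lambda>p. s (fst p) (snd p) * (f (fst p) - f (snd p))\<^sup>2)"
    unfolding eq using int by simp
  have a: "(\<integral>p. ?a p \<partial>(M \<Otimes>\<^sub>M M)) = (\<integral>x. mass x * (f x * f x) \<partial>M)"
    using pair.integral_fst'[OF int(1)] by (simp add: mass_def power2_eq_square)
  have b: "(\<integral>p. ?b p \<partial>(M \<Otimes>\<^sub>M M)) = (\<integral>p. ?a p \<partial>(M \<Otimes>\<^sub>M M))"
    using pair.integral_product_swap[OF borel_measurable_integrable[OF int(1)]]
    by (simp add: case_prod_unfold s_sym[of "snd _"])
  have "(\<integral>p. s (fst p) (snd p) * (f (fst p) - f (snd p))\<^sup>2 \<partial>(M \<Otimes>\<^sub>M M))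
      = (\<integral>p. ?a p \<partial>(M \<Otimes>\<^sub>M M)) + (\<integral>p. ?b p \<partial>(M \<Otimes>\<^sub>M M)) - 2 * kform f f"
    unfolding eq kform_def using int by simp
  then show "dirichlet f = (\<integral>x. mass x * (f x * f x) \<partial>M) - kform f f"
    unfolding dirichlet_def b a by simp
qed

lemma centred_form_dirichlet:
  assumes f: "f \<in> L2_functions M"
  shows "centred_form f f = variance f - dirichlet f"
proof -
  have "(\<integral>x. (1 - mass x) * (f x * f x) \<partial>M) = (\<integral>x. (f x)\<^sup>2 \<partial>M) - (\<integral>x. mass x * (f x * f x) \<partial>M)"
    using integrable_rejection(1)[OF f f] f by (simp add: algebra_simps L2_functions_def power2_eq_square)
  then show ?thesis
    using variance_eq[of f] integrable_L2[OF f] f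
    by (simp add: centred_form_def dirichlet_eq(1)[OF f] L2_functions_def power2_eq_square)
qed

lemma step_L2:
  assumes f: "f \<in> L2_functions M"
  shows "step f \<in> L2_functions M"
proof -
  note [measurable] = f[THEN L2_D(1)]
  have m: "(\<lambda>x. \<integral>y. s (fst (x, y)) (snd (x, y)) * f (snd (x, y)) \<partial>M) \<in> borel_measurable M"
    by (intro borel_measurable_lebesgue_integral) measurable
  then have [measurable]: "step f \<in> borel_measurable M"
    unfolding step_def[abs_def] by simp
  have AE1: "AE x in M. integrable M (\<lambda>y. s x y * f y)"
    using pair.AE_integrable_fst'[OF integrable_kform[OF const_L2[of 1] f]] by simp
  have AE2: "AE x in M. integrable M (\<lambda>y. s x y * (f y)\<^sup>2)"
    using pair.AE_integrable_fst'[OF integrable_s_snd[OF f]] by simp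
  have int: "integrable M (\<lambda>x. \<integral>y. s x y * (f y)\<^sup>2 \<partial>M)"
    using pair.integrable_fst'[OF integrable_s_snd[OF f]] by simp
  have "integrable M (\<lambda>x. (step f x)\<^sup>2)"
  proof (rule Bochner_Integration.integrable_bound)
    show "integrable M (\<lambda>x. 2 * (\<integral>y. s x y * (f y)\<^sup>2 \<partial>M) + 2 * (f x)\<^sup>2)"
      using int f by (simp add: L2_functions_def)
    show "AE x in M. norm ((step f x)\<^sup>2) \<le> norm (2 * (\<integral>y. s x y * (f y)\<^sup>2 \<partial>M) + 2 * (f x)\<^sup>2)"
      using AE1 AE2 AE_space
    proof (eventually_elim, goal_cases)
      case (1 x)
      note True = 1(3)
      show ?case
      proof -
        \<comment> \<open>Jensen for the sub-probability density \<open>s x\<close>: the square is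
          expanded about the unnormalised mean \<open>c\<close>, and \<open>mass x \<le> 1\<close>
          turns \<open>- 2 * c * c + c\<^sup>2 * mass x\<close> into at most
          \<open>- c\<^sup>2\<close>.\<close>
        define c where "c = (\<integral>y. s x y * f y \<partial>M)"
        have "0 \<le> (\<integral>y. s x y * (f y - c)\<^sup>2 \<partial>M)" by (intro Bochner_Integration.integral_nonneg) (simp add: s_nonneg)
        also have "\<dots> = (\<integral>y. s x y * (f y)\<^sup>2 - 2 * c * (s x y * f y) + c\<^sup>2 * s x y \<partial>M)"
          by (intro Bochner_Integration.integral_cong) (auto simp: power2_eq_square algebra_simps)
        also have "\<dots> = (\<integral>y. s x y * (f y)\<^sup>2 \<partial>M) - 2 * c * c + c\<^sup>2 * mass x"
          using 1 integrable_s_section[OF True] by (simp add: c_def mass_def)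
        also have "\<dots> \<le> (\<integral>y. s x y * (f y)\<^sup>2 \<partial>M) - 2 * c * c + c\<^sup>2 * 1"
          using mass_le_1[OF True] by (intro add_left_mono mult_left_mono) auto
        finally have c: "c\<^sup>2 \<le> (\<integral>y. s x y * (f y)\<^sup>2 \<partial>M)" by (simp add: power2_eq_square)
        have "((1 - mass x) * f x)\<^sup>2 \<le> 1 * (f x)\<^sup>2"
          unfolding power_mult_distrib using mass_le_1[OF True] mass_nonneg[of x]
          by (intro mult_right_mono power_le_one) auto
        moreover have "(a + b)\<^sup>2 \<le> 2 * a\<^sup>2 + 2 * b\<^sup>2" for a b :: real
          using sum_squares_bound[of a b] by (simp add: power2_sum)
        from this[of c "(1 - mass x) * f x"]
        have "(step f x)\<^sup>2 \<le> 2 * c\<^sup>2 + 2 * ((1 - mass x) * f x)\<^sup>2" by (simp add: step_def c_def)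
        ultimately have "(step f x)\<^sup>2 \<le> 2 * (\<integral>y. s x y * (f y)\<^sup>2 \<partial>M) + 2 * (f x)\<^sup>2" using c by simp
        then show ?thesis by simp
      qed
    qed
  qed measurable
  then show ?thesis by (simp add: L2_functions_def)
qed

lemma inner_step:
  assumes f: "f \<in> L2_functions M" and g: "g \<in> L2_functions M"
  shows "(\<integral>x. g x * (step f x - expectation f) \<partial>M) = centred_form g f"
proof -
  have i1: "integrable M (\<lambda>x. g x * (\<integral>y. s x y * f y \<partial>M))"
    using pair.integrable_fst'[OF integrable_kform[OF g f]] by (simp add: mult.assoc mult.left_commute[of "s _ _"])
  have "kform g f = (\<integral>x. g x * (\<integral>y. s x y * f y \<partial>M) \<partial>M)"
    unfolding kform_def using pair.integral_fst'[OF integrable_kform[OF g f]]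
    by (simp add: mult.assoc mult.left_commute[of "s _ _"])
  moreover have "g x * (step f x - expectation f)
      = g x * (\<integral>y. s x y * f y \<partial>M) + (1 - mass x) * (g x * f x) - g x * expectation f" for x
    by (simp add: step_def algebra_simps)
  ultimately show ?thesis unfolding centred_form_def
    using i1 integrable_rejection(2)[OF g f] integrable_L2[OF g] by simp
qed

text \<open>The centred operator is self-adjoint and nonnegative, so its quadratic form determines its norm.\<close>

theorem step_contraction:
  assumes pos: "\<And>f. f \<in> L2_functions M \<Longrightarrow> 0 \<le> kform f f"
    and gap: "\<And>f. f \<in> L2_functions M \<Longrightarrow> \<kappa> * variance f \<le> dirichlet f"
    and \<kappa>: "0 \<le> \<kappa>" "\<kappa> \<le> 1" and f: "f \<in> L2_functions M"
  shows "(\<integral>x. (step f x - expectation f)\<^sup>2 \<partial>M) \<le> (1 - \<kappa>)\<^sup>2 * (\<integral>x. (f x)\<^sup>2 \<partial>M)"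
proof -
  have nonneg: "0 \<le> centred_form g g" if g: "g \<in> L2_functions M" for g
  proof -
    let ?c = "expectation g" and ?o = "\<lambda>_::'a. 1::real"
    let ?g = "\<lambda>x. g x + (- ?c) * ?o x"
    have g': "?g \<in> L2_functions M" by (rule add_mult_L2[OF g const_L2])
    \<comment> \<open>Both \<open>step\<close> and the expectation fix constants, so these lie in
      the kernel of the form. Subtracting the mean therefore leaves the form unchanged, while it
      removes the only negative term.\<close>
    have o: "centred_form h ?o = 0" if h: "h \<in> L2_functions M" for h
      using integrable_rejection[OF h const_L2[of 1]] kform_one[OF h] integrable_L2[OF h]
      by (simp add: centred_form_def prob_space algebra_simps)
    have "expectation ?g = 0" using integrable_L2[OF g] by (simp add: prob_space)
    moreover have "0 \<le> (\<integral>x. (1 - mass x) * (?g x * ?g x) \<partial>M)"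
      by (rule integral_nonneg_AE) (auto simp: mass_le_1)
    ultimately have "0 \<le> centred_form ?g ?g"
      using pos[OF g'] by (simp add: centred_form_def)
    then show ?thesis
      unfolding centred_form_expand[OF g const_L2] o[OF g] o[OF const_L2] by simp
  qed
  have upper: "centred_form g g \<le> (1 - \<kappa>) * (\<integral>x. (g x)\<^sup>2 \<partial>M)" if g: "g \<in> L2_functions M" for g
  proof -
    have "centred_form g g \<le> (1 - \<kappa>) * variance g"
      using gap[OF g] by (simp add: centred_form_dirichlet[OF g] algebra_simps)
    also have "\<dots> \<le> (1 - \<kappa>) * (\<integral>x. (g x)\<^sup>2 \<partial>M)"
      using \<kappa> variance_eq[of g] integrable_L2[OF g] g
      by (intro mult_left_mono) (auto simp: L2_functions_def)
    finally show ?thesis .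
  qed
  define T where "T = (\<lambda>x. step f x - expectation f)"
  define A where "A = (\<integral>x. (T x)\<^sup>2 \<partial>M)"
  have T: "T \<in> L2_functions M"
    using add_mult_L2[OF step_L2[OF f] const_L2[of 1], of "- expectation f"] by (simp add: T_def)
  \<comment> \<open>The squared norm of the image is the form at image and argument. Cauchy-Schwarz
    for the nonnegative form then bounds it by two values of the form on the diagonal, each
    controlled by \<open>upper\<close>; one factor \<open>A\<close> cancels at the end.\<close>
  have "A = centred_form T f"
    using inner_step[OF f T] by (simp add: A_def T_def power2_eq_square)
  moreover have "(centred_form T f)\<^sup>2 \<le> centred_form T T * centred_form f f"
    using nonneg[OF add_mult_L2[OF T f]] unfolding centred_form_expand[OF T f]
    by (rule quadratic_nonneg_discriminant)
  moreover have "centred_form T T * centred_form f f \<le> ((1 - \<kappa>) * A) * ((1 - \<kappa>) * (\<integral>x. (f x)\<^sup>2 \<partial>M))"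
    unfolding A_def using \<kappa> by (intro mult_mono upper T f nonneg mult_nonneg_nonneg
        Bochner_Integration.integral_nonneg) auto
  ultimately have le: "A * A \<le> A * ((1 - \<kappa>)\<^sup>2 * (\<integral>x. (f x)\<^sup>2 \<partial>M))"
    by (simp add: power2_eq_square mult_ac)
  have "A \<le> (1 - \<kappa>)\<^sup>2 * (\<integral>x. (f x)\<^sup>2 \<partial>M)"
  proof (cases "A = 0")
    case False
    moreover have "A \<ge> 0" by (simp add: A_def)
    ultimately show ?thesis using le by (simp add: mult_le_cancel_left)
  qed simp
  then show ?thesis by (simp add: A_def T_def)
qed

section \<open>Reduction to bounded functions, and positivity from mixtures\<close>

lemma gap_of_bounded:
  assumes gap: "\<And>f C. f \<in> borel_measurable M \<Longrightarrow> (\<And>x. \<bar>f x\<bar> \<le> C) \<Longrightarrow> \<kappa> * variance f \<le> dirichlet f"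
    and f: "f \<in> L2_functions M"
  shows "\<kappa> * variance f \<le> dirichlet f"
proof -
  note [measurable] = f[THEN L2_D(1)]
  define F where "F n x = max (- real n) (min (real n) (f x))" for n x
  have [measurable]: "F n \<in> borel_measurable M" for n unfolding F_def by measurable
  have Fb: "\<bar>F n x\<bar> \<le> real n" for n x unfolding F_def by auto
  have Ff: "\<bar>F n x\<bar> \<le> \<bar>f x\<bar>" for n x unfolding F_def by auto
  have FL: "F n \<in> L2_functions M" for n
  proof -
    have "integrable M (\<lambda>x. (F n x)\<^sup>2)"
      by (rule Bochner_Integration.integrable_bound[OF L2_D(2)[OF f]])
        (auto simp: Ff abs_le_square_iff[symmetric])
    then show ?thesis by (simp add: L2_functions_def)
  qed
  have lim: "(\<lambda>n. F n x) \<longlonglongrightarrow> f x" for x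
  proof (rule tendsto_eventually)
    obtain n0 :: nat where "\<bar>f x\<bar> \<le> real n0" using real_arch_simple by blast
    then show "\<forall>\<^sub>F n in sequentially. F n x = f x"
      unfolding F_def by (intro eventually_sequentiallyI[of n0]) auto
  qed
  have 1: "(\<lambda>n. expectation (F n)) \<longlonglongrightarrow> expectation f"
    by (rule integral_dominated_convergence[where w="\<lambda>x. \<bar>f x\<bar>"])
      (use integrable_L2[OF f] Ff lim in auto)
  have 2: "(\<lambda>n. \<integral>x. (F n x)\<^sup>2 \<partial>M) \<longlonglongrightarrow> (\<integral>x. (f x)\<^sup>2 \<partial>M)"
    by (rule integral_dominated_convergence[where w="\<lambda>x. (f x)\<^sup>2"])
      (use L2_D(2)[OF f] Ff lim in \<open>auto simp: abs_le_square_iff[symmetric] intro!: tendsto_intros\<close>)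
  have var: "variance g = (\<integral>x. (g x)\<^sup>2 \<partial>M) - (expectation g)\<^sup>2" if "g \<in> L2_functions M" for g
    using variance_eq[OF integrable_L2[OF that] L2_D(2)[OF that]] .
  have "(\<lambda>n. \<kappa> * variance (F n)) \<longlonglongrightarrow> \<kappa> * variance f"
    unfolding var[OF FL] var[OF f] by (intro tendsto_intros 1 2)
  moreover have "\<kappa> * variance (F n) \<le> dirichlet f" for n
  proof -
    \<comment> \<open>Truncation is 1-Lipschitz, so it does not increase the Dirichlet form, while
      the variances converge by dominated convergence.\<close>
    have "(F n x - F n y)\<^sup>2 \<le> (f x - f y)\<^sup>2" for x y
      unfolding abs_le_square_iff[symmetric] F_def by auto
    then have "dirichlet (F n) \<le> dirichlet f"
      unfolding dirichlet_def
      by (intro divide_right_mono Bochner_Integration.integral_mono dirichlet_eq(2) FL f mult_left_mono)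
          (auto simp: s_nonneg)
    then show ?thesis using gap[of "F n" "real n"] Fb by auto
  qed
  ultimately show ?thesis by (intro LIMSEQ_le_const2[where X="\<lambda>n. \<kappa> * variance (F n)"]) auto
qed

text \<open>For each \<open>w\<close> the form is the square of the integral of
  \<open>\<rho> x w * f x\<close>; Fubini sums these squares over \<open>w\<close>. Absolute
  integrability is inherited from \<open>integrable_kform\<close>.\<close>

lemma kform_nonneg_of_mixture:
  assumes W: "sigma_finite_measure W"
    and [measurable]: "(\<lambda>p. \<rho> (fst p) (snd p)) \<in> borel_measurable (M \<Otimes>\<^sub>M W)"
    and \<rho>: "\<And>x w. 0 \<le> \<rho> x w"
    and s: "\<And>x y. x \<in> space M \<Longrightarrow> y \<in> space M \<Longrightarrow> ennreal (s x y) = (\<integral>\<^sup>+w. ennreal (\<rho> x w * \<rho> y w) \<partial>W)"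
    and f: "f \<in> L2_functions M"
  shows "0 \<le> kform f f"
proof -
  note [measurable] = f[THEN L2_D(1)]
  interpret W: sigma_finite_measure W by fact
  interpret MM: sigma_finite_measure "M \<Otimes>\<^sub>M M" ..
  interpret Q: pair_sigma_finite "M \<Otimes>\<^sub>M M" W ..
  let ?G = "\<lambda>q. \<rho> (fst (fst q)) (snd q) * \<rho> (snd (fst q)) (snd q) * (f (fst (fst q)) * f (snd (fst q)))"
  have [measurable]: "(\<lambda>q. \<rho> (fst (fst q)) (snd q)) \<in> borel_measurable ((M \<Otimes>\<^sub>M M) \<Otimes>\<^sub>M W)"
    using measurable_compose[of "\<lambda>q. (fst (fst q), snd q)" "(M \<Otimes>\<^sub>M M) \<Otimes>\<^sub>M W" "M \<Otimes>\<^sub>M W" "\<lambda>p. \<rho> (fst p) (snd p)" borel]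
    by simp
  have [measurable]: "(\<lambda>q. \<rho> (snd (fst q)) (snd q)) \<in> borel_measurable ((M \<Otimes>\<^sub>M M) \<Otimes>\<^sub>M W)"
    using measurable_compose[of "\<lambda>q. (snd (fst q), snd q)" "(M \<Otimes>\<^sub>M M) \<Otimes>\<^sub>M W" "M \<Otimes>\<^sub>M W" "\<lambda>p. \<rho> (fst p) (snd p)" borel]
    by simp
  have s': "(\<integral>\<^sup>+w. ennreal (\<rho> (fst p) w * \<rho> (snd p) w) \<partial>W) = ennreal (s (fst p) (snd p))"
    if "p \<in> space (M \<Otimes>\<^sub>M M)" for p
    using that s[of "fst p" "snd p"] by (auto simp: space_pair_measure)
  have [measurable]: "(\<lambda>w. \<rho> (fst p) w) \<in> borel_measurable W" "(\<lambda>w. \<rho> (snd p) w) \<in> borel_measurable W"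
    if "p \<in> space (M \<Otimes>\<^sub>M M)" for p
    using that measurable_compose[OF measurable_Pair1'[of "fst p" M W], of "\<lambda>p. \<rho> (fst p) (snd p)"]
      measurable_compose[OF measurable_Pair1'[of "snd p" M W], of "\<lambda>p. \<rho> (fst p) (snd p)"]
    by (auto simp: space_pair_measure)
  have int: "integrable ((M \<Otimes>\<^sub>M M) \<Otimes>\<^sub>M W) ?G"
  proof (rule integrableI_bounded)
    have "(\<integral>\<^sup>+q. ennreal (norm (?G q)) \<partial>((M \<Otimes>\<^sub>M M) \<Otimes>\<^sub>M W))
        = (\<integral>\<^sup>+p. (\<integral>\<^sup>+w. ennreal (\<rho> (fst p) w * \<rho> (snd p) w) * ennreal \<bar>f (fst p) * f (snd p)\<bar> \<partial>W) \<partial>(M \<Otimes>\<^sub>M M))"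
      by (subst W.nn_integral_fst[symmetric]) (simp_all add: abs_mult \<rho> ennreal_mult)
    also have "\<dots> = (\<integral>\<^sup>+p. ennreal (s (fst p) (snd p)) * ennreal \<bar>f (fst p) * f (snd p)\<bar> \<partial>(M \<Otimes>\<^sub>M M))"
      by (intro nn_integral_cong) (simp add: nn_integral_multc s')
    also have "\<dots> = (\<integral>\<^sup>+p. ennreal (norm (s (fst p) (snd p) * f (fst p) * f (snd p))) \<partial>(M \<Otimes>\<^sub>M M))"
      by (simp add: abs_mult s_nonneg ennreal_mult mult.assoc)
    also have "\<dots> < \<infinity>"
      using integrable_kform[OF f f] by (simp add: integrable_iff_bounded)
    finally show "(\<integral>\<^sup>+q. ennreal (norm (?G q)) \<partial>((M \<Otimes>\<^sub>M M) \<Otimes>\<^sub>M W)) < \<infinity>" .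
  qed measurable
  have "kform f f = (\<integral>p. (\<integral>w. ?G (p, w) \<partial>W) \<partial>(M \<Otimes>\<^sub>M M))"
    unfolding kform_def
  proof (intro Bochner_Integration.integral_cong refl)
    fix p assume p: "p \<in> space (M \<Otimes>\<^sub>M M)"
    have "(\<integral>w. \<rho> (fst p) w * \<rho> (snd p) w \<partial>W) = s (fst p) (snd p)"
      using p s'[OF p] by (intro integral_eq_nn_integral[THEN trans]) (simp_all add: \<rho> s_nonneg)
    then show "s (fst p) (snd p) * f (fst p) * f (snd p) = (\<integral>w. ?G (p, w) \<partial>W)"
      by simp
  qed
  also have "\<dots> = (\<integral>w. (\<integral>p. ?G (p, w) \<partial>(M \<Otimes>\<^sub>M M)) \<partial>W)"
    using Q.Fubini_integral[of "\<lambda>p w. ?G (p, w)"] int by (simp add: case_prod_unfold)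
  finally have "kform f f = (\<integral>w. (\<integral>p. ?G (p, w) \<partial>(M \<Otimes>\<^sub>M M)) \<partial>W)" .
  moreover have "0 \<le> (\<integral>p. ?G (p, w) \<partial>(M \<Otimes>\<^sub>M M))" for w
    using integral_tensor_square_nonneg[of "\<lambda>x. \<rho> x w * f x"] by (simp add: mult_ac)
  ultimately show ?thesis by (simp add: Bochner_Integration.integral_nonneg)
qed

end

section \<open>Gaussian measures\<close>

text \<open>Vectors are plain functions, read at indices below \<open>m\<close>, so that points of
  \<open>block_space\<close> can be used as they are. The passage to library vectors and matrices is
  made once, in \<open>scalar_prod_vec\<close> and \<open>mult_mat_vec_index\<close>.\<close>

definition dot :: "nat \<Rightarrow> (nat \<Rightarrow> real) \<Rightarrow> (nat \<Rightarrow> real) \<Rightarrow> real" where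
  "dot m u v = (\<Sum>i<m. u i * v i)"

definition mv :: "nat \<Rightarrow> (nat \<Rightarrow> nat \<Rightarrow> real) \<Rightarrow> (nat \<Rightarrow> real) \<Rightarrow> nat \<Rightarrow> real" where
  "mv m a v i = (\<Sum>k<m. a i k * v k)"

lemma dot_commute: "dot m u v = dot m v u"
  by (simp add: dot_def mult.commute)

lemma dot_cong: "(\<And>i. i < m \<Longrightarrow> u i = u' i) \<Longrightarrow> (\<And>i. i < m \<Longrightarrow> v i = v' i) \<Longrightarrow> dot m u v = dot m u' v'"
  unfolding dot_def by (intro sum.cong) auto

lemma dot_lincomb_left: "dot m (\<lambda>i. c * x i + s * y i) z = c * dot m x z + s * dot m y z"
  by (simp add: dot_def sum_distrib_left sum.distrib algebra_simps)

lemma dot_lincomb_right: "dot m z (\<lambda>i. c * x i + s * y i) = c * dot m z x + s * dot m z y"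
  by (simp add: dot_def sum_distrib_left sum.distrib algebra_simps)

lemma dot_nonneg[simp]: "0 \<le> dot m x x"
  by (simp add: dot_def sum_nonneg)

lemma dot_restrict[simp]:
  "dot m (\<lambda>i\<in>{..<m}. x i) y = dot m x y" "dot m y (\<lambda>i\<in>{..<m}. x i) = dot m y x"
  by (auto simp: dot_def intro!: sum.cong)

lemma mv_restrict[simp]: "mv m a (\<lambda>i\<in>{..<m}. x i) = mv m a x"
  by (auto simp: mv_def intro!: sum.cong)

lemma mv_cong: "(\<And>i. i < m \<Longrightarrow> v i = v' i) \<Longrightarrow> mv m a v = mv m a v'"
  by (auto simp: mv_def intro!: sum.cong)

lemma mv_lincomb: "mv m a (\<lambda>i. c * x i + s * y i) = (\<lambda>i. c * mv m a x i + s * mv m a y i)"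
  by (auto simp: mv_def sum_distrib_left sum.distrib algebra_simps)

lemma dot_Cauchy_Schwarz: "(dot m u v)\<^sup>2 \<le> dot m u u * dot m v v"
  unfolding dot_def using Cauchy_Schwarz_ineq_sum[of u v "{..<m}"] by (simp add: power2_eq_square)

lemma dot_mv_symmetric:
  assumes "\<And>i k. i < m \<Longrightarrow> k < m \<Longrightarrow> a i k = a k i"
  shows "dot m x (mv m a y) = dot m y (mv m a x)"
proof -
  have "dot m x (mv m a y) = (\<Sum>i<m. \<Sum>k<m. x i * a i k * y k)"
    by (simp add: dot_def mv_def sum_distrib_left mult.assoc)
  also have "\<dots> = (\<Sum>k<m. \<Sum>i<m. x i * a i k * y k)" by (rule sum.swap)
  also have "\<dots> = (\<Sum>k<m. \<Sum>i<m. y k * a k i * x i)"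
    by (intro sum.cong refl) (simp add: assms)
  also have "\<dots> = dot m y (mv m a x)" by (simp add: dot_def mv_def sum_distrib_left mult.assoc)
  finally show ?thesis .
qed

lemma measurable_dot[measurable (raw)]:
  assumes "\<And>i. i < m \<Longrightarrow> (\<lambda>x. f x i) \<in> borel_measurable N" "\<And>i. i < m \<Longrightarrow> (\<lambda>x. g x i) \<in> borel_measurable N"
  shows "(\<lambda>x. dot m (f x) (g x)) \<in> borel_measurable N"
  unfolding dot_def using assms by (intro borel_measurable_sum borel_measurable_times) auto

lemma measurable_mv[measurable (raw)]:
  assumes "\<And>i. i < m \<Longrightarrow> (\<lambda>x. f x i) \<in> borel_measurable N"
  shows "(\<lambda>x. mv m a (f x) i) \<in> borel_measurable N"
  unfolding mv_def using assms by (intro borel_measurable_sum borel_measurable_times) auto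

section \<open>Second moments from exponential moments\<close>

lemma exp_add_exp_minus_ge: "2 + t\<^sup>2 \<le> exp t + exp (- t)" for t :: real
proof -
  have *: "2 + t\<^sup>2 \<le> exp t + exp (- t)" if "t \<ge> 0" for t :: real
  proof -
    \<comment> \<open>\<open>exp t + exp (- t) - 2\<close> is the square of
      \<open>exp r - exp (- r)\<close>, so it suffices to bound the latter below by
      \<open>2 * r\<close>. The quadratic Taylor bound \<open>p\<close> for \<open>exp r\<close>
      gives this through \<open>p - 1 / p\<close>.\<close>
    define r where "r = t / 2"
    define p where "p = 1 + r + r\<^sup>2 / 2"
    have r: "r \<ge> 0" using that by (simp add: r_def)
    have p1: "p \<ge> 1" using r by (simp add: p_def)
    have pe: "p \<le> exp r" using exp_lower_Taylor_quadratic[OF r] by (simp add: p_def)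
    have "p * p - 2 * r * p - 1 = r^4 / 4"
      unfolding p_def by (simp add: power2_eq_square power4_eq_xxxx algebra_simps)
    then have "2 * r * p \<le> p * p - 1" by (smt (verit) zero_le_even_power even_numeral divide_nonneg_nonneg)
    then have "2 * r \<le> p - 1 / p" using p1 by (simp add: field_simps)
    also have "\<dots> \<le> exp r - exp (- r)"
      using pe p1 by (simp add: exp_minus inverse_eq_divide frac_le diff_mono)
    finally have "(2 * r)\<^sup>2 \<le> (exp r - exp (- r))\<^sup>2" using r by (intro power_mono) auto
    also have "\<dots> = exp t + exp (- t) - 2"
      by (simp add: power2_diff r_def flip: exp_double exp_minus) (simp add: exp_minus)
    finally show ?thesis by (simp add: r_def)
  qed
  show ?thesis using *[of t] *[of "- t"] by (cases "t \<ge> 0") auto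
qed

lemma exp_half_le: "exp (1/2::real) \<le> 5/3"
proof -
  have "exp (1/2::real) ^ 2 \<le> (5/3)^2"
    using e_less_272 by (simp add: power2_eq_square flip: exp_add)
  then show ?thesis by (rule power2_le_imp_le) simp
qed

text \<open>Integrating \<open>2 + (t u)\<^sup>2 \<le> exp (t u) + exp (- t u)\<close> bounds the
  moment by \<open>(2 * exp (t\<^sup>2 * v / 2) - 2) / t\<^sup>2\<close>. At
  \<open>t = 1 / sqrt v\<close> this is \<open>v\<close> times 2 exp(1/2) - 2, at most 10/3 - 2 =
  4/3.\<close>

lemma (in prob_space) second_moment_of_subgaussian:
  assumes [measurable]: "u \<in> borel_measurable M" and v: "0 \<le> v"
    and mgf: "\<And>t. (\<integral>\<^sup>+x. ennreal (exp (t * u x)) \<partial>M) \<le> ennreal (exp (t\<^sup>2 * v / 2))"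
  shows "(\<integral>\<^sup>+x. ennreal ((u x)\<^sup>2) \<partial>M) \<le> ennreal (4/3 * v)"
proof -
  have *: "ennreal (t\<^sup>2) * (\<integral>\<^sup>+x. ennreal ((u x)\<^sup>2) \<partial>M) \<le> ennreal (2 * exp (t\<^sup>2 * v / 2) - 2)" for t
  proof -
    have "2 + ennreal (t\<^sup>2) * (\<integral>\<^sup>+x. ennreal ((u x)\<^sup>2) \<partial>M) = (\<integral>\<^sup>+x. ennreal (2 + t\<^sup>2 * (u x)\<^sup>2) \<partial>M)"
      by (simp add: nn_integral_add ennreal_mult nn_integral_cmult emeasure_space_1)
    also have "\<dots> \<le> (\<integral>\<^sup>+x. ennreal (exp (t * u x)) + ennreal (exp ((- t) * u x)) \<partial>M)"
      using exp_add_exp_minus_ge[of "t * u _"]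
      by (intro nn_integral_mono) (simp add: power_mult_distrib flip: ennreal_plus)
    also have "\<dots> \<le> ennreal (exp (t\<^sup>2 * v / 2)) + ennreal (exp (t\<^sup>2 * v / 2))"
      using mgf[of t] mgf[of "- t"] by (subst nn_integral_add) (auto intro: add_mono)
    also have "\<dots> = 2 + ennreal (2 * exp (t\<^sup>2 * v / 2) - 2)"
      using v by (simp flip: ennreal_plus ennreal_numeral)
    finally show ?thesis by (simp add: ennreal_add_left_cancel_le)
  qed
  show ?thesis
  proof (cases "v = 0")
    case True
    then show ?thesis using *[of 1] by simp
  next
    case False
    define t where "t = 1 / sqrt v"
    have t2: "t\<^sup>2 = 1 / v" using v by (simp add: t_def power_divide)
    have "ennreal (1 / v) * (\<integral>\<^sup>+x. ennreal ((u x)\<^sup>2) \<partial>M) \<le> ennreal (4/3)"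
    proof -
      have "2 * exp (t\<^sup>2 * v / 2) - 2 \<le> 4/3" using exp_half_le False by (simp add: t2)
      then show ?thesis using order_trans[OF *[of t] ennreal_leI] by (simp add: t2)
    qed
    then have "ennreal v * (ennreal (1 / v) * (\<integral>\<^sup>+x. ennreal ((u x)\<^sup>2) \<partial>M)) \<le> ennreal v * ennreal (4/3)"
      by (rule mult_left_mono) simp
    moreover have "ennreal v * (ennreal (1 / v) * X) = X" for X
      using v False by (simp add: mult.assoc[symmetric] flip: ennreal_mult)
    ultimately show ?thesis using v by (simp add: mult.commute flip: ennreal_mult)
  qed
qed

lemma integrable_exp_neg_square:
  assumes "c > 0" shows "integrable lborel (\<lambda>x::real. exp (- c * (x - e)\<^sup>2))"
proof -
  have "(\<lambda>x. exp (- c * (x - e)\<^sup>2)) = (\<lambda>x. sqrt (pi / c) * normal_density e (sqrt (1 / (2 * c))) x)"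
    using assms by (auto simp: normal_density_def field_simps real_sqrt_divide power2_eq_square)
  moreover have "sqrt (1 / (2 * c)) > 0" using assms by simp
  ultimately show ?thesis by (simp only:) (intro integrable_mult_right integrable_normal_density)
qed

lemma integrable_prod_exp_neg_square:
  assumes "c > 0"
  shows "integrable (block_space m) (\<lambda>x. \<Prod>i<m. exp (- c * (x i - e i)\<^sup>2))"
  unfolding block_space_def
  by (intro lborel_product.product_integrable_prod finite_lessThan integrable_exp_neg_square assms)

lemma emeasure_space_block_space: "emeasure (block_space m) (space (block_space m)) \<noteq> 0"
proof -
  have "space (block_space m) = Pi\<^sub>E {..<m} (\<lambda>_. UNIV)" by (simp add: space_block_space PiE_UNIV_domain PiE_def)
  then show ?thesis
    unfolding block_space_def by (simp add: lborel_product.emeasure_PiM)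
qed

lemma integral_pos:
  fixes f :: "'a \<Rightarrow> real"
  assumes int: "integrable M f" and pos: "\<And>x. 0 < f x" and ne: "emeasure M (space M) \<noteq> 0"
  shows "0 < (\<integral>x. f x \<partial>M)"
proof -
  have "(\<integral>x. f x \<partial>M) \<noteq> 0"
  proof
    assume "(\<integral>x. f x \<partial>M) = 0"
    then have "AE x in M. f x = 0"
      using int pos by (subst (asm) integral_nonneg_eq_0_iff_AE) (auto simp: less_imp_le)
    then have "AE x in M. False" using pos by (auto simp: less_imp_neq[symmetric])
    then show False using ne by (simp add: AE_iff_null null_setsD1)
  qed
  moreover have "0 \<le> (\<integral>x. f x \<partial>M)"
    using pos by (intro Bochner_Integration.integral_nonneg) (simp add: less_imp_le)
  ultimately show ?thesis by simp
qed

text \<open>The law is N(0, A^-1); \<open>coercive\<close> bounds the spectrum of A below by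
  \<open>\<psi>\<close>. Invertibility enters as solvability of A w = u, so no inverse matrix
  appears here.\<close>

locale gaussian_block =
  fixes m :: nat and a :: "nat \<Rightarrow> nat \<Rightarrow> real" and \<psi> :: real
  assumes sym: "\<And>i k. i < m \<Longrightarrow> k < m \<Longrightarrow> a i k = a k i"
    and psi_pos: "\<psi> > 0"
    and coercive: "\<And>v. \<psi> * dot m v v \<le> dot m v (mv m a v)"
    and solvable: "\<And>u. \<exists>w. \<forall>i<m. mv m a w i = u i"
begin

abbreviation "A \<equiv> mv m a"
abbreviation "M \<equiv> block_space m"

definition quad :: "(nat \<Rightarrow> real) \<Rightarrow> real" where "quad x = dot m x (A x)"

definition Z :: real where "Z = (\<integral>x. exp (- quad x / 2) \<partial>M)"

definition N :: "(nat \<Rightarrow> real) measure" where "N = density M (\<lambda>x. ennreal (exp (- quad x / 2) / Z))"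

lemma dot_A_commute: "dot m x (A y) = dot m y (A x)"
  by (rule dot_mv_symmetric) (rule sym)

lemma quad_nonneg: "0 \<le> quad x"
proof -
  have "0 \<le> \<psi> * dot m x x" using psi_pos by simp
  then show ?thesis using coercive[of x] unfolding quad_def by linarith
qed

lemma quad_lincomb: "quad (\<lambda>i. c * x i + s * y i) = c\<^sup>2 * quad x + 2 * c * s * dot m x (A y) + s\<^sup>2 * quad y"
  unfolding quad_def mv_lincomb dot_lincomb_left dot_lincomb_right
  by (simp add: dot_A_commute[of y x] power2_eq_square algebra_simps)

lemma quad_restrict[simp]: "quad (\<lambda>i\<in>{..<m}. x i) = quad x"
  by (simp add: quad_def)

lemma measurable_quad[measurable]: "quad \<in> borel_measurable M"
  unfolding quad_def[abs_def] by measurable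

lemma integrable_gauss: "integrable M (\<lambda>x. exp (- quad x / 2))"
proof (rule Bochner_Integration.integrable_bound[OF integrable_prod_exp_neg_square])
  show "0 < \<psi> / 2" using psi_pos by simp
  have "exp (- quad x / 2) \<le> (\<Prod>i<m. exp (- (\<psi> / 2) * (x i - 0)\<^sup>2))" for x
  proof -
    have "(\<Prod>i<m. exp (- (\<psi> / 2) * (x i - 0)\<^sup>2)) = exp (- (\<psi> * dot m x x) / 2)"
      by (simp add: exp_sum[symmetric] dot_def sum_distrib_left sum_divide_distrib power2_eq_square sum_negf)
    then show ?thesis using coercive[of x] by (simp add: quad_def)
  qed
  then show "AE x in M. norm (exp (- quad x / 2)) \<le> norm (\<Prod>i<m. exp (- (\<psi> / 2) * (x i - 0)\<^sup>2))"
    by (simp add: prod_nonneg)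
qed measurable

lemma Z_pos: "Z > 0"
  unfolding Z_def by (rule integral_pos[OF integrable_gauss _ emeasure_space_block_space]) simp

lemma sets_N[simp, measurable_cong]: "sets N = sets M" by (simp add: N_def)
lemma space_N[simp]: "space N = space M" by (simp add: N_def)

lemma nn_integral_N:
  assumes [measurable]: "f \<in> borel_measurable M"
  shows "(\<integral>\<^sup>+x. f x \<partial>N) = (\<integral>\<^sup>+x. ennreal (exp (- quad x / 2) / Z) * f x \<partial>M)"
  unfolding N_def by (rule nn_integral_density) simp_all

lemma integral_N:
  fixes f :: "_ \<Rightarrow> real"
  assumes [measurable]: "f \<in> borel_measurable M"
  shows "(\<integral>x. f x \<partial>N) = (\<integral>x. exp (- quad x / 2) / Z * f x \<partial>M)"
  unfolding N_def using Z_pos by (intro integral_real_density) auto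

lemma prob_space_N: "prob_space N"
proof
  have "emeasure N (space N) = (\<integral>\<^sup>+x. 1 \<partial>N)" by simp
  also have "\<dots> = ennreal (\<integral>x. exp (- quad x / 2) / Z \<partial>M)"
    using integrable_gauss Z_pos by (subst nn_integral_N) (auto simp: nn_integral_eq_integral)
  also have "(\<integral>x. exp (- quad x / 2) / Z \<partial>M) = 1"
    using Z_pos by (simp add: Z_def)
  finally show "emeasure N (space N) = 1" by simp
qed

sublocale N: prob_space N by (rule prob_space_N)

text \<open>Completing the square turns the exponential tilt into a translation by \<open>w\<close>,
  so the constant \<open>Z\<close> cancels and is never evaluated.\<close>

lemma mgf_N: "(\<integral>\<^sup>+x. ennreal (exp (dot m (A w) x)) \<partial>N) = ennreal (exp (quad w / 2))"
proof -
  let ?F = "\<lambda>x. ennreal (exp (quad w / 2)) * ennreal (exp (- quad x / 2) / Z)"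
  have "- quad x / 2 + dot m (A w) x = quad w / 2 + - quad (\<lambda>i\<in>{..<m}. x i + - w i) / 2" for x
    using quad_lincomb[of 1 x "-1" w] by (simp add: dot_commute[of m "A w"] field_simps)
  then have "exp (- quad x / 2) * exp (dot m (A w) x)
      = exp (quad w / 2) * exp (- quad (\<lambda>i\<in>{..<m}. x i + - w i) / 2)" for x
    by (simp only: exp_add[symmetric])
  then have "ennreal (exp (- quad x / 2) / Z) * ennreal (exp (dot m (A w) x)) = ?F (\<lambda>i\<in>{..<m}. x i + - w i)" for x
    using Z_pos by (simp flip: ennreal_mult)
  then have "(\<integral>\<^sup>+x. ennreal (exp (dot m (A w) x)) \<partial>N) = (\<integral>\<^sup>+x. ?F (\<lambda>i\<in>{..<m}. x i + - w i) \<partial>M)"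
    by (subst nn_integral_N) simp_all
  also have "\<dots> = (\<integral>\<^sup>+x. ?F x \<partial>M)"
    by (rule nn_integral_block_space_translate) measurable
  also have "\<dots> = ennreal (exp (quad w / 2)) * (\<integral>\<^sup>+x. 1 \<partial>N)"
    by (subst nn_integral_N) (simp_all add: nn_integral_cmult)
  finally show ?thesis using N.emeasure_space_1 by simp
qed

text \<open>With A w = u the linear function is sub-Gaussian with variance parameter
  \<open>quad w\<close>, which is u' A^-1 u. Cauchy-Schwarz and coercivity give
  \<open>quad w * quad w \<le> (quad w / \<psi>) * dot m u u\<close>, hence the bound by
  \<open>dot m u u / \<psi>\<close>.\<close>

lemma second_moment_N:
  "(\<integral>\<^sup>+x. ennreal ((dot m u x)\<^sup>2) \<partial>N) \<le> ennreal (4/3 * (dot m u u / \<psi>))"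
proof -
  obtain w where w: "\<And>i. i < m \<Longrightarrow> A w i = u i" using solvable[of u] by auto
  have dw: "dot m u x = dot m (A w) x" for x by (rule dot_cong) (simp_all add: w)
  have "(\<integral>\<^sup>+x. ennreal ((dot m (A w) x)\<^sup>2) \<partial>N) \<le> ennreal (4/3 * quad w)"
  proof (rule N.second_moment_of_subgaussian[OF _ quad_nonneg])
    fix t
    have "quad (\<lambda>i. t * w i + 0 * w i) = t\<^sup>2 * quad w" unfolding quad_lincomb by simp
    moreover have "dot m (A (\<lambda>i. t * w i + 0 * w i)) x = t * dot m (A w) x" for x
      unfolding mv_lincomb dot_lincomb_left by simp
    ultimately show "(\<integral>\<^sup>+x. ennreal (exp (t * dot m (A w) x)) \<partial>N) \<le> ennreal (exp (t\<^sup>2 * quad w / 2))"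
      using mgf_N[of "\<lambda>i. t * w i + 0 * w i"] by simp
  qed measurable
  moreover have "quad w \<le> dot m u u / \<psi>"
  proof (cases "quad w = 0")
    case False
    have q: "quad w = dot m w u" unfolding quad_def by (rule dot_cong) (simp_all add: w)
    have "quad w * quad w \<le> dot m w w * dot m u u"
      using dot_Cauchy_Schwarz[of m w u] by (simp add: q power2_eq_square)
    also have "\<dots> \<le> (quad w / \<psi>) * dot m u u"
      using coercive[of w] psi_pos by (intro mult_right_mono) (auto simp: quad_def field_simps)
    finally have "quad w * quad w \<le> quad w * (dot m u u / \<psi>)" by simp
    then show ?thesis using False quad_nonneg[of w] by (subst (asm) mult_le_cancel_left) auto
  qed (use psi_pos in simp)
  ultimately have "(\<integral>\<^sup>+x. ennreal ((dot m (A w) x)\<^sup>2) \<partial>N) \<le> ennreal (4/3 * (dot m u u / \<psi>))"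
    by (elim order_trans) (intro ennreal_leI, simp)
  then show ?thesis by (simp only: dw)
qed


lemma measurable_N_iff[simp]: "borel_measurable N = borel_measurable M"
  by (rule measurable_cong_sets) simp_all

lemma integrable_dot_sq: "integrable N (\<lambda>x. (dot m u x)\<^sup>2)"
proof (rule integrableI_nonneg)
  show "(\<integral>\<^sup>+x. ennreal ((dot m u x)\<^sup>2) \<partial>N) < \<infinity>"
    using second_moment_N[of u] by (rule le_less_trans) simp
qed simp_all

lemma integrable_norm_sq: "integrable N (\<lambda>x. dot m x x)"
proof -
  have "integrable N (\<lambda>x. \<Sum>i<m. (dot m (\<lambda>k. if k = i then 1 else 0) x)\<^sup>2)"
    by (intro Bochner_Integration.integrable_sum integrable_dot_sq)
  also have "(\<lambda>x. \<Sum>i<m. (dot m (\<lambda>k. if k = i then 1 else 0) x)\<^sup>2) = (\<lambda>x. dot m x x)"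
    by (auto simp: dot_def power2_eq_square if_distrib[of "\<lambda>c. c * _"] cong: if_cong intro!: sum.cong)
  finally show ?thesis .
qed

section \<open>The Gaussian Poincare inequality\<close>

abbreviation "NN \<equiv> N \<Otimes>\<^sub>M N"

sublocale NN: pair_prob_space N N by standard

lemma nn_integral_NN:
  assumes [measurable]: "f \<in> borel_measurable (M \<Otimes>\<^sub>M M)"
  shows "(\<integral>\<^sup>+p. f p \<partial>NN) = (\<integral>\<^sup>+p. ennreal (exp (- (quad (fst p) + quad (snd p)) / 2) / Z\<^sup>2) * f p \<partial>(M \<Otimes>\<^sub>M M))"
proof -
  have sN: "sigma_finite_measure (density M (\<lambda>x. ennreal (exp (- quad x / 2) / Z)))"
    using N.sigma_finite_measure_axioms by (simp add: N_def)
  have "NN = density (M \<Otimes>\<^sub>M M) (\<lambda>(x, y). ennreal (exp (- quad x / 2) / Z) * ennreal (exp (- quad y / 2) / Z))"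
    unfolding N_def using sN
    by (intro pair_measure_density) (auto intro: sigma_finite_block_space)
  also have "(\<lambda>(x, y). ennreal (exp (- quad x / 2) / Z) * ennreal (exp (- quad y / 2) / Z))
      = (\<lambda>p. ennreal (exp (- (quad (fst p) + quad (snd p)) / 2) / Z\<^sup>2))"
  proof -
    have "exp (- b / 2) / Z * (exp (- c / 2) / Z) = exp (- (b + c) / 2) / Z\<^sup>2" for b c
    proof -
      have "exp (- (b + c) / 2) = exp (- b / 2 + - c / 2)" by (rule arg_cong[where f=exp]) (simp add: field_simps)
      then show ?thesis by (simp only: exp_add) (simp add: power2_eq_square)
    qed
    then show ?thesis using Z_pos by (simp add: fun_eq_iff flip: ennreal_mult)
  qed
  finally show ?thesis by (simp add: nn_integral_density)
qed

text \<open>The density of the pair depends only on the sum of the two quadratic forms, and a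
  rotation preserves that sum because it mixes the copies with coefficients that do not depend on
  the coordinate.\<close>

lemma nn_integral_NN_rotate:
  assumes [measurable]: "F \<in> borel_measurable (M \<Otimes>\<^sub>M M)" and c: "cos (t / 2) \<noteq> 0"
  shows "(\<integral>\<^sup>+p. F (rotate_pair m t p) \<partial>NN) = (\<integral>\<^sup>+p. F p \<partial>NN)"
proof -
  have inv: "quad (fst (rotate_pair m t p)) + quad (snd (rotate_pair m t p)) = quad (fst p) + quad (snd p)" for p
  proof -
    have 1: "quad (fst (rotate_pair m t p)) = quad (\<lambda>i. cos t * fst p i + sin t * snd p i)"
      unfolding rotate_pair_def by simp
    have 2: "quad (snd (rotate_pair m t p)) = quad (\<lambda>i. cos t * snd p i + (- sin t) * fst p i)"
      unfolding rotate_pair_def by simp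
    have "quad (fst (rotate_pair m t p)) + quad (snd (rotate_pair m t p))
       = ((cos t)\<^sup>2 + (sin t)\<^sup>2) * quad (fst p) + ((cos t)\<^sup>2 + (sin t)\<^sup>2) * quad (snd p)"
      unfolding 1 2 quad_lincomb dot_A_commute[of "snd p" "fst p"] by (simp add: power2_eq_square
          algebra_simps del: sin_cos_squared_add sin_cos_squared_add2 sin_cos_squared_add3)
    then show ?thesis by simp
  qed
  have "(\<integral>\<^sup>+p. F (rotate_pair m t p) \<partial>NN) = (\<integral>\<^sup>+p. ennreal (exp (- (quad (fst (rotate_pair m t p)) + quad
      (snd (rotate_pair m t p))) / 2) / Z\<^sup>2) * F (rotate_pair m t p) \<partial>(M \<Otimes>\<^sub>M M))"
    unfolding inv by (rule nn_integral_NN) measurable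
  also have "\<dots> = (\<integral>\<^sup>+p. ennreal (exp (- (quad (fst p) + quad (snd p)) / 2) / Z\<^sup>2) * F p \<partial>(M \<Otimes>\<^sub>M M))"
    by (rule nn_integral_rotate_pair[where F="\<lambda>p. ennreal (exp (- (quad (fst p) + quad (snd p)) / 2) /
        Z\<^sup>2) * F p", OF _ c]) measurable
  also have "\<dots> = (\<integral>\<^sup>+p. F p \<partial>NN)" by (rule nn_integral_NN[symmetric]) measurable
  finally show ?thesis .
qed

lemma variance_eq_pair:
  fixes g :: "(nat \<Rightarrow> real) \<Rightarrow> real"
  assumes [measurable]: "g \<in> borel_measurable M" and g: "\<And>x. \<bar>g x\<bar> \<le> B"
  shows "N.variance g = (\<integral>p. (g (snd p) - g (fst p))\<^sup>2 \<partial>NN) / 2"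
proof -
  have "0 \<le> B" using g[of undefined] by linarith
  then have b2: "\<bar>g x * g y\<bar> \<le> B * B" for x y
    unfolding abs_mult by (intro mult_mono[of "\<bar>g x\<bar>" B "\<bar>g y\<bar>" B] g) simp_all
  have b1: "\<bar>(g x)\<^sup>2\<bar> \<le> B * B" for x
    using b2[of x x] by (simp add: power2_eq_square)
  have i: "integrable N (\<lambda>x. (g x)\<^sup>2)" "integrable N g"
    by (rule N.integrable_const_bound[where B="B * B"], use b1 in simp, simp)
      (rule N.integrable_const_bound[where B=B], use g in simp, simp)
  have i1: "integrable NN (\<lambda>p. (g (fst p))\<^sup>2)" "integrable NN (\<lambda>p. (g (snd p))\<^sup>2)" "integrable NN (\<lambda>p. g
      (fst p) * g (snd p))"
    by (rule NN.P.integrable_const_bound[where B="B * B"], simp only: real_norm_def b1 b2, simp, simp)+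
  have "(\<integral>p. (g (snd p) - g (fst p))\<^sup>2 \<partial>NN) = (\<integral>p. (g (snd p))\<^sup>2 + (g (fst p))\<^sup>2 - 2 * (g (fst p) * g (snd p)) \<partial>NN)"
    by (intro Bochner_Integration.integral_cong) (auto simp: power2_eq_square algebra_simps)
  also have "\<dots> = (\<integral>p. (g (snd p))\<^sup>2 \<partial>NN) + (\<integral>p. (g (fst p))\<^sup>2 \<partial>NN) - 2 * (\<integral>p. g (fst p) * g (snd p) \<partial>NN)"
    using i1 by simp
  also have "\<dots> = 2 * (\<integral>x. (g x)\<^sup>2 \<partial>N) - 2 * (N.expectation g)\<^sup>2"
    using NN.integral_fst'[OF i1(1)] NN.integral_fst'[OF i1(2)] NN.integral_fst'[OF i1(3)]
    using N.prob_space by (simp add: power2_eq_square)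
  finally show ?thesis using N.variance_eq[OF i(2,1)] by simp
qed

text \<open>
  Maurey--Pisier: two independent copies \<open>x, x'\<close> are joined by the rotations of the pair
  \<open>(x, x')\<close>. Rotations preserve the law of the pair, so all small steps of the path have the
  same mean square.
\<close>

theorem gaussian_Poincare:
  fixes g :: "(nat \<Rightarrow> real) \<Rightarrow> real"
  assumes [measurable]: "g \<in> borel_measurable M" and gB: "\<And>x. \<bar>g x\<bar> \<le> B"
    and g_res: "\<And>x. g (\<lambda>i\<in>{..<m}. x i) = g x"
    and G_meas[measurable]: "\<And>i. i < m \<Longrightarrow> (\<lambda>x. G x i) \<in> borel_measurable M"
    and GC: "\<And>x. dot m (G x) (G x) \<le> C\<^sup>2"
    and der: "\<And>x v. ((\<lambda>t. g (\<lambda>i. cos t * x i + sin t * v i)) has_real_derivative dot m (G x) v) (at 0)"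
  shows "N.variance g \<le> 8 / (3 * \<psi>) * (\<integral>x. dot m (G x) (G x) \<partial>N)"
proof -
  define \<gamma> where "\<gamma> t p = g (\<lambda>i. cos t * fst p i + sin t * snd p i)" for t and p :: "(nat \<Rightarrow> real) \<times> (nat \<Rightarrow> real)"
  have \<gamma>_rot: "\<gamma> (t + s) p = \<gamma> s (rotate_pair m t p)" for t s p
  proof -
    have "\<gamma> s (rotate_pair m t p) = g (\<lambda>i\<in>{..<m}. cos s * fst (rotate_pair m t p) i + sin s * snd
        (rotate_pair m t p) i)"
      by (simp only: \<gamma>_def g_res)
    also have "(\<lambda>i\<in>{..<m}. cos s * fst (rotate_pair m t p) i + sin s * snd (rotate_pair m t p) i)
        = (\<lambda>i\<in>{..<m}. cos (t + s) * fst p i + sin (t + s) * snd p i)"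
      by (auto simp: rotate_pair_def cos_add sin_add algebra_simps)
    finally show ?thesis by (simp only: \<gamma>_def g_res)
  qed
  have \<gamma>_meas[measurable]: "\<gamma> t \<in> borel_measurable (M \<Otimes>\<^sub>M M)" for t
  proof -
    have "\<gamma> t = (\<lambda>p. g (\<lambda>i\<in>{..<m}. cos t * fst p i + sin t * snd p i))" by (simp only: \<gamma>_def[abs_def] g_res)
    then show ?thesis by simp
  qed
  have \<gamma>_der0: "((\<lambda>t. \<gamma> t p) has_real_derivative dot m (G (fst p)) (snd p)) (at 0)" for p
    unfolding \<gamma>_def by (rule der)
  have \<gamma>_der: "((\<lambda>t. \<gamma> t p) has_real_derivative dot m (G (fst (rotate_pair m s p))) (snd (rotate_pair m s
      p))) (at s)" for s p
  proof -
    have "((\<lambda>t. \<gamma> (t + s) p) has_real_derivative dot m (G (fst (rotate_pair m s p))) (snd (rotate_pair m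
        s p))) (at 0)"
      using \<gamma>_der0[of "rotate_pair m s p"] unfolding \<gamma>_rot[symmetric] by (simp add: add.commute)
    then show ?thesis using DERIV_shift[of "\<lambda>t. \<gamma> t p" _ 0 s] by simp
  qed
  \<comment> \<open>\<open>R\<close> is invariant under rotation and integrable, so a multiple of it
    dominates the rescaled increments \<open>D n\<close> simultaneously for all
    \<open>n\<close>.\<close>
  define R where "R p = dot m (fst p) (fst p) + dot m (snd p) (snd p)" for p :: "(nat \<Rightarrow> real) \<times> (nat \<Rightarrow> real)"
  have R_nonneg: "0 \<le> R p" for p by (simp add: R_def)
  have der_bound: "\<bar>dot m (G (fst (rotate_pair m s p))) (snd (rotate_pair m s p))\<bar> \<le> \<bar>C\<bar> * sqrt (R p)" for s p
  proof -
    let ?v = "snd (rotate_pair m s p)" and ?u = "fst (rotate_pair m s p)"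
    have "dot m ?v ?v \<le> dot m ?u ?u + dot m ?v ?v" by simp
    also have "\<dots> = ((cos s)\<^sup>2 + (sin s)\<^sup>2) * dot m (fst p) (fst p) + ((cos s)\<^sup>2 + (sin s)\<^sup>2) * dot m (snd p) (snd p)"
    proof -
      have 1: "dot m ?u ?u = dot m (\<lambda>i. cos s * fst p i + sin s * snd p i) (\<lambda>i. cos s * fst p i + sin s * snd p i)"
        unfolding rotate_pair_def by simp
      have 2: "dot m ?v ?v = dot m (\<lambda>i. cos s * snd p i + (- sin s) * fst p i) (\<lambda>i. cos s * snd p i + (-
          sin s) * fst p i)"
        unfolding rotate_pair_def by simp
      show ?thesis
        unfolding 1 2 dot_lincomb_left dot_lincomb_right dot_commute[of m "snd p" "fst p"]
        by (simp add: power2_eq_square algebra_simps del: sin_cos_squared_add sin_cos_squared_add2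
            sin_cos_squared_add3)
    qed
    also have "\<dots> = R p" by (simp add: R_def)
    finally have "dot m (G ?u) (G ?u) * dot m ?v ?v \<le> C\<^sup>2 * R p"
      using GC[of ?u] by (intro mult_mono) auto
    then have "(dot m (G ?u) ?v)\<^sup>2 \<le> C\<^sup>2 * R p" using dot_Cauchy_Schwarz[of m "G ?u" ?v] by simp
    then have "sqrt ((dot m (G ?u) ?v)\<^sup>2) \<le> sqrt (C\<^sup>2 * R p)" by (rule real_sqrt_le_mono)
    then show ?thesis by (simp add: real_sqrt_mult)
  qed
  have lip: "\<bar>\<gamma> t p - \<gamma> 0 p\<bar> \<le> \<bar>C\<bar> * sqrt (R p) * t" if t: "t > 0" for t p
  proof -
    obtain z where "\<gamma> t p - \<gamma> 0 p = (t - 0) * dot m (G (fst (rotate_pair m z p))) (snd (rotate_pair m z p))"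
      using MVT2[OF t, of "\<lambda>t. \<gamma> t p", OF \<gamma>_der] by blast
    then show ?thesis using der_bound[of _ p] t by (simp add: abs_mult mult.commute mult_left_mono)
  qed
  \<comment> \<open>A quarter turn, from the first copy to the second, in \<open>Suc n\<close> equal
    steps.\<close>
  define \<delta> where "\<delta> n = pi / 2 / real (Suc n)" for n
  define D where "D n p = (real (Suc n) * (\<gamma> (\<delta> n) p - \<gamma> 0 p))\<^sup>2" for n p
  have [measurable]: "D n \<in> borel_measurable (M \<Otimes>\<^sub>M M)" for n unfolding D_def[abs_def] by measurable
  have \<delta>_pos: "\<delta> n > 0" for n by (simp add: \<delta>_def)
  have N\<delta>: "real (Suc n) * \<delta> n = pi / 2" for n by (simp add: \<delta>_def field_simps del: of_nat_Suc)
  define Dlim where "Dlim p = (pi / 2 * dot m (G (fst p)) (snd p))\<^sup>2" for p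
  have G_fst[measurable]: "(\<lambda>p. G (fst p) i) \<in> borel_measurable (M \<Otimes>\<^sub>M M)" if "i < m" for i
    using measurable_compose[OF measurable_fst G_meas[OF that]] .
  have G_fst': "(\<lambda>p. dot m (G (fst p)) (snd p)) \<in> borel_measurable (M \<Otimes>\<^sub>M M)"
    by (intro measurable_dot) (auto intro: G_fst)
  have [measurable]: "Dlim \<in> borel_measurable (M \<Otimes>\<^sub>M M)" unfolding Dlim_def[abs_def] using G_fst' by simp
  have D_bound: "\<bar>D n p\<bar> \<le> (pi / 2 * C)\<^sup>2 * R p" for n p
  proof -
    have "\<bar>real (Suc n) * (\<gamma> (\<delta> n) p - \<gamma> 0 p)\<bar> \<le> real (Suc n) * (\<bar>C\<bar> * sqrt (R p) * \<delta> n)"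
      unfolding abs_mult using lip[OF \<delta>_pos, of n p] by (intro mult_mono) auto
    also have "\<dots> = pi / 2 * \<bar>C\<bar> * sqrt (R p)" using N\<delta>[of n] by (simp add: mult_ac)
    finally have "\<bar>real (Suc n) * (\<gamma> (\<delta> n) p - \<gamma> 0 p)\<bar>\<^sup>2 \<le> (pi / 2 * \<bar>C\<bar> * sqrt (R p))\<^sup>2"
      by (rule power_mono) simp
    then show ?thesis using R_nonneg[of p] by (simp add: D_def power_mult_distrib power_divide)
  qed
  have R_int: "integrable NN R"
  proof -
    have *: "(\<integral>\<^sup>+x. ennreal (dot m x x) \<partial>N) < \<infinity>"
      using integrable_norm_sq by (simp add: integrable_iff_bounded)
    have "(\<integral>\<^sup>+p. ennreal (dot m (fst p) (fst p)) \<partial>NN) < \<infinity>"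
      using * N.nn_integral_fst[of "\<lambda>p. ennreal (dot m (fst p) (fst p))" N, symmetric]
      by (simp add: N.emeasure_space_1[simplified])
    moreover have "(\<integral>\<^sup>+p. ennreal (dot m (snd p) (snd p)) \<partial>NN) < \<infinity>"
      using * N.nn_integral_fst[of "\<lambda>p. ennreal (dot m (snd p) (snd p))" N, symmetric]
      by (simp add: N.emeasure_space_1[simplified])
    ultimately show ?thesis unfolding R_def
      by (intro Bochner_Integration.integrable_add integrableI_nonneg) simp_all
  qed
  have D_lim: "(\<lambda>n. D n p) \<longlonglongrightarrow> Dlim p" for p
  proof -
    have "(\<lambda>n. pi / 2 * inverse (real (Suc n))) \<longlonglongrightarrow> pi / 2 * 0"
      by (rule tendsto_mult_left[OF LIMSEQ_inverse_real_of_nat])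
    then have 0: "\<delta> \<longlonglongrightarrow> 0"
      by (simp only: \<delta>_def[abs_def] divide_inverse mult_zero_right)
    have "\<forall>\<^sub>F n in sequentially. \<delta> n \<noteq> 0"
      by (rule always_eventually) (use \<delta>_pos in \<open>metis less_irrefl\<close>)
    with 0 have "filterlim \<delta> (at 0) sequentially" by (rule filterlim_atI)
    moreover have "((\<lambda>h. (\<gamma> (0 + h) p - \<gamma> 0 p) / h) \<longlongrightarrow> dot m (G (fst p)) (snd p)) (at 0)"
      using \<gamma>_der0[of p] by (simp add: DERIV_def)
    ultimately have "(\<lambda>n. (\<gamma> (0 + \<delta> n) p - \<gamma> 0 p) / \<delta> n) \<longlonglongrightarrow> dot m (G (fst p)) (snd p)"
      by (rule filterlim_compose[rotated])
    then have "(\<lambda>n. (pi / 2 * ((\<gamma> (0 + \<delta> n) p - \<gamma> 0 p) / \<delta> n))\<^sup>2) \<longlonglongrightarrow> Dlim p"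
      unfolding Dlim_def by (intro tendsto_intros)
    moreover have "pi / 2 * ((\<gamma> (0 + \<delta> n) p - \<gamma> 0 p) / \<delta> n) = real (Suc n) * (\<gamma> (\<delta> n) p - \<gamma> 0 p)" for n
      using \<delta>_pos[of n] unfolding N\<delta>[of n, symmetric] by simp
    ultimately show ?thesis unfolding D_def by simp
  qed
  have DR_int: "integrable NN (\<lambda>p. (pi / 2 * C)\<^sup>2 * R p)" using R_int by simp
  have D_int: "integrable NN (D n)" for n
  proof (rule Bochner_Integration.integrable_bound[OF DR_int])
    show "AE p in NN. norm (D n p) \<le> norm ((pi / 2 * C)\<^sup>2 * R p)"
      unfolding real_norm_def by (intro AE_I2 order_trans[OF D_bound abs_ge_self])
  qed simp
  have D_bound': "AE p in NN. norm (D n p) \<le> (pi / 2 * C)\<^sup>2 * R p" for n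
    unfolding real_norm_def by (intro AE_I2 D_bound)
  have D_lim': "AE p in NN. (\<lambda>n. D n p) \<longlonglongrightarrow> Dlim p"
    by (intro AE_I2 D_lim)
  have D_conv: "(\<lambda>n. \<integral>p. D n p \<partial>NN) \<longlonglongrightarrow> (\<integral>p. Dlim p \<partial>NN)"
    by (rule integral_dominated_convergence[OF _ _ DR_int D_lim' D_bound']) simp_all
  have Dlim_int: "integrable NN Dlim"
    by (rule integrable_dominated_convergence[OF _ _ DR_int D_lim' D_bound']) simp_all
  \<comment> \<open>Cauchy-Schwarz over the telescoping sum costs one factor \<open>Suc n\<close>;
    the \<open>Suc n\<close> increments with equal mean square contribute another. Together they
    make up the square of the scaling in \<open>D n\<close>.\<close>
  have steps: "(\<integral>p. (g (snd p) - g (fst p))\<^sup>2 \<partial>NN) \<le> (\<integral>p. D n p \<partial>NN)" for n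
  proof -
    let ?d = "\<lambda>k p. (\<gamma> (real (Suc k) * \<delta> n) p - \<gamma> (real k * \<delta> n) p)"
    have "(g (snd p) - g (fst p))\<^sup>2 \<le> real (Suc n) * (\<Sum>k<Suc n. (?d k p)\<^sup>2)" for p
    proof -
      have "(\<Sum>k<Suc n. ?d k p) = \<gamma> (real (Suc n) * \<delta> n) p - \<gamma> (real 0 * \<delta> n) p"
        by (rule sum_lessThan_telescope)
      also have "\<dots> = g (snd p) - g (fst p)" unfolding N\<delta> by (simp add: \<gamma>_def)
      finally show ?thesis
        using sum_squared_le_sum_of_squares[of "\<lambda>k. ?d k p" "{..<Suc n}"] by (simp add: mult.commute)
    qed
    then have "(\<integral>\<^sup>+p. ennreal ((g (snd p) - g (fst p))\<^sup>2) \<partial>NN)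
        \<le> (\<integral>\<^sup>+p. ennreal (real (Suc n)) * (\<Sum>k<Suc n. ennreal ((?d k p)\<^sup>2)) \<partial>NN)"
      by (intro nn_integral_mono) (simp add: ennreal_mult[symmetric] sum_nonneg del: of_nat_Suc sum.lessThan_Suc)
    also have "\<dots> = ennreal (real (Suc n)) * (\<Sum>k<Suc n. \<integral>\<^sup>+p. ennreal ((?d k p)\<^sup>2) \<partial>NN)"
      by (subst nn_integral_cmult; (subst nn_integral_sum)?) simp_all
    also have "(\<Sum>k<Suc n. \<integral>\<^sup>+p. ennreal ((?d k p)\<^sup>2) \<partial>NN) = (\<Sum>k<Suc n. \<integral>\<^sup>+p. ennreal ((\<gamma> (\<delta> n) p - \<gamma> 0 p)\<^sup>2) \<partial>NN)"
    proof (intro sum.cong refl)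
      fix k assume k: "k \<in> {..<Suc n}"
      let ?t = "real k * \<delta> n"
      have "?t \<le> real (Suc n) * \<delta> n" using k \<delta>_pos[of n] by (intro mult_right_mono) auto
      then have "?t \<le> pi / 2" unfolding N\<delta> .
      moreover have "0 \<le> ?t" using \<delta>_pos[of n] by simp
      \<comment> \<open>All starting angles are at most pi/2, so the factorisation of the rotation
        into shears applies.\<close>
      ultimately have "cos (?t / 2) > 0" using pi_gt_zero by (intro cos_gt_zero_pi) linarith+
      then have c: "cos (?t / 2) \<noteq> 0" by simp
      have "?d k p = \<gamma> (\<delta> n) (rotate_pair m ?t p) - \<gamma> 0 (rotate_pair m ?t p)" for p
        by (simp add: \<gamma>_rot[symmetric] algebra_simps)
      then show "(\<integral>\<^sup>+p. ennreal ((?d k p)\<^sup>2) \<partial>NN) = (\<integral>\<^sup>+p. ennreal ((\<gamma> (\<delta> n) p - \<gamma> 0 p)\<^sup>2) \<partial>NN)"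
        using nn_integral_NN_rotate[of "\<lambda>p. ennreal ((\<gamma> (\<delta> n) p - \<gamma> 0 p)\<^sup>2)", OF _ c] by simp
    qed
    also have "ennreal (real (Suc n)) * (\<Sum>k<Suc n. \<integral>\<^sup>+p. ennreal ((\<gamma> (\<delta> n) p - \<gamma> 0 p)\<^sup>2) \<partial>NN)
        = (ennreal (real (Suc n)) * ennreal (real (Suc n))) * (\<integral>\<^sup>+p. ennreal ((\<gamma> (\<delta> n) p - \<gamma> 0 p)\<^sup>2) \<partial>NN)"
      by (simp only: sum_constant card_lessThan ennreal_of_nat_eq_real_of_nat mult.assoc)
    also have "\<dots> = (\<integral>\<^sup>+p. ennreal (D n p) \<partial>NN)"
      by (subst nn_integral_cmult[symmetric])
        (simp_all add: D_def power2_eq_square ennreal_mult[symmetric] mult_ac del: of_nat_Suc)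
    also have "\<dots> = ennreal (\<integral>p. D n p \<partial>NN)"
      by (intro nn_integral_eq_integral D_int AE_I2) (simp add: D_def)
    finally show ?thesis
      by (intro integral_real_bounded) (auto simp: D_def intro: Bochner_Integration.integral_nonneg)
  qed
  have "(\<integral>p. (g (snd p) - g (fst p))\<^sup>2 \<partial>NN) \<le> (\<integral>p. Dlim p \<partial>NN)"
    by (rule LIMSEQ_le_const[OF D_conv]) (use steps in auto)
  also have "\<dots> = (\<integral>x. (\<integral>y. Dlim (x, y) \<partial>N) \<partial>N)" by (rule NN.integral_fst'[OF Dlim_int, symmetric])
  \<comment> \<open>16/3 is the product of \<open>(pi / 2)\<^sup>2 \<le> 4\<close> and the factor
    4/3 of \<open>second_moment_N\<close>. Half of it remains, since the mean square difference of
    two copies is twice the variance.\<close>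
  also have "\<dots> \<le> (\<integral>x. 16 / (3 * \<psi>) * dot m (G x) (G x) \<partial>N)"
  proof (rule Bochner_Integration.integral_mono)
    show "integrable N (\<lambda>x. \<integral>y. Dlim (x, y) \<partial>N)" by (rule NN.integrable_fst'[OF Dlim_int])
    have "integrable N (\<lambda>x. dot m (G x) (G x))"
      by (rule N.integrable_const_bound[where B="C\<^sup>2"]) (use GC in auto)
    then show "integrable N (\<lambda>x. 16 / (3 * \<psi>) * dot m (G x) (G x))" by simp
    fix x
    have "(\<integral>y. (dot m (G x) y)\<^sup>2 \<partial>N) \<le> 4/3 * (dot m (G x) (G x) / \<psi>)"
      by (rule integral_real_bounded[OF _ second_moment_N]) (use psi_pos in simp)
    then have "(pi / 2)\<^sup>2 * (\<integral>y. (dot m (G x) y)\<^sup>2 \<partial>N) \<le> 2\<^sup>2 * (4/3 * (dot m (G x) (G x) / \<psi>))"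
      using pi_less_4 by (intro mult_mono power_mono) auto
    then show "(\<integral>y. Dlim (x, y) \<partial>N) \<le> 16 / (3 * \<psi>) * dot m (G x) (G x)"
      by (simp add: Dlim_def power_mult_distrib power_divide)
  qed
  finally show ?thesis
    unfolding variance_eq_pair[OF assms(1) gB] by simp
qed

end

section \<open>Proposal and acceptance\<close>

lemma nn_integral_normal_density_exp:
  assumes "\<sigma> > 0"
  shows "(\<integral>\<^sup>+y. ennreal (normal_density \<mu> \<sigma> y * exp (c * (y - \<mu>))) \<partial>lborel) = ennreal (exp (c\<^sup>2 * \<sigma>\<^sup>2 / 2))"
proof -
  have "normal_density \<mu> \<sigma> y * exp (c * (y - \<mu>)) = exp (c\<^sup>2 * \<sigma>\<^sup>2 / 2) * normal_density (\<mu> + c * \<sigma>\<^sup>2) \<sigma> y" for y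
  proof -
    have "- (y - \<mu>)\<^sup>2 / (2 * \<sigma>\<^sup>2) + c * (y - \<mu>) = c\<^sup>2 * \<sigma>\<^sup>2 / 2 + - (y - (\<mu> + c * \<sigma>\<^sup>2))\<^sup>2 / (2 * \<sigma>\<^sup>2)"
      using assms by (simp add: field_simps power2_eq_square)
    then have "exp (- (y - \<mu>)\<^sup>2 / (2 * \<sigma>\<^sup>2)) * exp (c * (y - \<mu>)) = exp (c\<^sup>2 * \<sigma>\<^sup>2 / 2) * exp (- (y - (\<mu> +
        c * \<sigma>\<^sup>2))\<^sup>2 / (2 * \<sigma>\<^sup>2))"
      by (simp only: exp_add[symmetric])
    then show ?thesis by (simp add: normal_density_def)
  qed
  then have "(\<integral>\<^sup>+y. ennreal (normal_density \<mu> \<sigma> y * exp (c * (y - \<mu>))) \<partial>lborel)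
      = ennreal (exp (c\<^sup>2 * \<sigma>\<^sup>2 / 2)) * (\<integral>\<^sup>+y. ennreal (normal_density (\<mu> + c * \<sigma>\<^sup>2) \<sigma> y) \<partial>lborel)"
    by (simp add: ennreal_mult nn_integral_cmult)
  also have "(\<integral>\<^sup>+y. ennreal (normal_density (\<mu> + c * \<sigma>\<^sup>2) \<sigma> y) \<partial>lborel) = 1"
    using assms by (simp add: nn_integral_eq_integral)
  finally show ?thesis by simp
qed

text \<open>\<open>upper\<close> says 2hA is at most the identity, which is the eigenvalue condition
  on the step size. The double sum in \<open>trace\<close> is tr(A^2), because the coefficients are
  symmetric.\<close>

locale mala_block = gaussian_block +
  fixes h :: real
  assumes h_pos: "h > 0"
    and upper: "\<And>v. 2 * h * dot m v (mv m a v) \<le> dot m v v"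
    and trace: "h\<^sup>2 * (\<Sum>i<m. \<Sum>k<m. (a i k)\<^sup>2) \<le> 1 / 10"
begin

definition drift :: "(nat \<Rightarrow> real) \<Rightarrow> nat \<Rightarrow> real" where "drift x i = x i - h * A x i"
definition eta :: "(nat \<Rightarrow> real) \<Rightarrow> (nat \<Rightarrow> real) \<Rightarrow> nat \<Rightarrow> real" where "eta x y i = y i - drift x i"
definition pdens :: "(nat \<Rightarrow> real) \<Rightarrow> (nat \<Rightarrow> real) \<Rightarrow> real" where
  "pdens x y = (\<Prod>i<m. normal_density (drift x i) (sqrt (2 * h)) (y i))"
text \<open>This is log (w(x)/w(y)) for the weight w of the overview, so \<open>barker\<close> is
  w(y)/(w(x) + w(y)).\<close>

definition D :: "(nat \<Rightarrow> real) \<Rightarrow> (nat \<Rightarrow> real) \<Rightarrow> real" where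
  "D x y = h / 4 * (dot m (A y) (A y) - dot m (A x) (A x))"
definition barker :: "(nat \<Rightarrow> real) \<Rightarrow> (nat \<Rightarrow> real) \<Rightarrow> real" where "barker x y = 1 / (1 + exp (D x y))"
definition P :: "(nat \<Rightarrow> real) \<Rightarrow> (nat \<Rightarrow> real) measure" where "P x = density M (\<lambda>y. ennreal (pdens x y))"

lemma drift_lincomb: "drift x = (\<lambda>i. 1 * x i + (- h) * A x i)"
  by (auto simp: drift_def)

lemma A_drift: "A (drift x) = drift (A x)"
  unfolding drift_lincomb mv_lincomb ..

text \<open>The operator inequality 2hA^2 \<le> A, obtained without a square root of A:
  Cauchy-Schwarz for the form \<open>quad\<close> bounds |Av|^4 by
  \<open>quad v * quad (A v)\<close>, and \<open>upper\<close> at A v bounds the second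
  factor.\<close>

lemma two_h_norm_A_le: "2 * h * dot m (A v) (A v) \<le> dot m v (A v)"
proof -
  define n where "n = dot m (A v) (A v)"
  have "(dot m v (A (A v)))\<^sup>2 \<le> quad v * quad (A v)"
  proof (rule quadratic_nonneg_discriminant)
    fix t
    show "0 \<le> quad v + 2 * t * dot m v (A (A v)) + t\<^sup>2 * quad (A v)"
      using quad_nonneg[of "\<lambda>i. 1 * v i + t * A v i"] unfolding quad_lincomb by simp
  qed
  moreover have "dot m v (A (A v)) = n" unfolding n_def by (rule dot_A_commute)
  moreover have "2 * h * quad (A v) \<le> n" using upper[of "A v"] by (simp add: quad_def n_def)
  then have "quad v * (2 * h * quad (A v)) \<le> quad v * n" by (intro mult_left_mono quad_nonneg)
  moreover have "2 * h * n\<^sup>2 \<le> 2 * h * (quad v * quad (A v))"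
    if "n\<^sup>2 \<le> quad v * quad (A v)" using that h_pos by (intro mult_left_mono) auto
  ultimately have "n * (2 * h * n) \<le> n * quad v" by (simp add: power2_eq_square mult_ac)
  moreover have "n \<ge> 0" by (simp add: n_def)
  ultimately show ?thesis
    using quad_nonneg[of v] unfolding n_def[symmetric] quad_def[symmetric]
    by (cases "n = 0") (auto simp: mult_le_cancel_left)
qed

lemma drift_contracts: "dot m (drift v) (drift v) \<le> dot m v v"
proof -
  have "dot m (drift v) (drift v) = dot m v v - 2 * h * dot m v (A v) + h * h * dot m (A v) (A v)"
    unfolding drift_lincomb dot_lincomb_left dot_lincomb_right dot_commute[of m "A v" v]
    by (simp add: algebra_simps)
  moreover have "h * (2 * h * dot m (A v) (A v)) \<le> h * dot m v (A v)"
    using two_h_norm_A_le[of v] h_pos by (intro mult_left_mono) auto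
  moreover have "0 \<le> h * dot m v (A v)" using h_pos quad_nonneg[of v] by (simp add: quad_def)
  ultimately show ?thesis by linarith
qed

lemma dot_drift_commute: "dot m (drift v) w = dot m v (drift w)"
  unfolding drift_lincomb dot_lincomb_left dot_lincomb_right
  by (simp add: dot_A_commute[of v w] dot_commute[of m "A v"])

lemma pdens_eq: "pdens x y = (1 / sqrt (4 * pi * h)) ^ m * exp (- dot m (eta x y) (eta x y) / (4 * h))"
proof -
  have "pdens x y = (\<Prod>i<m. (1 / sqrt (4 * pi * h)) * exp (- (eta x y i)\<^sup>2 / (4 * h)))"
    unfolding pdens_def normal_density_def eta_def using h_pos by (intro prod.cong) (auto simp: mult_ac)
  also have "\<dots> = (1 / sqrt (4 * pi * h)) ^ m * exp (\<Sum>i<m. - (eta x y i)\<^sup>2 / (4 * h))"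
    by (simp add: prod_dividef exp_sum power_divide)
  finally show ?thesis by (simp add: dot_def power2_eq_square sum_divide_distrib sum_negf)
qed

lemma pdens_pos: "pdens x y > 0" unfolding pdens_eq using h_pos by simp

lemma drift_restrict[simp]:  "i < m \<Longrightarrow> drift (\<lambda>i\<in>{..<m}. x i) i = drift x i"
  by (simp add: drift_def)

lemma pdens_restrict[simp]: "pdens (\<lambda>i\<in>{..<m}. x i) y = pdens x y"
  unfolding pdens_def by (intro prod.cong) auto

lemma D_restrict[simp]: "D (\<lambda>i\<in>{..<m}. x i) y = D x y" by (simp add: D_def)
lemma barker_restrict[simp]: "barker (\<lambda>i\<in>{..<m}. x i) y = barker x y" by (simp add: barker_def)

lemma measurable_drift[measurable (raw)]:
  assumes "\<And>i. i < m \<Longrightarrow> (\<lambda>x. f x i) \<in> borel_measurable K"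
  shows "i < m \<Longrightarrow> (\<lambda>x. drift (f x) i) \<in> borel_measurable K"
  unfolding drift_def using assms by measurable

lemma measurable_eta[measurable (raw)]:
  assumes "\<And>i. i < m \<Longrightarrow> (\<lambda>x. f x i) \<in> borel_measurable K" "\<And>i. i < m \<Longrightarrow> (\<lambda>x. g x i) \<in> borel_measurable K"
  shows "i < m \<Longrightarrow> (\<lambda>x. eta (f x) (g x) i) \<in> borel_measurable K"
  unfolding eta_def using assms by measurable

lemma measurable_pdens[measurable (raw)]:
  assumes "\<And>i. i < m \<Longrightarrow> (\<lambda>x. f x i) \<in> borel_measurable K" "\<And>i. i < m \<Longrightarrow> (\<lambda>x. g x i) \<in> borel_measurable K"
  shows "(\<lambda>x. pdens (f x) (g x)) \<in> borel_measurable K"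
  unfolding pdens_eq using assms by measurable

lemma measurable_D[measurable (raw)]:
  assumes "\<And>i. i < m \<Longrightarrow> (\<lambda>x. f x i) \<in> borel_measurable K" "\<And>i. i < m \<Longrightarrow> (\<lambda>x. g x i) \<in> borel_measurable K"
  shows "(\<lambda>x. D (f x) (g x)) \<in> borel_measurable K"
  unfolding D_def using assms by measurable

lemma measurable_barker[measurable (raw)]:
  assumes "\<And>i. i < m \<Longrightarrow> (\<lambda>x. f x i) \<in> borel_measurable K" "\<And>i. i < m \<Longrightarrow> (\<lambda>x. g x i) \<in> borel_measurable K"
  shows "(\<lambda>x. barker (f x) (g x)) \<in> borel_measurable K"
  unfolding barker_def using assms by measurable

lemma sets_P[simp, measurable_cong]: "sets (P x) = sets M" by (simp add: P_def)
lemma space_P[simp]: "space (P x) = space M" by (simp add: P_def)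
lemma measurable_P_iff[simp]: "borel_measurable (P x) = borel_measurable M"
  by (rule measurable_cong_sets) simp_all

lemma mgf_P: "(\<integral>\<^sup>+y. ennreal (exp (dot m c (eta x y))) \<partial>P x) = ennreal (exp (h * dot m c c))"
proof -
  let ?f = "\<lambda>i y. ennreal (normal_density (drift x i) (sqrt (2 * h)) y * exp (c i * (y - drift x i)))"
  have "(\<integral>\<^sup>+y. ennreal (exp (dot m c (eta x y))) \<partial>P x) = (\<integral>\<^sup>+y. ennreal (pdens x y) * ennreal (exp (dot m
      c (eta x y))) \<partial>M)"
    unfolding P_def by (rule nn_integral_density) measurable
  also have "\<dots> = (\<integral>\<^sup>+y. (\<Prod>i<m. ?f i (y i)) \<partial>M)"
    by (intro nn_integral_cong)
      (simp add: pdens_def dot_def eta_def exp_sum prod_ennreal prod.distrib prod_nonneg flip: ennreal_mult)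
  also have "\<dots> = (\<Prod>i<m. \<integral>\<^sup>+y. ?f i y \<partial>lborel)"
    unfolding block_space_def by (rule lborel_product.product_nn_integral_prod) simp_all
  also have "\<dots> = (\<Prod>i<m. ennreal (exp (h * (c i * c i))))"
    using h_pos by (intro prod.cong refl, subst nn_integral_normal_density_exp)
      (simp_all add: power2_eq_square mult_ac)
  also have "\<dots> = ennreal (exp (h * dot m c c))"
    by (simp add: prod_ennreal dot_def sum_distrib_left exp_sum)
  finally show ?thesis .
qed

lemma prob_space_P: "prob_space (P x)"
proof
  show "emeasure (P x) (space (P x)) = 1"
    using mgf_P[of x "\<lambda>_. 0"] by (simp add: dot_def)
qed

lemma nn_second_moment_P: "(\<integral>\<^sup>+y. ennreal ((dot m c (eta x y))\<^sup>2) \<partial>P x) \<le> ennreal (8 * h / 3 * dot m c c)"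
proof -
  interpret prob_space "P x" by (rule prob_space_P)
  have "(\<integral>\<^sup>+y. ennreal ((dot m c (eta x y))\<^sup>2) \<partial>P x) \<le> ennreal (4/3 * (2 * h * dot m c c))"
  proof (rule second_moment_of_subgaussian)
    show "0 \<le> 2 * h * dot m c c" using h_pos by simp
    fix t
    have "dot m (\<lambda>i. t * c i + 0 * c i) z = t * dot m c z" for z unfolding dot_lincomb_left by simp
    moreover have "dot m z (\<lambda>i. t * c i + 0 * c i) = t * dot m z c" for z unfolding dot_lincomb_right by simp
    ultimately show "(\<integral>\<^sup>+y. ennreal (exp (t * dot m c (eta x y))) \<partial>P x) \<le> ennreal (exp (t\<^sup>2 * (2 * h *
        dot m c c) / 2))"
      using mgf_P[of x "\<lambda>i. t * c i + 0 * c i"] by (simp add: power2_eq_square mult_ac)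
  qed measurable
  then show ?thesis by (simp add: mult_ac)
qed

lemma second_moment_P:
  "integrable (P x) (\<lambda>y. (dot m c (eta x y))\<^sup>2)"
  "(\<integral>y. (dot m c (eta x y))\<^sup>2 \<partial>P x) \<le> 8 * h / 3 * dot m c c"
proof -
  show "integrable (P x) (\<lambda>y. (dot m c (eta x y))\<^sup>2)"
    by (rule integrableI_nonneg) (use nn_second_moment_P[of x c] in \<open>auto intro: le_less_trans\<close>)
  show "(\<integral>y. (dot m c (eta x y))\<^sup>2 \<partial>P x) \<le> 8 * h / 3 * dot m c c"
    by (rule integral_real_bounded[OF _ nn_second_moment_P]) (use h_pos in simp)
qed

text \<open>Bounding the noise row by row yields a trace instead of a dimension times an eigenvalue:
  h/4 times 8h/3 tr(A^2) is 2/3 h^2 tr(A^2), at most 1/15 by \<open>trace\<close>.\<close>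

lemma norm_A_eta_P:
  "integrable (P x) (\<lambda>y. dot m (A (eta x y)) (A (eta x y)))"
  "h / 4 * (\<integral>y. dot m (A (eta x y)) (A (eta x y)) \<partial>P x) \<le> 1 / 15"
proof -
  have eq: "dot m (A w) (A w) = (\<Sum>i<m. (dot m (a i) w)\<^sup>2)" for w
    by (simp add: dot_def mv_def power2_eq_square)
  show "integrable (P x) (\<lambda>y. dot m (A (eta x y)) (A (eta x y)))"
    unfolding eq by (intro Bochner_Integration.integrable_sum second_moment_P)
  have "(\<integral>y. dot m (A (eta x y)) (A (eta x y)) \<partial>P x) = (\<Sum>i<m. \<integral>y. (dot m (a i) (eta x y))\<^sup>2 \<partial>P x)"
    unfolding eq by (intro Bochner_Integration.integral_sum second_moment_P)
  also have "\<dots> \<le> (\<Sum>i<m. 8 * h / 3 * dot m (a i) (a i))"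
    by (intro sum_mono second_moment_P)
  also have "\<dots> = 8 * h / 3 * (\<Sum>i<m. \<Sum>k<m. (a i k)\<^sup>2)"
    by (simp add: dot_def power2_eq_square sum_distrib_left)
  finally have "h / 4 * (\<integral>y. dot m (A (eta x y)) (A (eta x y)) \<partial>P x) \<le> h / 4 * (8 * h / 3 * (\<Sum>i<m. \<Sum>k<m. (a i k)\<^sup>2))"
    using h_pos by (intro mult_left_mono) auto
  also have "\<dots> = 2/3 * (h\<^sup>2 * (\<Sum>i<m. \<Sum>k<m. (a i k)\<^sup>2))" by (simp add: power2_eq_square)
  also have "\<dots> \<le> 1/15" using trace by simp
  finally show "h / 4 * (\<integral>y. dot m (A (eta x y)) (A (eta x y)) \<partial>P x) \<le> 1 / 15" .
qed

text \<open>
  With \<open>y\<close> the drifted point plus noise, the logarithm of the acceptance ratio is \<open>- D x y\<close>, and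
  \<open>D x y\<close> is bounded by a drift \<open>- 3/4 * drift_gain x\<close>, a centred linear term \<open>lin_noise\<close> whose variance is of
  order \<open>drift_gain x\<close>, and a nonnegative quadratic term \<open>quad_noise\<close> with mean at most \<open>1/15\<close>.
\<close>

definition drift_gain :: "(nat \<Rightarrow> real) \<Rightarrow> real" where "drift_gain x = h ^ 3 * dot m (A (A x)) (A (A x))"
definition lin_noise :: "(nat \<Rightarrow> real) \<Rightarrow> (nat \<Rightarrow> real) \<Rightarrow> real" where
  "lin_noise x y = h / 2 * dot m (drift (A (A x))) (eta x y)"
definition quad_noise :: "(nat \<Rightarrow> real) \<Rightarrow> (nat \<Rightarrow> real) \<Rightarrow> real" where
  "quad_noise x y = h / 4 * dot m (A (eta x y)) (A (eta x y))"

lemma drift_gain_nonneg: "0 \<le> drift_gain x" using h_pos by (simp add: drift_gain_def)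
lemma quad_noise_nonneg: "0 \<le> quad_noise x y" using h_pos by (simp add: quad_noise_def)

text \<open>Expanding |Ay|^2 around the drifted point leaves the deterministic change - 2hq + h^2 p,
  with q and p as named in the proof. Since \<open>2 * h * p \<le> q\<close> by
  \<open>two_h_norm_A_le\<close>, this is at most - 3 h^2 p, and the prefactor h/4 makes it - 3/4 of
  \<open>drift_gain x\<close>.\<close>

lemma D_le: "D x y \<le> - (3/4) * drift_gain x + lin_noise x y + quad_noise x y"
proof -
  have y: "A y = (\<lambda>i. 1 * A (drift x) i + 1 * A (eta x y) i)"
  proof -
    have "y = (\<lambda>i. 1 * drift x i + 1 * eta x y i)" by (auto simp: eta_def)
    then show ?thesis by (metis mv_lincomb)
  qed
  have 1: "dot m (A y) (A y) = dot m (A (drift x)) (A (drift x)) + 2 * dot m (drift (A (A x))) (eta x y)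
      + dot m (A (eta x y)) (A (eta x y))"
  proof -
    have "dot m (A (drift x)) (A (eta x y)) = dot m (drift (A (A x))) (eta x y)"
      using dot_A_commute[of "A (drift x)" "eta x y"] by (simp add: A_drift dot_commute)
    then show ?thesis
      unfolding y dot_lincomb_left dot_lincomb_right dot_commute[of m "A (eta x y)" "A (drift x)"] by simp
  qed
  define q p where "q = dot m (A x) (A (A x))" and "p = dot m (A (A x)) (A (A x))"
  have 2: "dot m (A (drift x)) (A (drift x)) = dot m (A x) (A x) - 2 * h * q + h * h * p"
    unfolding A_drift unfolding drift_lincomb dot_lincomb_left dot_lincomb_right q_def p_def
      dot_commute[of m "A (A x)" "A x"] by (simp add: algebra_simps)
  have "2 * h * p \<le> q" using two_h_norm_A_le[of "A x"] by (simp add: q_def p_def)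
  then have "h * (2 * h * p) \<le> h * q" using h_pos by (intro mult_left_mono) auto
  then have "h / 4 * (- 2 * h * q + h * h * p) \<le> h / 4 * (- 3 * h * h * p)"
    using h_pos by (intro mult_left_mono) auto
  then show ?thesis
    unfolding D_def 1 2 drift_gain_def lin_noise_def quad_noise_def p_def[symmetric]
    by (simp add: algebra_simps power3_eq_cube)
qed

lemma lin_noise_P:
  "integrable (P x) (\<lambda>y. (lin_noise x y)\<^sup>2)" "(\<integral>y. (lin_noise x y)\<^sup>2 \<partial>P x) \<le> 2/3 * drift_gain x"
proof -
  show "integrable (P x) (\<lambda>y. (lin_noise x y)\<^sup>2)"
    unfolding lin_noise_def power_mult_distrib by (intro integrable_mult_right second_moment_P)
  have "(\<integral>y. (lin_noise x y)\<^sup>2 \<partial>P x) = (h / 2)\<^sup>2 * (\<integral>y. (dot m (drift (A (A x))) (eta x y))\<^sup>2 \<partial>P x)"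
    unfolding lin_noise_def power_mult_distrib by simp
  also have "\<dots> \<le> (h / 2)\<^sup>2 * (8 * h / 3 * dot m (A (A x)) (A (A x)))"
    using h_pos by (intro mult_left_mono order_trans[OF second_moment_P(2)] drift_contracts) auto
  also have "\<dots> = 2/3 * drift_gain x" by (simp add: drift_gain_def power2_eq_square power3_eq_cube)
  finally show "(\<integral>y. (lin_noise x y)\<^sup>2 \<partial>P x) \<le> 2/3 * drift_gain x" .
qed

lemma quad_noise_P: "integrable (P x) (quad_noise x)" "(\<integral>y. quad_noise x y \<partial>P x) \<le> 1/15"
  using norm_A_eta_P[of x] unfolding quad_noise_def[abs_def] by auto

text \<open>Justifies the quotient \<open>(lin_noise x y)\<^sup>2 / drift_gain x\<close> when the
  denominator is 0 and division returns 0: the numerator vanishes as well.\<close>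

lemma lin_noise_zero: "drift_gain x = 0 \<Longrightarrow> lin_noise x y = 0"
proof -
  assume "drift_gain x = 0"
  then have "dot m (A (A x)) (A (A x)) = 0" using h_pos by (simp add: drift_gain_def)
  then have "dot m (drift (A (A x))) (drift (A (A x))) \<le> 0" using drift_contracts[of "A (A x)"] by simp
  then have "dot m (drift (A (A x))) (drift (A (A x))) = 0" by (simp add: antisym)
  then have "(dot m (drift (A (A x))) (eta x y))\<^sup>2 \<le> 0"
    using dot_Cauchy_Schwarz[of m "drift (A (A x))" "eta x y"] by simp
  then show ?thesis by (simp add: lin_noise_def)
qed

lemma barker_bounds: "0 < barker x y" "barker x y \<le> 1"
proof -
  have "0 < 1 + exp (D x y)" by (simp add: add_pos_pos)
  then show "0 < barker x y" "barker x y \<le> 1" unfolding barker_def by auto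
qed

text \<open>A lower bound that is affine in quantities with known mean. If
  \<open>D x y \<le> 1\<close>, the probability is at least 1/(1 + 3). If \<open>D x y > 1\<close>,
  then either \<open>quad_noise x y \<ge> 1/2\<close> or \<open>lin_noise x y\<close> exceeds 1/2 +
  3/4 of \<open>drift_gain x\<close>; by the arithmetic-geometric mean inequality its square is then
  at least 3/2 of \<open>drift_gain x\<close>. In both cases the left-hand side is at most
  0.\<close>

lemma barker_ge: "1/4 * (1 - 2 * quad_noise x y - 2/3 * ((lin_noise x y)\<^sup>2 / drift_gain x)) \<le> barker x y"
proof -
  define r where "r = (lin_noise x y)\<^sup>2 / drift_gain x"
  have r: "0 \<le> r" using drift_gain_nonneg[of x] by (simp add: r_def)
  show ?thesis unfolding r_def[symmetric]
  proof (cases "D x y \<le> 1")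
    case True
    have "exp (D x y) \<le> exp 1" using True by simp
    then have "exp (D x y) \<le> 3" using exp_le by linarith
    then have "1/4 \<le> barker x y" unfolding barker_def by (intro divide_left_mono) (auto simp: add_pos_pos)
    moreover have "1/4 * (1 - 2 * quad_noise x y - 2/3 * r) \<le> 1/4 * 1"
      using r quad_noise_nonneg[of x y] by (intro mult_left_mono) auto
    ultimately show "1/4 * (1 - 2 * quad_noise x y - 2/3 * r) \<le> barker x y" by simp
  next
    case False
    have "1 \<le> 2 * quad_noise x y + 2/3 * r"
    proof (cases "quad_noise x y \<ge> 1/2")
      case True
      then show ?thesis using r by simp
    next
      case q: False
      have l: "lin_noise x y > 1/2 + 3/4 * drift_gain x" using False q D_le[of x y] by linarith
      then have z: "drift_gain x > 0" using drift_gain_nonneg[of x] lin_noise_zero[of x y] by (cases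
          "drift_gain x = 0") auto
      have "3/2 * drift_gain x \<le> (1/2 + 3/4 * drift_gain x)\<^sup>2"
        using zero_le_power2[of "1/2 - 3/4 * drift_gain x"] by (simp add: power2_eq_square algebra_simps)
      also have "\<dots> \<le> (lin_noise x y)\<^sup>2" using l z by (intro power_mono) auto
      finally have "3/2 \<le> r" using z by (simp add: r_def field_simps)
      then show ?thesis using quad_noise_nonneg[of x y] by linarith
    qed
    then have "1/4 * (1 - 2 * quad_noise x y - 2/3 * r) \<le> 0" by simp
    then show "1/4 * (1 - 2 * quad_noise x y - 2/3 * r) \<le> barker x y" using barker_bounds(1)[of x y] by simp
  qed
qed

lemma integrable_barker: "integrable (P x) (barker x)"
proof -
  interpret prob_space "P x" by (rule prob_space_P)
  show ?thesis
    by (rule integrable_const_bound[where B=1])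
      (use barker_bounds in \<open>auto simp: less_imp_le abs_of_pos\<close>)
qed

lemma integral_barker_ge: "1/10 \<le> (\<integral>y. barker x y \<partial>P x)"
proof -
  interpret prob_space "P x" by (rule prob_space_P)
  have 1: "(\<integral>y. (lin_noise x y)\<^sup>2 / drift_gain x \<partial>P x) \<le> 2/3"
  proof (cases "drift_gain x = 0")
    case False
    then have "drift_gain x > 0" using drift_gain_nonneg[of x] by simp
    then show ?thesis using lin_noise_P(2)[of x] by (simp add: field_simps)
  qed simp
  have i: "integrable (P x) (\<lambda>y. (lin_noise x y)\<^sup>2 / drift_gain x)" using lin_noise_P(1)[of x] by simp
  \<comment> \<open>The right-hand side is 19/180.\<close>
  have "1/10 \<le> 1/4 * (1 - 2 * (1/15) - 2/3 * (2/3::real))" by simp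
  also have "\<dots> \<le> 1/4 * (1 - 2 * (\<integral>y. quad_noise x y \<partial>P x) - 2/3 * (\<integral>y. (lin_noise x y)\<^sup>2 / drift_gain x \<partial>P x))"
    by (intro mult_left_mono diff_mono 1 quad_noise_P(2)) auto
  also have "\<dots> = (\<integral>y. 1/4 * (1 - 2 * quad_noise x y - 2/3 * ((lin_noise x y)\<^sup>2 / drift_gain x)) \<partial>P x)"
    using Bochner_Integration.integral_diff[OF Bochner_Integration.integrable_diff[OF integrable_const[of
        1] integrable_mult_right[OF quad_noise_P(1)]] integrable_mult_right[OF i], of 2 "2/3"]
      Bochner_Integration.integral_diff[OF integrable_const[of 1] integrable_mult_right[OF quad_noise_P(1)], of 2]
      prob_space by simp
  also have "\<dots> \<le> (\<integral>y. barker x y \<partial>P x)"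
    by (intro Bochner_Integration.integral_mono integrable_barker barker_ge integrable_mult_right
        Bochner_Integration.integrable_diff i quad_noise_P(1)) simp
  finally show ?thesis .
qed

text \<open>Rejection becomes rare exactly where the A^2 x term of the score is large; this is what
  bounds that term in \<open>score_second_moment\<close>.\<close>

lemma integral_reject_le: "integrable (P x) (\<lambda>y. (1 - barker x y)\<^sup>2)" "drift_gain x * (\<integral>y. (1 - barker x
    y)\<^sup>2 \<partial>P x) \<le> 12"
proof -
  interpret prob_space "P x" by (rule prob_space_P)
  have b01: "0 \<le> 1 - barker x y" "1 - barker x y \<le> 1" for y
    using barker_bounds[of x y] by auto
  show int: "integrable (P x) (\<lambda>y. (1 - barker x y)\<^sup>2)"
    by (rule integrable_const_bound[where B=1]) (use b01 in \<open>auto intro!: power_le_one\<close>)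
  \<comment> \<open>Write z for \<open>drift_gain x\<close>. If the linear or the quadratic noise
    exceeds z/4, the matching term on the right is at least z. Otherwise \<open>D x y\<close> is at
    most - 3z/4 + z/4 + z/4 = - z/4, the left-hand side is at most z exp(- z/2), and this is at most
    1.\<close>
  have pt: "drift_gain x * (1 - barker x y)\<^sup>2 \<le> 1 + 16 * ((lin_noise x y)\<^sup>2 / drift_gain x) + 4 *
      quad_noise x y" for y
  proof (cases "drift_gain x = 0")
    case True then show ?thesis using quad_noise_nonneg[of x y] by simp
  next
    case False
    then have z: "drift_gain x > 0" using drift_gain_nonneg[of x] by simp
    have one: "drift_gain x * (1 - barker x y)\<^sup>2 \<le> drift_gain x * 1"
      using z b01[of y] by (intro mult_left_mono power_le_one) auto
    have n: "0 \<le> (lin_noise x y)\<^sup>2 / drift_gain x" using z by simp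
    show ?thesis
    proof (cases "lin_noise x y > drift_gain x / 4")
      case True
      then have "(drift_gain x / 4)\<^sup>2 \<le> (lin_noise x y)\<^sup>2" using z by (intro power_mono) auto
      then have "drift_gain x \<le> 16 * ((lin_noise x y)\<^sup>2 / drift_gain x)" using z by (simp add:
          field_simps power2_eq_square)
      then show ?thesis using one quad_noise_nonneg[of x y] by linarith
    next
      case l: False
      show ?thesis
      proof (cases "quad_noise x y > drift_gain x / 4")
        case True then show ?thesis using one n by linarith
      next
        case False
        then have D: "D x y \<le> - (drift_gain x / 4)" using l D_le[of x y] by linarith
        have "1 - barker x y = exp (D x y) / (1 + exp (D x y))"
          unfolding barker_def by (simp add: field_simps add_pos_pos add_nonneg_eq_0_iff)
        also have "\<dots> \<le> exp (D x y) / 1" by (intro divide_left_mono) (auto intro: add_pos_pos)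
        also have "\<dots> \<le> exp (- (drift_gain x / 4))" using D by simp
        finally have "(1 - barker x y)\<^sup>2 \<le> (exp (- (drift_gain x / 4)))\<^sup>2" using b01[of y] by (intro power_mono)
        also have "\<dots> = exp (- (drift_gain x / 2))" by (simp add: power2_eq_square flip: exp_add)
        finally have e: "drift_gain x * (1 - barker x y)\<^sup>2 \<le> drift_gain x * exp (- (drift_gain x / 2))"
            using z by (intro mult_left_mono) auto
        have "8 * drift_gain x \<le> 16 + drift_gain x * drift_gain x"
          using zero_le_power2[of "drift_gain x / 4 - 1"] by (simp add: power2_eq_square field_simps)
        moreover have "0 \<le> drift_gain x * drift_gain x" by simp
        moreover have "(drift_gain x / 2)\<^sup>2 / 2 = drift_gain x * drift_gain x / 8" by (simp add: power2_eq_square)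
        ultimately have "drift_gain x \<le> 1 + drift_gain x / 2 + (drift_gain x / 2)\<^sup>2 / 2" by linarith
        also have "\<dots> \<le> exp (drift_gain x / 2)" using z by (intro exp_lower_Taylor_quadratic) auto
        finally have "drift_gain x * exp (- (drift_gain x / 2)) \<le> 1" by (simp add: exp_minus field_simps)
        then show ?thesis using e n quad_noise_nonneg[of x y] by linarith
      qed
    qed
  qed
  have 1: "(\<integral>y. (lin_noise x y)\<^sup>2 / drift_gain x \<partial>P x) \<le> 2/3"
  proof (cases "drift_gain x = 0")
    case False
    then have "drift_gain x > 0" using drift_gain_nonneg[of x] by simp
    then show ?thesis using lin_noise_P(2)[of x] by (simp add: field_simps)
  qed simp
  have i: "integrable (P x) (\<lambda>y. (lin_noise x y)\<^sup>2 / drift_gain x)" using lin_noise_P(1)[of x] by simp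
  have "drift_gain x * (\<integral>y. (1 - barker x y)\<^sup>2 \<partial>P x) = (\<integral>y. drift_gain x * (1 - barker x y)\<^sup>2 \<partial>P x)" by simp
  also have "\<dots> \<le> (\<integral>y. 1 + 16 * ((lin_noise x y)\<^sup>2 / drift_gain x) + 4 * quad_noise x y \<partial>P x)"
    by (intro Bochner_Integration.integral_mono pt integrable_mult_right int
        Bochner_Integration.integrable_add i quad_noise_P(1)) simp
  also have "\<dots> = 1 + 16 * (\<integral>y. (lin_noise x y)\<^sup>2 / drift_gain x \<partial>P x) + 4 * (\<integral>y. quad_noise x y \<partial>P x)"
    using Bochner_Integration.integral_add[OF Bochner_Integration.integrable_add[OF integrable_const[of
        1] integrable_mult_right[OF i]] integrable_mult_right[OF quad_noise_P(1)], of 16 4]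
      Bochner_Integration.integral_add[OF integrable_const[of 1] integrable_mult_right[OF i], of 16]
      prob_space by simp
  \<comment> \<open>1 + 16 * 2/3 + 4/15 is just below 12.\<close>
  also have "\<dots> \<le> 12" using 1 quad_noise_P(2)[of x] by linarith
  finally show "drift_gain x * (\<integral>y. (1 - barker x y)\<^sup>2 \<partial>P x) \<le> 12" .
qed

end

section \<open>Smoothing by accepted proposals\<close>

text \<open>By the mean value theorem \<open>w\<close> dominates the difference quotients; the limit
  is tested along sequences, so dominated convergence applies.\<close>

lemma has_real_derivative_integral:
  fixes u u' :: "real \<Rightarrow> 'a \<Rightarrow> real"
  assumes int: "\<And>t. integrable M (u t)"
    and meas: "u' t0 \<in> borel_measurable M"
    and der: "\<And>t y. y \<in> space M \<Longrightarrow> ((\<lambda>t. u t y) has_real_derivative u' t y) (at t)"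
    and bound: "\<And>t y. y \<in> space M \<Longrightarrow> \<bar>u' t y\<bar> \<le> w y"
    and w: "integrable M w"
  shows "((\<lambda>t. \<integral>y. u t y \<partial>M) has_real_derivative (\<integral>y. u' t0 y \<partial>M)) (at t0)"
  unfolding DERIV_def tendsto_at_iff_sequentially comp_def
proof (intro allI impI)
  fix X :: "nat \<Rightarrow> real" assume X: "\<forall>i. X i \<in> UNIV - {0}" "X \<longlonglongrightarrow> 0"
  let ?q = "\<lambda>n y. (u (t0 + X n) y - u t0 y) / X n"
  have eq: "((\<integral>y. u (t0 + X n) y \<partial>M) - (\<integral>y. u t0 y \<partial>M)) / X n = (\<integral>y. ?q n y \<partial>M)" for n
    using int[of "t0 + X n"] int[of t0] by simp
  have lip: "\<bar>u b y - u c y\<bar> \<le> w y * \<bar>b - c\<bar>" if y: "y \<in> space M" and "c < b" for b c y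
  proof -
    obtain z where "u b y - u c y = (b - c) * u' z y"
      using MVT2[OF \<open>c < b\<close>, of "\<lambda>t. u t y" "\<lambda>t. u' t y"] der[OF y] by blast
    then show ?thesis using mult_right_mono[OF bound[OF y, of z], of "\<bar>b - c\<bar>"] by (simp add: abs_mult mult.commute)
  qed
  have "\<bar>?q n y\<bar> \<le> w y" if y: "y \<in> space M" for n y
  proof -
    have "\<bar>u (t0 + X n) y - u t0 y\<bar> \<le> w y * \<bar>X n\<bar>"
      using lip[OF y, of t0 "t0 + X n"] lip[OF y, of "t0 + X n" t0] X(1)
      by (cases "X n > 0") (auto simp: abs_minus_commute not_less less_le)
    moreover have "\<bar>X n\<bar> > 0" using X(1) by simp
    ultimately show ?thesis by (simp add: abs_divide pos_divide_le_eq)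
  qed
  then have b: "AE y in M. norm (?q n y) \<le> w y" for n by simp
  have "(\<lambda>n. ?q n y) \<longlonglongrightarrow> u' t0 y" if y: "y \<in> space M" for y
    using der[OF y, of t0] X unfolding DERIV_def tendsto_at_iff_sequentially comp_def by blast
  then have l: "AE y in M. (\<lambda>n. ?q n y) \<longlonglongrightarrow> u' t0 y" by simp
  have "(\<lambda>n. \<integral>y. ?q n y \<partial>M) \<longlonglongrightarrow> (\<integral>y. u' t0 y \<partial>M)"
    by (rule integral_dominated_convergence[OF meas _ w l b])
      (use int in \<open>auto intro!: borel_measurable_divide borel_measurable_diff borel_measurable_integrable\<close>)
  then show "(\<lambda>n. ((\<integral>y. u (t0 + X n) y \<partial>M) - (\<integral>y. u t0 y \<partial>M)) / X n) \<longlonglongrightarrow> (\<integral>y. u' t0 y \<partial>M)"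
    unfolding eq .
qed

lemma has_real_derivative_dot_self:
  assumes "\<And>i. i < m \<Longrightarrow> ((\<lambda>t. w t i) has_real_derivative w' i) (at t0)"
  shows "((\<lambda>t. dot m (w t) (w t)) has_real_derivative 2 * dot m (w t0) w') (at t0)"
proof -
  have "((\<lambda>t. \<Sum>i<m. w t i * w t i) has_real_derivative (\<Sum>i<m. w' i * w t0 i + w' i * w t0 i)) (at t0)"
    by (rule DERIV_sum, rule DERIV_mult; rule assms; simp)
  then show ?thesis unfolding dot_def by (simp add: sum_distrib_left mult.commute)
qed

lemma abs_diff_le_two: "\<bar>u - w\<bar> \<le> 2 * C" if "\<bar>u\<bar> \<le> C" "\<bar>w\<bar> \<le> C" for u w C :: real
  using that abs_triangle_ineq4[of u w] by linarith

lemma diff_square_le: "(u - w)\<^sup>2 \<le> (2 * C)\<^sup>2" if "\<bar>u\<bar> \<le> C" "\<bar>w\<bar> \<le> C" for u w C :: real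
  using power_mono[OF abs_diff_le_two[OF that], of 2] by simp

section \<open>The score of the accepted kernel\<close>

context mala_block begin

lemma drift_lin_noise: "drift (\<lambda>i. c * x i + s * y i) = (\<lambda>i. c * drift x i + s * drift y i)"
  unfolding drift_def mv_lincomb by (auto simp: algebra_simps)

text \<open>The gradient in \<open>x\<close> of log (\<open>pdens x y * barker x y\<close>). The
  factor \<open>1 - barker x y\<close> is the derivative of the logarithm of the logistic
  function.\<close>

definition score :: "(nat \<Rightarrow> real) \<Rightarrow> (nat \<Rightarrow> real) \<Rightarrow> nat \<Rightarrow> real" where
  "score x y = (\<lambda>i. 1 / (2 * h) * drift (eta x y) i + (1 - barker x y) * (h / 2) * A (A x) i)"

lemma dot_score: "dot m v (score x y)
    = 1 / (2 * h) * dot m (drift v) (eta x y) + (1 - barker x y) * (h / 2) * dot m v (A (A x))"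
  unfolding score_def dot_lincomb_right dot_drift_commute ..

lemma measurable_score[measurable (raw)]:
  assumes "\<And>i. i < m \<Longrightarrow> (\<lambda>x. f x i) \<in> borel_measurable K" "\<And>i. i < m \<Longrightarrow> (\<lambda>x. g x i) \<in> borel_measurable K"
  shows "i < m \<Longrightarrow> (\<lambda>x. score (f x) (g x) i) \<in> borel_measurable K"
  unfolding score_def drift_def using assms by measurable

text \<open>The Gaussian part contributes 4/3 through \<open>second_moment_P\<close>. In the other
  part Cauchy-Schwarz produces \<open>drift_gain x * (1 - barker x y)\<^sup>2\<close>, whose mean is
  at most 12 by \<open>integral_reject_le\<close>; this contributes 6. The total 22/3 is rounded up
  to 8.\<close>

lemma score_second_moment:
  "integrable (P x) (\<lambda>y. barker x y * (dot m v (score x y))\<^sup>2)"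
  "(\<integral>y. barker x y * (dot m v (score x y))\<^sup>2 \<partial>P x) \<le> 8 / h * dot m v v"
proof -
  let ?w = "\<lambda>y. 1 / (2 * h\<^sup>2) * (dot m (drift v) (eta x y))\<^sup>2 + dot m v v / (2 * h) * (drift_gain x * (1
      - barker x y)\<^sup>2)"
  have pt: "barker x y * (dot m v (score x y))\<^sup>2 \<le> ?w y" for y
  proof -
    define p q where "p = 1 / (2 * h) * dot m (drift v) (eta x y)" and "q = (1 - barker x y) * (h / 2) *
        dot m v (A (A x))"
    have "(dot m v (score x y))\<^sup>2 = (p + q)\<^sup>2" unfolding dot_score p_def q_def ..
    also have "\<dots> \<le> 2 * p\<^sup>2 + 2 * q\<^sup>2" using sum_squares_bound[of p q] by (simp add: power2_sum)
    finally have 1: "(dot m v (score x y))\<^sup>2 \<le> 2 * p\<^sup>2 + 2 * q\<^sup>2" .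
    have "2 * p\<^sup>2 = 1 / (2 * h\<^sup>2) * (dot m (drift v) (eta x y))\<^sup>2"
      by (simp add: p_def power_mult_distrib power_divide)
    moreover have "2 * q\<^sup>2 \<le> dot m v v / (2 * h) * (drift_gain x * (1 - barker x y)\<^sup>2)"
    proof -
      have "2 * q\<^sup>2 = (1 - barker x y)\<^sup>2 * (h\<^sup>2 / 2) * (dot m v (A (A x)))\<^sup>2"
        by (simp add: q_def power_mult_distrib power_divide)
      also have "\<dots> \<le> (1 - barker x y)\<^sup>2 * (h\<^sup>2 / 2) * (dot m v v * dot m (A (A x)) (A (A x)))"
        by (intro mult_left_mono dot_Cauchy_Schwarz) simp
      also have "\<dots> = dot m v v / (2 * h) * (drift_gain x * (1 - barker x y)\<^sup>2)"
        using h_pos by (simp add: drift_gain_def power2_eq_square power3_eq_cube)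
      finally show ?thesis .
    qed
    ultimately have 2: "2 * p\<^sup>2 + 2 * q\<^sup>2 \<le> ?w y" by simp
    have "barker x y * (dot m v (score x y))\<^sup>2 \<le> 1 * (dot m v (score x y))\<^sup>2"
      using barker_bounds[of x y] by (intro mult_right_mono) auto
    then show ?thesis using 1 2 by linarith
  qed
  have w: "integrable (P x) ?w"
    by (intro Bochner_Integration.integrable_add integrable_mult_right second_moment_P integral_reject_le)
  show int: "integrable (P x) (\<lambda>y. barker x y * (dot m v (score x y))\<^sup>2)"
  proof (rule Bochner_Integration.integrable_bound[OF w])
    show "AE y in P x. norm (barker x y * (dot m v (score x y))\<^sup>2) \<le> norm (?w y)"
    proof (rule AE_I2)
      fix y
      have "0 \<le> barker x y * (dot m v (score x y))\<^sup>2" using barker_bounds[of x y] by simp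
      then show "norm (barker x y * (dot m v (score x y))\<^sup>2) \<le> norm (?w y)"
        using pt[of y] unfolding real_norm_def by linarith
    qed
  qed simp
  have "(\<integral>y. barker x y * (dot m v (score x y))\<^sup>2 \<partial>P x) \<le> (\<integral>y. ?w y \<partial>P x)"
    by (intro Bochner_Integration.integral_mono int w pt)
  also have "\<dots> = 1 / (2 * h\<^sup>2) * (\<integral>y. (dot m (drift v) (eta x y))\<^sup>2 \<partial>P x) + dot m v v / (2 * h) *
      (drift_gain x * (\<integral>y. (1 - barker x y)\<^sup>2 \<partial>P x))"
    by (subst Bochner_Integration.integral_add; (intro integrable_mult_right second_moment_P
        integral_reject_le)?) simp
  also have "\<dots> \<le> 1 / (2 * h\<^sup>2) * (8 * h / 3 * dot m v v) + dot m v v / (2 * h) * 12"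
    using h_pos by (intro add_mono mult_left_mono integral_reject_le order_trans[OF second_moment_P(2)]
        drift_contracts) auto
  also have "\<dots> = (4 / 3 + 6) / h * dot m v v" using h_pos by (simp add: field_simps power2_eq_square)
  also have "\<dots> \<le> 8 / h * dot m v v" using h_pos by (intro mult_right_mono divide_right_mono) auto
  finally show "(\<integral>y. barker x y * (dot m v (score x y))\<^sup>2 \<partial>P x) \<le> 8 / h * dot m v v" .
qed

lemma integrable_barker_mult:
  assumes [measurable]: "k \<in> borel_measurable M" and k: "\<And>y. \<bar>k y\<bar> \<le> C"
  shows "integrable (P x) (\<lambda>y. barker x y * k y)"
    and "integrable (P x) (\<lambda>y. barker x y * dot m v (score x y) * k y)"
proof -
  interpret P: prob_space "P x" by (rule prob_space_P)
  have C: "0 \<le> C" using k[of undefined] by linarith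
  show "integrable (P x) (\<lambda>y. barker x y * k y)"
  proof (rule P.integrable_const_bound[where B=C])
    have "\<bar>barker x y * k y\<bar> \<le> 1 * C" for y
      unfolding abs_mult using barker_bounds[of x y] k[of y] by (intro mult_mono) auto
    then show "AE y in P x. norm (barker x y * k y) \<le> C" by simp
  qed simp
  show "integrable (P x) (\<lambda>y. barker x y * dot m v (score x y) * k y)"
  proof (rule Bochner_Integration.integrable_bound)
    show "integrable (P x) (\<lambda>y. C * (barker x y * (dot m v (score x y))\<^sup>2 + 1))"
      by (intro integrable_mult_right Bochner_Integration.integrable_add score_second_moment P.integrable_const)
    have "norm (barker x y * dot m v (score x y) * k y) \<le> norm (C * (barker x y * (dot m v (score x y))\<^sup>2 + 1))" for y
    proof -
      define s b where "s = dot m v (score x y)" and "b = barker x y"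
      have b: "0 \<le> b" "b \<le> 1" using barker_bounds[of x y] by (auto simp: b_def)
      have "\<bar>s\<bar> \<le> s\<^sup>2 + 1" using abs_mult_le_sum_squares[of s 1] by simp
      then have "b * \<bar>s\<bar> \<le> b * (s\<^sup>2 + 1)" using b by (intro mult_left_mono)
      also have "\<dots> \<le> b * s\<^sup>2 + 1" using b by (simp add: algebra_simps)
      finally have "(b * \<bar>s\<bar>) * \<bar>k y\<bar> \<le> (b * s\<^sup>2 + 1) * C"
        using k[of y] b by (intro mult_mono) auto
      moreover have "0 \<le> C * (b * s\<^sup>2 + 1)" using C b by simp
      ultimately show ?thesis
        using b C unfolding s_def[symmetric] b_def[symmetric] by (simp add: abs_mult mult.commute)
    qed
    then show "AE y in P x. norm (barker x y * dot m v (score x y) * k y) \<le> norm (C * (barker x y * (dot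
        m v (score x y))\<^sup>2 + 1))"
      by simp
  qed simp
qed

lemma integral_P:
  fixes k :: "_ \<Rightarrow> real"
  assumes "k \<in> borel_measurable M"
  shows "(\<integral>y. k y \<partial>P x) = (\<integral>y. pdens x y * k y \<partial>M)"
  unfolding P_def using assms pdens_pos by (intro integral_real_density) (auto simp: less_imp_le)

lemma integrable_P_iff:
  fixes k :: "_ \<Rightarrow> real"
  assumes "k \<in> borel_measurable M"
  shows "integrable (P x) k \<longleftrightarrow> integrable M (\<lambda>y. pdens x y * k y)"
  unfolding P_def using assms pdens_pos by (intro integrable_real_density) (auto simp: less_imp_le)

text \<open>Differentiation is along the rotation path used in \<open>gaussian_Poincare\<close>,
  whose velocity is \<open>q\<close>: the logarithmic derivative is the score in the direction
  \<open>q t\<close>.\<close>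

lemma has_derivative_smoothing_integrand:
  fixes x v :: "nat \<Rightarrow> real"
  defines "p \<equiv> \<lambda>t i. cos t * x i + sin t * v i" and "q \<equiv> \<lambda>t i. cos t * v i + (- sin t) * x i"
  shows "((\<lambda>t. pdens (p t) y * barker (p t) y) has_real_derivative
      pdens (p t) y * barker (p t) y * dot m (q t) (score (p t) y)) (at t)"
proof -
  have dp: "((\<lambda>t. eta (p t) y i) has_real_derivative (- 1) * drift (q t) i) (at t)" for i t
    unfolding eta_def p_def q_def drift_lin_noise by (auto intro!: derivative_eq_intros)
  have "((\<lambda>t. dot m (eta (p t) y) (eta (p t) y)) has_real_derivative 2 * dot m (eta (p t) y) (\<lambda>i. (- 1) *
      drift (q t) i)) (at t)"
    by (rule has_real_derivative_dot_self) (rule dp)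
  moreover have "dot m (eta (p t) y) (\<lambda>i. (- 1) * drift (q t) i) = - dot m (drift (q t)) (eta (p t) y)"
    by (simp add: dot_def sum_negf mult.commute)
  ultimately have dE: "((\<lambda>t. dot m (eta (p t) y) (eta (p t) y)) has_real_derivative - 2 * dot m (drift (q
      t)) (eta (p t) y)) (at t)"
    by simp
  have dP: "((\<lambda>t. pdens (p t) y) has_real_derivative pdens (p t) y * (1 / (2 * h) * dot m (drift (q t))
      (eta (p t) y))) (at t)"
  proof -
    have "((\<lambda>t. - dot m (eta (p t) y) (eta (p t) y) / (4 * h)) has_real_derivative
        1 / (2 * h) * dot m (drift (q t)) (eta (p t) y)) (at t)"
      using DERIV_cmult[OF dE, of "- (1 / (4 * h))"] by simp
    from DERIV_cmult[OF DERIV_fun_exp[OF this], of "(1 / sqrt (4 * pi * h)) ^ m"] show ?thesis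
      unfolding pdens_eq by (simp add: mult.assoc)
  qed
  have "((\<lambda>t. A (p t) i) has_real_derivative A (q t) i) (at t)" for i
    unfolding p_def q_def mv_lincomb by (auto intro!: derivative_eq_intros)
  then have "((\<lambda>t. dot m (A (p t)) (A (p t))) has_real_derivative 2 * dot m (A (p t)) (A (q t))) (at t)"
    by (rule has_real_derivative_dot_self)
  moreover have "dot m (A (p t)) (A (q t)) = dot m (q t) (A (A (p t)))"
    using dot_A_commute[of "A (p t)" "q t"] .
  ultimately have dA: "((\<lambda>t. dot m (A (p t)) (A (p t))) has_real_derivative 2 * dot m (q t) (A (A (p t)))) (at t)"
    by simp
  have dD: "((\<lambda>t. D (p t) y) has_real_derivative - (h / 2 * dot m (q t) (A (A (p t))))) (at t)"
    unfolding D_def by (rule derivative_eq_intros dA refl | simp)+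
  have e: "1 + exp (D (p t) y) \<noteq> 0" using exp_gt_zero[of "D (p t) y"] by linarith
  have "((\<lambda>t. 1 / (1 + exp (D (p t) y))) has_real_derivative
      - (exp (D (p t) y) * - (h / 2 * dot m (q t) (A (A (p t))))) / ((1 + exp (D (p t) y)) * (1 + exp (D
          (p t) y)))) (at t)"
    by (rule derivative_eq_intros dD refl | use e in simp)+
  moreover have "- (exp (D (p t) y) * - (h / 2 * dot m (q t) (A (A (p t))))) / ((1 + exp (D (p t) y)) *
      (1 + exp (D (p t) y)))
      = barker (p t) y * ((1 - barker (p t) y) * (h / 2) * dot m (q t) (A (A (p t))))"
    unfolding barker_def using e by (simp add: field_simps)
  ultimately have dB: "((\<lambda>t. barker (p t) y) has_real_derivative
      barker (p t) y * ((1 - barker (p t) y) * (h / 2) * dot m (q t) (A (A (p t))))) (at t)"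
    unfolding barker_def by simp
  show ?thesis
    using DERIV_mult[OF dP dB] unfolding dot_score by (simp add: algebra_simps)
qed

text \<open>Along the path every coordinate of the drift of point and velocity is at most
  \<open>B\<close>, uniformly in \<open>t\<close>, since sine and cosine are at most 1 in modulus.
  This leaves a Gaussian in \<open>y\<close> times a polynomial factor, which a wider Gaussian
  dominates.\<close>

lemma smoothing_dominated:
  fixes x v :: "nat \<Rightarrow> real"
  defines "p \<equiv> \<lambda>t i. cos t * x i + sin t * v i" and "q \<equiv> \<lambda>t i. cos t * v i + (- sin t) * x i"
  shows "\<exists>w. integrable M w \<and> (\<forall>t y. \<bar>pdens (p t) y * barker (p t) y * dot m (q t) (score (p t) y)\<bar> \<le> w y)"
proof -
  have lc: "\<bar>cos t * a + sin t * b\<bar> \<le> \<bar>a\<bar> + \<bar>b\<bar>" "\<bar>cos t * b + (- sin t) * a\<bar> \<le> \<bar>a\<bar> + \<bar>b\<bar>" for t a b :: real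
  proof -
    have "\<bar>cos t * z\<bar> \<le> 1 * \<bar>z\<bar>" "\<bar>sin t * z\<bar> \<le> 1 * \<bar>z\<bar>" for z
      unfolding abs_mult by (intro mult_right_mono; simp)+
    from this[of a] this[of b] show "\<bar>cos t * a + sin t * b\<bar> \<le> \<bar>a\<bar> + \<bar>b\<bar>" "\<bar>cos t * b + (- sin t) * a\<bar> \<le> \<bar>a\<bar> + \<bar>b\<bar>"
      by linarith+
  qed
  define B where "B i = \<bar>drift x i\<bar> + \<bar>drift v i\<bar>" for i
  define B' where "B' i = \<bar>A x i\<bar> + \<bar>A v i\<bar>" for i
  define SB c3 where "SB = dot m B B" and "c3 = dot m B' B'"
  define K where "K = (1 / sqrt (4 * pi * h)) ^ m * exp (SB / (4 * h))"
  define K2 where "K2 = 2 * SB / (2 * h) + h / 2 * c3"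
  define w where "w y = K * (K2 + 8) * (\<Prod>i<m. exp (- (1 / (16 * h)) * (y i - 0)\<^sup>2))" for y :: "nat \<Rightarrow> real"
  have SB: "0 \<le> SB" and c3: "0 \<le> c3" by (simp_all add: SB_def c3_def)
  have K: "0 \<le> K" and K2: "0 \<le> K2" using h_pos SB c3 by (simp_all add: K_def K2_def)
  have "integrable M w"
    unfolding w_def using h_pos by (intro integrable_mult_right integrable_prod_exp_neg_square) simp
  moreover have "\<bar>pdens (p t) y * barker (p t) y * dot m (q t) (score (p t) y)\<bar> \<le> w y" for t y
  proof -
    define S where "S = dot m y y"
    have S: "0 \<le> S" by (simp add: S_def)
    have dp: "\<bar>drift (p t) i\<bar> \<le> B i" "\<bar>drift (q t) i\<bar> \<le> B i" for i
      unfolding p_def q_def drift_lin_noise B_def by (rule lc)+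
    have Ap: "\<bar>A (p t) i\<bar> \<le> B' i" "\<bar>A (q t) i\<bar> \<le> B' i" for i
      unfolding p_def q_def mv_lincomb B'_def by (rule lc)+
    \<comment> \<open>Coordinatewise \<open>(y - b)\<^sup>2 \<ge> y\<^sup>2 / 2 - b\<^sup>2\<close>,
      because the difference is half of \<open>(y - 2 * b)\<^sup>2\<close>.\<close>
    have e1: "S / 2 - SB \<le> dot m (eta (p t) y) (eta (p t) y)"
    proof -
      have "(y i)\<^sup>2 / 2 - (B i)\<^sup>2 \<le> (eta (p t) y i)\<^sup>2" for i
      proof -
        have "(drift (p t) i)\<^sup>2 \<le> (B i)\<^sup>2" using dp(1)[of i] by (metis abs_ge_zero power2_abs power_mono)
        moreover have "0 \<le> (y i - 2 * drift (p t) i)\<^sup>2" by simp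
        ultimately show ?thesis unfolding eta_def by (simp add: power2_eq_square algebra_simps)
      qed
      then have "(\<Sum>i<m. (y i)\<^sup>2 / 2 - (B i)\<^sup>2) \<le> (\<Sum>i<m. (eta (p t) y i)\<^sup>2)" by (intro sum_mono)
      then show ?thesis
        by (simp add: S_def SB_def dot_def power2_eq_square sum_subtractf sum_divide_distrib)
    qed
    have pd: "pdens (p t) y \<le> K * exp (- S / (8 * h))"
    proof -
      have "- dot m (eta (p t) y) (eta (p t) y) / (4 * h) \<le> (SB - S / 2) / (4 * h)"
        using e1 h_pos by (intro divide_right_mono) auto
      also have "\<dots> = SB / (4 * h) + - S / (8 * h)" using h_pos by (simp add: field_simps)
      finally have "exp (- dot m (eta (p t) y) (eta (p t) y) / (4 * h)) \<le> exp (SB / (4 * h)) * exp (- S / (8 * h))"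
        by (simp only: exp_add[symmetric] exp_le_cancel_iff)
      then show ?thesis unfolding pdens_eq K_def using h_pos by (simp only: mult.assoc) (intro mult_left_mono, auto)
    qed
    have "\<bar>dot m (drift (q t)) (eta (p t) y)\<bar> \<le> 2 * SB + S"
    proof -
      have "\<bar>drift (q t) i * eta (p t) y i\<bar> \<le> 2 * (B i)\<^sup>2 + (y i)\<^sup>2" for i
      proof -
        have "\<bar>drift (q t) i * eta (p t) y i\<bar> \<le> B i * (\<bar>y i\<bar> + B i)"
          unfolding abs_mult using dp[of i] abs_triangle_ineq4[of "y i" "drift (p t) i"] abs_ge_zero[of
              "drift (q t) i"]
          by (intro mult_mono) (simp_all add: eta_def, linarith?)
        also have "\<dots> \<le> 2 * (B i)\<^sup>2 + (y i)\<^sup>2"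
        proof -
          have "0 \<le> B i" by (simp add: B_def)
          then show ?thesis
            using abs_mult_le_sum_squares[of "B i" "\<bar>y i\<bar>"] by (simp add: algebra_simps power2_eq_square abs_mult)
        qed
        finally show ?thesis .
      qed
      then have "(\<Sum>i<m. \<bar>drift (q t) i * eta (p t) y i\<bar>) \<le> (\<Sum>i<m. 2 * (B i)\<^sup>2 + (y i)\<^sup>2)" by (intro sum_mono)
      also have "\<dots> = 2 * SB + S"
        by (simp add: SB_def S_def dot_def sum.distrib sum_distrib_left power2_eq_square)
      finally show ?thesis unfolding dot_def using sum_abs[of "\<lambda>i. drift (q t) i * eta (p t) y i"
          "{..<m}"] by linarith
    qed
    then have s1: "\<bar>1 / (2 * h) * dot m (drift (q t)) (eta (p t) y)\<bar> \<le> (2 * SB + S) / (2 * h)"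
      using h_pos by (simp add: abs_mult divide_right_mono)
    have "\<bar>dot m (q t) (A (A (p t)))\<bar> \<le> c3"
    proof -
      have "\<bar>A (p t) i * A (q t) i\<bar> \<le> B' i * B' i" for i
        unfolding abs_mult using Ap[of i] by (intro mult_mono) (auto simp: B'_def)
      then have "(\<Sum>i<m. \<bar>A (p t) i * A (q t) i\<bar>) \<le> c3" unfolding c3_def dot_def by (intro sum_mono)
      moreover have "dot m (q t) (A (A (p t))) = (\<Sum>i<m. A (p t) i * A (q t) i)"
        using dot_A_commute[of "q t" "A (p t)"] by (simp add: dot_def)
      ultimately show ?thesis using sum_abs[of "\<lambda>i. A (p t) i * A (q t) i" "{..<m}"] by (simp only:)
    qed
    then have s2: "\<bar>(1 - barker (p t) y) * (h / 2) * dot m (q t) (A (A (p t)))\<bar> \<le> 1 * (h / 2) * c3"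
      unfolding abs_mult using barker_bounds[of "p t" y] h_pos c3 by (intro mult_mono) auto
    have s: "\<bar>dot m (q t) (score (p t) y)\<bar> \<le> K2 + S / (2 * h)"
      using s1 s2 unfolding dot_score K2_def add_divide_distrib by linarith
    have "\<bar>pdens (p t) y * barker (p t) y * dot m (q t) (score (p t) y)\<bar> \<le> (K * exp (- S / (8 * h))) * 1
        * (K2 + S / (2 * h))"
      unfolding abs_mult using pd s barker_bounds[of "p t" y] pdens_pos[of "p t" y] K K2 S h_pos
      by (intro mult_mono) auto
    also have "\<dots> = K * (exp (- S / (8 * h)) * (K2 + S / (2 * h)))" by simp
    also have "\<dots> \<le> K * ((K2 + 8) * exp (- S / (16 * h)))"
    proof (intro mult_left_mono K)
      \<comment> \<open>Half of the exponent \<open>2 * r\<close> is spent on the factor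
        \<open>K2 + 8 * r\<close>, using \<open>r \<le> exp r\<close>; the other half is the
        Gaussian in \<open>w\<close>.\<close>
      define r where "r = S / (16 * h)"
      have r: "0 \<le> r" using S h_pos by (simp add: r_def)
      have "1 \<le> exp r" "r \<le> exp r" using r exp_ge_add_one_self[of r] by linarith+
      then have "K2 + 8 * r \<le> K2 * exp r + 8 * exp r" using K2 mult_left_mono[of 1 "exp r" K2] by linarith
      then have "exp (- r) * exp (- r) * (K2 + 8 * r) \<le> exp (- r) * exp (- r) * (K2 * exp r + 8 * exp r)"
        by (intro mult_left_mono) auto
      also have "\<dots> = (K2 + 8) * exp (- r)" by (simp add: algebra_simps flip: exp_add)
      finally have "exp (- r + - r) * (K2 + 8 * r) \<le> (K2 + 8) * exp (- r)" by (simp only: exp_add)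
      moreover have "- r + - r = - S / (8 * h)" "8 * r = S / (2 * h)" "- r = - S / (16 * h)"
        using h_pos by (simp_all add: r_def field_simps)
      ultimately show "exp (- S / (8 * h)) * (K2 + S / (2 * h)) \<le> (K2 + 8) * exp (- S / (16 * h))" by simp
    qed
    also have "\<dots> = w y"
      by (simp add: w_def S_def dot_def exp_sum[symmetric] sum_negf sum_divide_distrib power2_eq_square)
    finally show ?thesis .
  qed
  ultimately show ?thesis by blast
qed

lemma has_derivative_smoothing:
  assumes [measurable]: "f \<in> borel_measurable M" and f: "\<And>y. \<bar>f y\<bar> \<le> C"
  shows "((\<lambda>t. \<integral>y. barker (\<lambda>i. cos t * x i + sin t * v i) y * f y \<partial>P (\<lambda>i. cos t * x i + sin t * v i))
    has_real_derivative (\<integral>y. barker x y * dot m v (score x y) * f y \<partial>P x)) (at 0)"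
proof -
  define p where "p = (\<lambda>t i. cos t * x i + sin t * v i)"
  define q where "q = (\<lambda>t i. cos t * v i + (- sin t) * x i)"
  have p0: "p 0 = x" "q 0 = v" by (simp_all add: p_def q_def)
  obtain w where w: "integrable M w" "\<And>t y. \<bar>pdens (p t) y * barker (p t) y * dot m (q t) (score (p t) y)\<bar> \<le> w y"
    using smoothing_dominated[of x v] unfolding p_def q_def by blast
  have "((\<lambda>t. \<integral>y. pdens (p t) y * barker (p t) y * f y \<partial>M)
      has_real_derivative (\<integral>y. pdens (p 0) y * barker (p 0) y * dot m (q 0) (score (p 0) y) * f y \<partial>M)) (at 0)"
  proof (rule has_real_derivative_integral)
    show "integrable M (\<lambda>y. pdens (p t) y * barker (p t) y * f y)" for t
      using integrable_barker_mult(1)[OF assms, of "p t"] by (subst (asm) integrable_P_iff) (simp_all add: mult.assoc)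
    show "(\<lambda>y. pdens (p 0) y * barker (p 0) y * dot m (q 0) (score (p 0) y) * f y) \<in> borel_measurable M"
      by measurable
    show "((\<lambda>t. pdens (p t) y * barker (p t) y * f y) has_real_derivative
        pdens (p t) y * barker (p t) y * dot m (q t) (score (p t) y) * f y) (at t)" for t y
      using DERIV_cmult_right[OF has_derivative_smoothing_integrand[of x v y t], of "f y"]
      unfolding p_def q_def by simp
    show "integrable M (\<lambda>y. w y * C)" using w(1) by simp
    show "\<bar>pdens (p t) y * barker (p t) y * dot m (q t) (score (p t) y) * f y\<bar> \<le> w y * C" for t y
      unfolding abs_mult[of _ "f y"] using w(2)[of t y] f[of y] abs_ge_zero[of "pdens (p t) y * barker (p
          t) y * dot m (q t) (score (p t) y)"]
      by (intro mult_mono) linarith+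
  qed
  then have "((\<lambda>t. \<integral>y. barker (p t) y * f y \<partial>P (p t))
      has_real_derivative (\<integral>y. barker x y * dot m v (score x y) * f y \<partial>P x)) (at 0)"
    by (simp add: integral_P mult.assoc p0)
  then show ?thesis unfolding p_def .
qed


section \<open>The smoothed function, its gradient and the local energy\<close>

definition bmass :: "(nat \<Rightarrow> real) \<Rightarrow> real" where "bmass x = (\<integral>y. barker x y \<partial>P x)"

definition smoothed :: "((nat \<Rightarrow> real) \<Rightarrow> real) \<Rightarrow> (nat \<Rightarrow> real) \<Rightarrow> real" where
  "smoothed f x = (\<integral>y. barker x y * f y \<partial>P x) / bmass x"

text \<open>Subtracting \<open>smoothed f x\<close> under the integral accounts for the derivative
  of the normalisation \<open>bmass\<close>. It also makes the gradient depend on fluctuations of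
  \<open>f\<close> only, so that the local energy can control it.\<close>

definition smoothed_grad :: "((nat \<Rightarrow> real) \<Rightarrow> real) \<Rightarrow> (nat \<Rightarrow> real) \<Rightarrow> nat \<Rightarrow> real" where
  "smoothed_grad f x i = (\<integral>y. barker x y * score x y i * (f y - smoothed f x) \<partial>P x) / bmass x"

definition local_energy :: "((nat \<Rightarrow> real) \<Rightarrow> real) \<Rightarrow> (nat \<Rightarrow> real) \<Rightarrow> real" where
  "local_energy f x = (\<integral>y. barker x y * (f y - f x)\<^sup>2 \<partial>P x)"

lemma bmass_ge: "1/10 \<le> bmass x" unfolding bmass_def by (rule integral_barker_ge)

lemma bmass_pos: "0 < bmass x" using bmass_ge[of x] by simp

lemma smoothed_bound:
  assumes [measurable]: "f \<in> borel_measurable M" and f: "\<And>y. \<bar>f y\<bar> \<le> C"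
  shows "\<bar>smoothed f x\<bar> \<le> C"
proof -
  have "\<bar>\<integral>y. barker x y * f y \<partial>P x\<bar> \<le> (\<integral>y. \<bar>barker x y * f y\<bar> \<partial>P x)" by (rule integral_abs_bound)
  also have "\<dots> \<le> (\<integral>y. barker x y * C \<partial>P x)"
  proof (rule Bochner_Integration.integral_mono)
    show "integrable (P x) (\<lambda>y. \<bar>barker x y * f y\<bar>)" using integrable_barker_mult(1)[OF assms] by simp
    show "integrable (P x) (\<lambda>y. barker x y * C)" using integrable_barker by simp
    show "\<bar>barker x y * f y\<bar> \<le> barker x y * C" for y
      unfolding abs_mult using barker_bounds[of x y] f[of y] by (simp add: mult_left_mono)
  qed
  also have "\<dots> = bmass x * C" by (simp add: bmass_def)
  finally show ?thesis using bmass_pos[of x] by (simp add: smoothed_def abs_divide pos_divide_le_eq mult.commute)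
qed

lemma has_derivative_smoothed:
  assumes [measurable]: "f \<in> borel_measurable M" and f: "\<And>y. \<bar>f y\<bar> \<le> C"
  shows "((\<lambda>t. smoothed f (\<lambda>i. cos t * x i + sin t * v i)) has_real_derivative dot m (smoothed_grad f x) v) (at 0)"
proof -
  let ?p = "\<lambda>t i. cos t * x i + sin t * v i"
  let ?d = "\<lambda>k. \<integral>y. barker x y * dot m v (score x y) * k y \<partial>P x"
  have p0: "?p 0 = x" by simp
  have 1: "((\<lambda>t. \<integral>y. barker (?p t) y * f y \<partial>P (?p t)) has_real_derivative ?d f) (at 0)"
    by (rule has_derivative_smoothing[OF assms])
  have 2: "((\<lambda>t. bmass (?p t)) has_real_derivative ?d (\<lambda>_. 1)) (at 0)"
    using has_derivative_smoothing[of "\<lambda>_. 1" 1 x v] by (simp add: bmass_def)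
  have "((\<lambda>t. smoothed f (?p t)) has_real_derivative
     (?d f * bmass (?p 0) - (\<integral>y. barker (?p 0) y * f y \<partial>P (?p 0)) * ?d (\<lambda>_. 1)) / (bmass (?p 0) * bmass
         (?p 0))) (at 0)"
    unfolding smoothed_def by (rule DERIV_divide[OF 1 2]) (use bmass_pos[of "?p 0"] in simp)
  also have "(?d f * bmass (?p 0) - (\<integral>y. barker (?p 0) y * f y \<partial>P (?p 0)) * ?d (\<lambda>_. 1)) / (bmass (?p 0) *
      bmass (?p 0))
      = (?d f - smoothed f x * ?d (\<lambda>_. 1)) / bmass x"
    unfolding p0 smoothed_def using bmass_pos[of x] by (simp add: field_simps)
  also have "\<dots> = dot m (smoothed_grad f x) v"
  proof -
    have e: "dot m (\<lambda>k. if k = i then 1 else 0) w = w i" if "i < m" for i w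
      using that by (simp add: dot_def if_distrib[of "\<lambda>c. c * _"] cong: if_cong)
    have i: "integrable (P x) (\<lambda>y. barker x y * score x y i * (f y - smoothed f x))" if "i < m" for i
      using integrable_barker_mult(2)[of "\<lambda>y. f y - smoothed f x" "2 * C" x "\<lambda>k. if k = i then 1 else 0"]
        abs_diff_le_two[OF f smoothed_bound[OF assms]] e[OF that] by simp
    have "?d f - smoothed f x * ?d (\<lambda>_. 1) = (\<integral>y. barker x y * dot m v (score x y) * f y - smoothed f x *
        (barker x y * dot m v (score x y) * 1) \<partial>P x)"
      using integrable_barker_mult(2)[OF assms] integrable_barker_mult(2)[of "\<lambda>_. 1" 1] by simp
    also have "\<dots> = (\<integral>y. (\<Sum>i<m. v i * (barker x y * score x y i * (f y - smoothed f x))) \<partial>P x)"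
      by (intro Bochner_Integration.integral_cong refl)
        (simp add: dot_def sum_distrib_left sum_distrib_right sum_subtractf[symmetric] algebra_simps)
    also have "\<dots> = (\<Sum>i<m. v i * (\<integral>y. barker x y * score x y i * (f y - smoothed f x) \<partial>P x))"
      using i by (subst Bochner_Integration.integral_sum) auto
    finally show ?thesis by (simp add: smoothed_grad_def dot_def sum_divide_distrib mult.commute)
  qed
  finally show ?thesis .
qed

lemma smoothed_restrict: "smoothed f (\<lambda>i\<in>{..<m}. x i) = smoothed f x"
proof -
  have "P (\<lambda>i\<in>{..<m}. x i) = P x" by (simp add: P_def)
  then show ?thesis by (simp add: smoothed_def bmass_def)
qed

lemma measurable_integral_P:
  assumes "(\<lambda>(x, y). k x y) \<in> borel_measurable (M \<Otimes>\<^sub>M M)"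
  shows "(\<lambda>x. \<integral>y. k x y \<partial>P x :: real) \<in> borel_measurable M"
proof -
  interpret sigma_finite_measure M by (rule sigma_finite_block_space)
  have "(\<lambda>(x, y). pdens x y * k x y) \<in> borel_measurable (M \<Otimes>\<^sub>M M)"
    using assms by (simp add: case_prod_unfold)
  then have "(\<lambda>x. \<integral>y. pdens x y * k x y \<partial>M) \<in> borel_measurable M"
    by (rule borel_measurable_lebesgue_integral)
  moreover have "(\<integral>y. k x y \<partial>P x) = (\<integral>y. pdens x y * k x y \<partial>M)" if "x \<in> space M" for x
    using measurable_Pair2[OF assms that] by (intro integral_P) simp
  ultimately show ?thesis by (simp cong: measurable_cong)
qed

lemma measurable_bmass[measurable]: "bmass \<in> borel_measurable M"
  unfolding bmass_def[abs_def] by (rule measurable_integral_P) measurable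

lemma measurable_smoothed[measurable]:
  assumes [measurable]: "f \<in> borel_measurable M"
  shows "smoothed f \<in> borel_measurable M"
  unfolding smoothed_def[abs_def] by (intro borel_measurable_divide measurable_integral_P measurable_bmass) measurable

lemma measurable_local_energy[measurable]:
  assumes [measurable]: "f \<in> borel_measurable M"
  shows "local_energy f \<in> borel_measurable M"
  unfolding local_energy_def[abs_def] by (intro measurable_integral_P) measurable

lemma measurable_smoothed_grad:
  assumes [measurable]: "f \<in> borel_measurable M" and "i < m"
  shows "(\<lambda>x. smoothed_grad f x i) \<in> borel_measurable M"
  unfolding smoothed_grad_def[abs_def] using assms(2)
  by (intro borel_measurable_divide measurable_integral_P measurable_bmass) measurable

text \<open>\<open>smoothed f x\<close> is the mean of \<open>f\<close> under the weights
  \<open>barker x y\<close>, so the cross term vanishes when the square is expanded about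
  it.\<close>

lemma local_energy_split:
  assumes [measurable]: "f \<in> borel_measurable M" and f: "\<And>y. \<bar>f y\<bar> \<le> C"
  shows "local_energy f x = (\<integral>y. barker x y * (f y - smoothed f x)\<^sup>2 \<partial>P x) + bmass x * (smoothed f x - f x)\<^sup>2"
proof -
  define c where "c = smoothed f x"
  have b: "\<bar>(f y - c)\<^sup>2\<bar> \<le> (2 * C)\<^sup>2" for y
    using diff_square_le[OF f smoothed_bound[OF assms]] by (simp add: c_def)
  have i2: "integrable (P x) (\<lambda>y. barker x y * (f y - c)\<^sup>2)"
    by (rule integrable_barker_mult(1)[OF _ b]) measurable
  have i1: "integrable (P x) (\<lambda>y. barker x y * f y)" by (rule integrable_barker_mult(1)[OF assms])
  have Ff: "(\<integral>y. barker x y * f y \<partial>P x) = bmass x * c"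
    using bmass_pos[of x] by (simp add: c_def smoothed_def)
  have "local_energy f x = (\<integral>y. barker x y * (f y - c)\<^sup>2 + (2 * (c - f x) * (barker x y * f y) - 2 * (c -
      f x) * c * barker x y + (c - f x)\<^sup>2 * barker x y) \<partial>P x)"
    unfolding local_energy_def
    by (intro Bochner_Integration.integral_cong refl) (simp add: power2_eq_square algebra_simps)
  also have "\<dots> = (\<integral>y. barker x y * (f y - c)\<^sup>2 \<partial>P x) + (2 * (c - f x) * (bmass x * c) - 2 * (c - f x) * c
      * bmass x + (c - f x)\<^sup>2 * bmass x)"
    using i1 i2 integrable_barker[of x] by (simp add: Ff bmass_def)
  finally show ?thesis unfolding c_def by (simp add: mult_ac)
qed

lemma smoothed_error:
  assumes [measurable]: "f \<in> borel_measurable M" and f: "\<And>y. \<bar>f y\<bar> \<le> C"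
  shows "(f x - smoothed f x)\<^sup>2 \<le> 10 * local_energy f x"
proof -
  have "0 \<le> (\<integral>y. barker x y * (f y - smoothed f x)\<^sup>2 \<partial>P x)"
    using barker_bounds by (intro Bochner_Integration.integral_nonneg) (simp add: less_imp_le)
  then have "bmass x * (smoothed f x - f x)\<^sup>2 \<le> local_energy f x" unfolding local_energy_split[OF assms] by simp
  moreover have "1/10 * (smoothed f x - f x)\<^sup>2 \<le> bmass x * (smoothed f x - f x)\<^sup>2"
    by (intro mult_right_mono bmass_ge) simp
  ultimately show ?thesis by (simp add: power2_commute)
qed

text \<open>Pairing the gradient v with itself writes \<open>bmass x\<close> times |v|^2 as an
  integral of the score along v against the fluctuation of \<open>f\<close>. Cauchy-Schwarz and
  \<open>score_second_moment\<close> bound its square by 8/h |v|^2 times the local energy;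
  \<open>bmass x \<ge> 1/10\<close> turns 8 into 800.\<close>

lemma smoothed_grad_le:
  assumes [measurable]: "f \<in> borel_measurable M" and f: "\<And>y. \<bar>f y\<bar> \<le> C"
  shows "dot m (smoothed_grad f x) (smoothed_grad f x) \<le> 800 / h * local_energy f x"
proof -
  define c where "c = smoothed f x"
  define v where "v = smoothed_grad f x"
  define n where "n = dot m v v"
  let ?s = "\<lambda>y. dot m v (score x y)"
  define W0 where "W0 = (\<integral>y. barker x y * (f y - c)\<^sup>2 \<partial>P x)"
  define I where "I = (\<integral>y. barker x y * ?s y * (f y - c) \<partial>P x)"
  have b1: "\<bar>f y - c\<bar> \<le> 2 * C" for y
    using f[of y] smoothed_bound[OF assms, of x] abs_triangle_ineq4[of "f y" c] by (simp add: c_def)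
  have b2: "\<bar>(f y - c)\<^sup>2\<bar> \<le> (2 * C)\<^sup>2" for y
    using diff_square_le[OF f smoothed_bound[OF assms]] by (simp add: c_def)
  have i2: "integrable (P x) (\<lambda>y. barker x y * (f y - c)\<^sup>2)"
    by (rule integrable_barker_mult(1)[OF _ b2]) measurable
  have i1: "integrable (P x) (\<lambda>y. barker x y * ?s y * (f y - c))"
    by (rule integrable_barker_mult(2)[OF _ b1]) measurable
  have i3: "integrable (P x) (\<lambda>y. barker x y * (?s y)\<^sup>2)" by (rule score_second_moment)
  have e: "dot m (\<lambda>k. if k = i then 1 else 0) w = w i" if "i < m" for i w
    using that by (simp add: dot_def if_distrib[of "\<lambda>c. c * _"] cong: if_cong)
  have ii: "integrable (P x) (\<lambda>y. barker x y * score x y i * (f y - c))" if "i < m" for i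
    using integrable_barker_mult(2)[of "\<lambda>y. f y - c" "2 * C" x "\<lambda>k. if k = i then 1 else 0", OF _ b1]
        e[OF that] by simp
  have "I = (\<integral>y. (\<Sum>i<m. v i * (barker x y * score x y i * (f y - c))) \<partial>P x)"
    unfolding I_def by (intro Bochner_Integration.integral_cong refl)
      (simp add: dot_def sum_distrib_left sum_distrib_right mult_ac)
  also have "\<dots> = (\<Sum>i<m. v i * (\<integral>y. barker x y * score x y i * (f y - c) \<partial>P x))"
    using ii by (subst Bochner_Integration.integral_sum) auto
  also have "\<dots> = bmass x * n"
    using bmass_pos[of x] by (simp add: n_def v_def dot_def smoothed_grad_def c_def sum_distrib_left)
  finally have I: "I = bmass x * n" .
  have "I\<^sup>2 \<le> (\<integral>y. barker x y * (?s y)\<^sup>2 \<partial>P x) * W0"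
  proof (rule quadratic_nonneg_discriminant)
    fix t
    have "0 \<le> (\<integral>y. barker x y * (?s y + t * (f y - c))\<^sup>2 \<partial>P x)"
      using barker_bounds by (intro Bochner_Integration.integral_nonneg) (simp add: less_imp_le)
    also have "\<dots> = (\<integral>y. barker x y * (?s y)\<^sup>2 + (2 * t * (barker x y * ?s y * (f y - c)) + t\<^sup>2 * (barker
        x y * (f y - c)\<^sup>2)) \<partial>P x)"
      by (intro Bochner_Integration.integral_cong refl) (simp add: power2_eq_square algebra_simps)
    also have "\<dots> = (\<integral>y. barker x y * (?s y)\<^sup>2 \<partial>P x) + (2 * t * I + t\<^sup>2 * W0)"
      unfolding I_def W0_def
      by (simp only: Bochner_Integration.integral_add Bochner_Integration.integrable_add
          integrable_mult_right i1 i2 i3 integral_mult_right_zero)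
    finally show "0 \<le> (\<integral>y. barker x y * (?s y)\<^sup>2 \<partial>P x) + 2 * t * I + t\<^sup>2 * W0" by simp
  qed
  also have "\<dots> \<le> (8 / h * n) * W0"
  proof (rule mult_right_mono)
    show "0 \<le> W0" unfolding W0_def using barker_bounds by (intro Bochner_Integration.integral_nonneg)
        (simp add: less_imp_le)
  qed (simp only: n_def score_second_moment)
  finally have 1: "(bmass x * n)\<^sup>2 \<le> (8 / h * n) * W0" unfolding I .
  have n: "0 \<le> n" by (simp add: n_def)
  have "(1/10 * n)\<^sup>2 \<le> (bmass x * n)\<^sup>2" using bmass_ge[of x] n by (intro power_mono mult_right_mono) auto
  then have "(1/10 * n)\<^sup>2 \<le> (8 / h * n) * W0" using 1 by (rule order_trans)
  then have "n * n \<le> n * (800 / h * W0)" by (simp add: power2_eq_square mult_ac)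
  then have "n \<le> 800 / h * W0"
  proof (cases "n = 0")
    case True
    have "0 \<le> W0" unfolding W0_def using barker_bounds by (intro Bochner_Integration.integral_nonneg)
        (simp add: less_imp_le)
    then show ?thesis using True h_pos by simp
  next
    case False
    then show "n * n \<le> n * (800 / h * W0) \<Longrightarrow> n \<le> 800 / h * W0" using n by (subst (asm) mult_le_cancel_left) auto
  qed
  also have "\<dots> \<le> 800 / h * local_energy f x"
    unfolding local_energy_split[OF assms] W0_def c_def using h_pos bmass_pos[of x]
    by (intro mult_left_mono) (auto simp: less_imp_le)
  finally show ?thesis by (simp add: n_def v_def)
qed

lemma local_energy_bound:
  assumes [measurable]: "f \<in> borel_measurable M" and f: "\<And>y. \<bar>f y\<bar> \<le> C"
  shows "0 \<le> local_energy f x" "local_energy f x \<le> (2 * C)\<^sup>2"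
proof -
  show "0 \<le> local_energy f x"
    unfolding local_energy_def using barker_bounds by (intro Bochner_Integration.integral_nonneg) (simp
        add: less_imp_le)
  interpret P: prob_space "P x" by (rule prob_space_P)
  have b: "(f y - f x)\<^sup>2 \<le> (2 * C)\<^sup>2" for y by (rule diff_square_le[OF f f])
  have "local_energy f x \<le> (\<integral>y. (2 * C)\<^sup>2 \<partial>P x)"
    unfolding local_energy_def
  proof (rule Bochner_Integration.integral_mono)
    show "integrable (P x) (\<lambda>y. barker x y * (f y - f x)\<^sup>2)"
      by (rule integrable_barker_mult(1)[of _ "(2 * C)\<^sup>2"]) (use b in auto)
    show "barker x y * (f y - f x)\<^sup>2 \<le> (2 * C)\<^sup>2" for y
      using mult_mono[of "barker x y" 1 "(f y - f x)\<^sup>2" "(2 * C)\<^sup>2"] b[of y] barker_bounds[of x y] by simp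
  qed simp
  then show "local_energy f x \<le> (2 * C)\<^sup>2" using P.prob_space by simp
qed

text \<open>\<open>f\<close> is close to its smoothing by \<open>smoothed_error\<close>, and the
  smoothing has small variance by the Poincare inequality. The former costs no inverse power of h;
  it is absorbed at the end through \<open>h\<psi>\<close>.\<close>

theorem variance_le_local_energy:
  assumes f[measurable]: "f \<in> borel_measurable M" and fC: "\<And>y. \<bar>f y\<bar> \<le> C"
    and h\<psi>: "2 * h * \<psi> \<le> 1"
  shows "N.variance f \<le> 4300 / (h * \<psi>) * (\<integral>x. local_energy f x \<partial>N)"
proof -
  let ?g = "smoothed f"
  let ?W = "\<integral>x. local_energy f x \<partial>N"
  note le = local_energy_bound[OF f fC]
  have Wint: "integrable N (local_energy f)"
    by (rule N.integrable_const_bound[where B="(2 * C)\<^sup>2"]) (use le in auto)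
  have gb: "\<bar>?g x\<bar> \<le> C" for x by (rule smoothed_bound[OF f fC])
  have C: "0 \<le> C" using fC[of undefined] by linarith
  define c where "c = N.expectation ?g"
  have Gint: "integrable N (\<lambda>x. dot m (smoothed_grad f x) (smoothed_grad f x))"
  proof (rule N.integrable_const_bound)
    show "AE x in N. norm (dot m (smoothed_grad f x) (smoothed_grad f x)) \<le> 800 / h * (2 * C)\<^sup>2"
    proof (rule AE_I2)
      fix x
      have "dot m (smoothed_grad f x) (smoothed_grad f x) \<le> 800 / h * local_energy f x"
        by (rule smoothed_grad_le[OF f fC])
      also have "\<dots> \<le> 800 / h * (2 * C)\<^sup>2" using le[of x] h_pos by (intro mult_left_mono) auto
      finally show "norm (dot m (smoothed_grad f x) (smoothed_grad f x)) \<le> 800 / h * (2 * C)\<^sup>2" by simp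
    qed
    show "(\<lambda>x. dot m (smoothed_grad f x) (smoothed_grad f x)) \<in> borel_measurable N"
      unfolding measurable_N_iff by (intro measurable_dot measurable_smoothed_grad f)
  qed
  have "N.variance ?g \<le> 8 / (3 * \<psi>) * (\<integral>x. dot m (smoothed_grad f x) (smoothed_grad f x) \<partial>N)"
  proof (rule gaussian_Poincare[of ?g C _ "sqrt (800 / h * (2 * C)\<^sup>2)"])
    show "dot m (smoothed_grad f x) (smoothed_grad f x) \<le> (sqrt (800 / h * (2 * C)\<^sup>2))\<^sup>2" for x
    proof -
      have "dot m (smoothed_grad f x) (smoothed_grad f x) \<le> 800 / h * local_energy f x"
        by (rule smoothed_grad_le[OF f fC])
      also have "\<dots> \<le> 800 / h * (2 * C)\<^sup>2" using le[of x] h_pos by (intro mult_left_mono) auto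
      finally show ?thesis using h_pos by simp
    qed
  qed (use gb in \<open>auto intro: smoothed_restrict measurable_smoothed_grad has_derivative_smoothed[OF f fC]\<close>)
  also have "\<dots> \<le> 8 / (3 * \<psi>) * (800 / h * ?W)"
  proof (intro mult_left_mono)
    have "(\<integral>x. dot m (smoothed_grad f x) (smoothed_grad f x) \<partial>N) \<le> (\<integral>x. 800 / h * local_energy f x \<partial>N)"
      by (intro Bochner_Integration.integral_mono Gint smoothed_grad_le[OF f fC] integrable_mult_right Wint)
    then show "(\<integral>x. dot m (smoothed_grad f x) (smoothed_grad f x) \<partial>N) \<le> 800 / h * ?W" by simp
  qed (use psi_pos in simp)
  finally have vg: "N.variance ?g \<le> 8 / (3 * \<psi>) * (800 / h * ?W)" .
  have cb: "\<bar>c\<bar> \<le> C"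
  proof -
    have "\<bar>c\<bar> \<le> (\<integral>x. \<bar>?g x\<bar> \<partial>N)" unfolding c_def by (rule integral_abs_bound)
    also have "\<dots> \<le> (\<integral>x. C \<partial>N)"
      by (intro Bochner_Integration.integral_mono gb integrable_abs N.integrable_const
        N.integrable_const_bound[where B=C]) (use gb in auto)
    finally show ?thesis using N.prob_space by simp
  qed
  have sq: "\<bar>(u - w)\<^sup>2\<bar> \<le> (2 * C)\<^sup>2" if "\<bar>u\<bar> \<le> C" "\<bar>w\<bar> \<le> C" for u w :: real
    using diff_square_le[OF that] by simp
  have j1: "integrable N (\<lambda>x. (f x - ?g x)\<^sup>2)"
    by (rule N.integrable_const_bound[where B="(2 * C)\<^sup>2"]) (use sq[OF fC gb] in auto)
  have j2: "integrable N (\<lambda>x. (?g x - c)\<^sup>2)"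
    by (rule N.integrable_const_bound[where B="(2 * C)\<^sup>2"]) (use sq[OF gb cb] in auto)
  have j3: "integrable N (\<lambda>x. (f x - c)\<^sup>2)"
    by (rule N.integrable_const_bound[where B="(2 * C)\<^sup>2"]) (use sq[OF fC cb] in auto)
  have j4: "integrable N f" by (rule N.integrable_const_bound[where B=C]) (use fC in auto)
  \<comment> \<open>The variance is the least mean square deviation, so \<open>f\<close> may be
    centred at the mean of its smoothing.\<close>
  have "N.variance f \<le> (\<integral>x. (f x - c)\<^sup>2 \<partial>N)"
  proof -
    define e where "e = N.expectation f"
    have j5: "integrable N (\<lambda>x. (f x - e)\<^sup>2)"
    proof -
      have "integrable N (\<lambda>x. (f x - c)\<^sup>2 - 2 * (e - c) * f x + (e\<^sup>2 - c\<^sup>2))" using j3 j4 by simp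
      then show ?thesis by (rule back_subst[of "integrable N"]) (auto simp: power2_eq_square algebra_simps)
    qed
    have "(\<integral>x. (f x - c)\<^sup>2 \<partial>N) = (\<integral>x. (f x - e)\<^sup>2 + (2 * (e - c) * f x - 2 * (e - c) * e + (e - c)\<^sup>2) \<partial>N)"
      by (intro Bochner_Integration.integral_cong refl) (simp add: power2_eq_square algebra_simps)
    also have "\<dots> = (\<integral>x. (f x - e)\<^sup>2 \<partial>N) + (2 * (e - c) * e - 2 * (e - c) * e + (e - c)\<^sup>2)"
      using j5 j4 N.prob_space by (simp add: e_def)
    finally show ?thesis by (simp add: e_def)
  qed
  also have "\<dots> \<le> (\<integral>x. 2 * (f x - ?g x)\<^sup>2 + 2 * (?g x - c)\<^sup>2 \<partial>N)"
  proof (intro Bochner_Integration.integral_mono j3)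
    show "integrable N (\<lambda>x. 2 * (f x - ?g x)\<^sup>2 + 2 * (?g x - c)\<^sup>2)" using j1 j2 by simp
    show "(f x - c)\<^sup>2 \<le> 2 * (f x - ?g x)\<^sup>2 + 2 * (?g x - c)\<^sup>2" for x
      using zero_le_power2[of "(f x - ?g x) - (?g x - c)"] by (simp add: power2_eq_square algebra_simps)
  qed
  also have "\<dots> = 2 * (\<integral>x. (f x - ?g x)\<^sup>2 \<partial>N) + 2 * N.variance ?g"
    using j1 j2 by (simp add: c_def)
  also have "\<dots> \<le> 2 * (10 * ?W) + 2 * (8 / (3 * \<psi>) * (800 / h * ?W))"
  proof (intro add_mono mult_left_mono vg)
    have "(\<integral>x. (f x - ?g x)\<^sup>2 \<partial>N) \<le> (\<integral>x. 10 * local_energy f x \<partial>N)"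
      by (intro Bochner_Integration.integral_mono j1 smoothed_error[OF f fC] integrable_mult_right Wint)
    then show "(\<integral>x. (f x - ?g x)\<^sup>2 \<partial>N) \<le> 10 * ?W" by simp
  qed auto
  \<comment> \<open>12800/3 is 2 * 8/3 * 800. As \<open>h * \<psi>\<close> is at most 1/2, the
    numerator is at most 10 + 12800/3, which is below 4300.\<close>
  also have "\<dots> = (20 * (h * \<psi>) + 12800 / 3) / (h * \<psi>) * ?W"
    using h_pos psi_pos by (simp add: field_simps)
  also have "\<dots> \<le> 4300 / (h * \<psi>) * ?W"
    using h_pos psi_pos h\<psi> le by (intro mult_right_mono divide_right_mono Bochner_Integration.integral_nonneg) auto
  finally show ?thesis .
qed

end

section \<open>Spectral gap of the block chain\<close>

context mala_block begin

definition weight :: "(nat \<Rightarrow> real) \<Rightarrow> real" where "weight x = exp (- (h / 4 * dot m (A x) (A x)))"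
definition accept :: "(nat \<Rightarrow> real) \<Rightarrow> (nat \<Rightarrow> real) \<Rightarrow> real" where "accept x y = min 1 (exp (- D x y))"
text \<open>The density of accepted moves relative to \<open>N\<close>, instead of Lebesgue measure;
  in this normalisation detailed balance is plain symmetry.\<close>

definition kern :: "(nat \<Rightarrow> real) \<Rightarrow> (nat \<Rightarrow> real) \<Rightarrow> real" where
  "kern x y = pdens x y * accept x y * (Z / exp (- quad y / 2))"
text \<open>The form of I/h - A, positive by \<open>upper\<close>. The kernel S of the overview is
  exp of minus a quarter of this form at x - y, times a function of x and the same function of
  y.\<close>

definition cquad :: "(nat \<Rightarrow> real) \<Rightarrow> real" where "cquad u = dot m u u / h - quad u"

lemma weight_pos: "0 < weight x" by (simp add: weight_def)

lemma accept_bounds: "0 < accept x y" "accept x y \<le> 1" by (simp_all add: accept_def)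

lemma barker_le_accept: "barker x y \<le> accept x y"
proof -
  have "1 + exp (D x y) > 0" using exp_gt_zero[of "D x y"] by linarith
  then show ?thesis unfolding accept_def barker_def by (simp add: exp_minus field_simps)
qed

lemma weight_accept: "weight x * accept x y = min (weight x) (weight y)"
proof -
  have "weight x * exp (- D x y) = weight y"
    unfolding weight_def D_def exp_add[symmetric] by (simp add: algebra_simps)
  moreover have "weight x * min 1 (exp (- D x y)) = min (weight x * 1) (weight x * exp (- D x y))"
    using weight_pos[of x] by (simp add: min_mult_distrib_left)
  ultimately show ?thesis by (simp add: accept_def)
qed

lemma cquad_lincomb: "cquad (\<lambda>i. c * x i + s * y i) = c\<^sup>2 * cquad x + 2 * c * s * (dot m x y / h - dot m
    x (A y)) + s\<^sup>2 * cquad y"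
  unfolding cquad_def quad_lincomb dot_lincomb_left dot_lincomb_right dot_commute[of m y x]
  using h_pos by (simp add: field_simps power2_eq_square)

lemma cquad_ge: "dot m u u / (2 * h) \<le> cquad u"
proof -
  have "2 * quad u \<le> dot m u u / h" using upper[of u] h_pos by (simp add: quad_def field_simps)
  then show ?thesis unfolding cquad_def by (simp add: field_simps)
qed

text \<open>Read through exp, a product of Gaussians in z centred at x and at y is a Gaussian in z
  centred at the midpoint times a Gaussian in x - y. Integrating over z exhibits the latter as a
  mixture of products.\<close>

lemma cquad_parallelogram:
  "cquad (\<lambda>i. 1 * x i + (- 1) * z i) + cquad (\<lambda>i. 1 * y i + (- 1) * z i)
    = 2 * cquad (\<lambda>i. 1 * z i + (- 1) * (1/2 * x i + 1/2 * y i)) + cquad (\<lambda>i. 1 * x i + (- 1) * y i) / 2"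
  unfolding cquad_lincomb dot_lincomb_left dot_lincomb_right mv_lincomb
    dot_A_commute[of z x] dot_A_commute[of z y] dot_commute[of m z x] dot_commute[of m z y]
  by (simp add: power2_eq_square algebra_simps add_divide_distrib diff_divide_distrib)

text \<open>
  Up to the factor \<open>weight x\<close>, the flow from \<open>x\<close> to \<open>y\<close> under the target is symmetric and Gaussian in
  the difference of the two points, hence a mixture of products.
\<close>

lemma pdens_balance:
  "exp (- quad x / 2) * pdens x y
    = (1 / sqrt (4 * pi * h)) ^ m * (exp (- quad x / 4) * exp (- quad y / 4) * exp (- cquad (\<lambda>i. 1 * x i
        + (- 1) * y i) / 4)) * weight x"
proof -
  have e: "eta x y = (\<lambda>i. 1 * (1 * y i + (- 1) * x i) + h * A x i)"
    by (auto simp: eta_def drift_def)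
  have "- quad x / 2 + - dot m (eta x y) (eta x y) / (4 * h)
      = - quad x / 4 + - quad y / 4 + - cquad (\<lambda>i. 1 * x i + (- 1) * y i) / 4 + - (h / 4 * dot m (A x) (A x))"
  proof -
    have "dot m (eta x y) (eta x y)
        = (dot m y y - 2 * dot m x y + dot m x x) + 2 * h * (dot m x (A y) - quad x) + h * h * dot m (A x) (A x)"
      unfolding e dot_lincomb_left dot_lincomb_right dot_commute[of m "A x" x] dot_commute[of m "A x" y]
        dot_commute[of m y x] dot_A_commute[of y x] quad_def by (simp add: algebra_simps)
    moreover have "cquad (\<lambda>i. 1 * x i + (- 1) * y i)
        = (dot m y y - 2 * dot m x y + dot m x x) / h - quad x + 2 * dot m x (A y) - quad y"
      unfolding cquad_lincomb by (simp add: cquad_def algebra_simps add_divide_distrib diff_divide_distrib)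
    ultimately show ?thesis
      using h_pos by (simp add: field_simps)
  qed
  then have "exp (- quad x / 2) * exp (- dot m (eta x y) (eta x y) / (4 * h))
      = exp (- quad x / 4) * exp (- quad y / 4) * exp (- cquad (\<lambda>i. 1 * x i + (- 1) * y i) / 4) * weight x"
    unfolding weight_def by (simp only: exp_add[symmetric])
  then show ?thesis unfolding pdens_eq by (simp add: mult_ac)
qed

lemma kern_eq:
  "kern x y = Z * (1 / sqrt (4 * pi * h)) ^ m * (exp (quad x / 4) * exp (quad y / 4)
     * exp (- cquad (\<lambda>i. 1 * x i + (- 1) * y i) / 4)) * min (weight x) (weight y)"
proof -
  have q: "exp (- quad z / 4) = exp (quad z / 4) * exp (- quad z / 2)" for z
    by (simp add: exp_add[symmetric])
  have "kern x y * (exp (- quad x / 2) * exp (- quad y / 2))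
      = Z * (exp (- quad x / 2) * pdens x y) * accept x y"
    by (simp add: kern_def)
  also have "\<dots> = Z * (1 / sqrt (4 * pi * h)) ^ m * (exp (- quad x / 4) * exp (- quad y / 4) * exp (-
      cquad (\<lambda>i. 1 * x i + (- 1) * y i) / 4)) * min (weight x) (weight y)"
    unfolding pdens_balance weight_accept[symmetric] by simp
  also have "\<dots> = (Z * (1 / sqrt (4 * pi * h)) ^ m * (exp (quad x / 4) * exp (quad y / 4)
     * exp (- cquad (\<lambda>i. 1 * x i + (- 1) * y i) / 4)) * min (weight x) (weight y)) * (exp (- quad x / 2)
         * exp (- quad y / 2))"
    unfolding q[of x] q[of y] by (simp only: mult_ac)
  finally show ?thesis by (subst (asm) mult_cancel_right) simp
qed

lemma kern_sym: "kern x y = kern y x"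
proof -
  have "cquad (\<lambda>i. 1 * x i + (- 1) * y i) = cquad (\<lambda>i. 1 * y i + (- 1) * x i)"
    unfolding cquad_lincomb by (simp add: dot_A_commute[of x y] dot_commute[of m x y])
  then show ?thesis unfolding kern_eq by (simp add: min.commute mult_ac)
qed

lemma kern_nonneg: "0 \<le> kern x y"
  unfolding kern_def using pdens_pos[of x y] accept_bounds[of x y] Z_pos by simp

lemma measurable_accept[measurable (raw)]:
  assumes "\<And>i. i < m \<Longrightarrow> (\<lambda>x. f x i) \<in> borel_measurable K" "\<And>i. i < m \<Longrightarrow> (\<lambda>x. g x i) \<in> borel_measurable K"
  shows "(\<lambda>x. accept (f x) (g x)) \<in> borel_measurable K"
  unfolding accept_def using assms by measurable

lemma measurable_quad_gen[measurable (raw)]: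
  assumes "\<And>i. i < m \<Longrightarrow> (\<lambda>x. f x i) \<in> borel_measurable K"
  shows "(\<lambda>x. quad (f x)) \<in> borel_measurable K"
  unfolding quad_def using assms by measurable

lemma measurable_kern[measurable (raw)]:
  assumes "\<And>i. i < m \<Longrightarrow> (\<lambda>x. f x i) \<in> borel_measurable K" "\<And>i. i < m \<Longrightarrow> (\<lambda>x. g x i) \<in> borel_measurable K"
  shows "(\<lambda>x. kern (f x) (g x)) \<in> borel_measurable K"
  unfolding kern_def using assms by measurable

lemma kern_weight: "exp (- quad y / 2) / Z * kern x y = pdens x y * accept x y"
  unfolding kern_def using Z_pos by simp

lemma kern_mass: "(\<integral>\<^sup>+y. ennreal (kern x y) \<partial>N) \<le> 1"
proof -
  have "(\<integral>\<^sup>+y. ennreal (kern x y) \<partial>N) = (\<integral>\<^sup>+y. ennreal (pdens x y * accept x y) \<partial>M)"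
    using Z_pos kern_nonneg[of x] kern_weight[of _ x]
    by (subst nn_integral_N) (simp_all add: ennreal_mult[symmetric])
  also have "\<dots> \<le> (\<integral>\<^sup>+y. ennreal (pdens x y) \<partial>M)"
    using accept_bounds pdens_pos by (intro nn_integral_mono ennreal_leI) (simp add: mult_left_le less_imp_le)
  also have "\<dots> = (\<integral>\<^sup>+y. 1 \<partial>P x)"
    unfolding P_def by (subst nn_integral_density) simp_all
  also have "\<dots> = 1" using prob_space.emeasure_space_1[OF prob_space_P, of x] by simp
  finally show ?thesis .
qed

sublocale K: symmetric_kernel N kern
proof
  have "(\<lambda>p. kern (fst p) (snd p)) \<in> borel_measurable (M \<Otimes>\<^sub>M M)" by measurable
  moreover have "sets (N \<Otimes>\<^sub>M N) = sets (M \<Otimes>\<^sub>M M)" by (intro sets_pair_measure_cong) simp_all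
  ultimately show "(\<lambda>p. kern (fst p) (snd p)) \<in> borel_measurable (N \<Otimes>\<^sub>M N)"
    by (simp cong: measurable_cong_sets)
qed (use kern_nonneg kern_mass in \<open>auto intro: kern_sym\<close>)

lemma integral_kern:
  assumes [measurable]: "f \<in> borel_measurable M"
  shows "(\<integral>y. kern x y * f y \<partial>N) = (\<integral>y. accept x y * f y \<partial>P x)"
proof -
  have "(\<integral>y. kern x y * f y \<partial>N) = (\<integral>y. (exp (- quad y / 2) / Z * kern x y) * f y \<partial>M)"
    by (subst integral_N) (simp_all add: mult.assoc)
  also have "\<dots> = (\<integral>y. accept x y * f y \<partial>P x)"
    unfolding kern_weight by (subst integral_P) (simp_all add: mult.assoc)
  finally show ?thesis .
qed

lemma step_eq:
  assumes [measurable]: "f \<in> borel_measurable M"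
  shows "K.step f x = (\<integral>y. accept x y * f y \<partial>P x) + (1 - (\<integral>y. accept x y \<partial>P x)) * f x"
  unfolding K.step_def K.mass_def using integral_kern[OF assms] integral_kern[of "\<lambda>_. 1"] by simp

text \<open>The mixture index is a pair: a centre z for the Gaussian factor, and a level t with
  which the minimum of the two weights becomes the length of the intersection of
  \<open>{0..<weight x}\<close> and \<open>{0..<weight y}\<close>.\<close>

lemma kform_nonneg:
  assumes f: "f \<in> L2_functions N"
  shows "0 \<le> K.kform f f"
proof -
  interpret MM: sigma_finite_measure M by (rule sigma_finite_block_space)
  interpret PL: pair_sigma_finite M lborel by standard
  define Cc where "Cc = (\<integral>x. exp (- cquad x) \<partial>M)"
  have ci: "integrable M (\<lambda>x. exp (- cquad x))"
  proof (rule Bochner_Integration.integrable_bound[OF integrable_prod_exp_neg_square])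
    show "0 < 1 / (2 * h)" using h_pos by simp
    have "exp (- cquad x) \<le> (\<Prod>i<m. exp (- (1 / (2 * h)) * (x i - 0)\<^sup>2))" for x
    proof -
      have "(\<Prod>i<m. exp (- (1 / (2 * h)) * (x i - 0)\<^sup>2)) = exp (- (dot m x x / (2 * h)))"
        by (simp add: exp_sum[symmetric] dot_def sum_divide_distrib power2_eq_square sum_negf)
      then show ?thesis using cquad_ge[of x] by simp
    qed
    then show "AE x in M. norm (exp (- cquad x)) \<le> norm (\<Prod>i<m. exp (- (1 / (2 * h)) * (x i - 0)\<^sup>2))"
      by (simp add: prod_nonneg)
    show "(\<lambda>x. exp (- cquad x)) \<in> borel_measurable M" unfolding cquad_def by measurable
  qed
  have Cc: "0 < Cc"
    unfolding Cc_def by (rule integral_pos[OF ci _ emeasure_space_block_space]) simp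
  \<comment> \<open>Chosen so that \<open>B * B * Cc\<close> is the constant in
    \<open>kern_eq\<close>; the factor \<open>Cc\<close> arises when the midpoint Gaussian is
    integrated over \<open>z\<close>.\<close>
  define B where "B = sqrt (Z * (1 / sqrt (4 * pi * h)) ^ m / Cc)"
  have B: "0 \<le> B" and B2: "B * B = Z * (1 / sqrt (4 * pi * h)) ^ m / Cc"
    using Z_pos Cc h_pos by (simp_all add: B_def)
  define e where "e x z = B * exp (quad x / 4) * exp (- cquad (\<lambda>i. 1 * x i + (- 1) * z i) / 2)" for x z
      :: "nat \<Rightarrow> real"
  define \<rho> where "\<rho> x p = e x (fst p) * indicator {0..<weight x} (snd p)" for x and p :: "(nat \<Rightarrow> real) \<times> real"
  have e0: "0 \<le> e x z" for x z using B by (simp add: e_def)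
  show ?thesis
  proof (rule K.kform_nonneg_of_mixture[OF PL.sigma_finite_measure_axioms, where \<rho>=\<rho>, OF _ _ _ f])
    show "0 \<le> \<rho> x w" for x w using e0 by (simp add: \<rho>_def)
    have "(\<lambda>p. \<rho> (fst p) (snd p)) = (\<lambda>p. e (fst p) (fst (snd p)) * (if 0 \<le> snd (snd p) \<and> snd (snd p) <
        weight (fst p) then 1 else 0))"
      by (auto simp: \<rho>_def indicator_def)
    also have "\<dots> \<in> borel_measurable (N \<Otimes>\<^sub>M (M \<Otimes>\<^sub>M lborel))"
      unfolding e_def cquad_def weight_def by measurable
    finally show "(\<lambda>p. \<rho> (fst p) (snd p)) \<in> borel_measurable (N \<Otimes>\<^sub>M (M \<Otimes>\<^sub>M lborel))" .
  next
    fix x y :: "nat \<Rightarrow> real"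
    let ?m = "\<lambda>i. 1/2 * x i + 1/2 * y i"
    have em: "(\<lambda>z. e u z) \<in> borel_measurable M" for u unfolding e_def cquad_def by measurable
    have ee: "e x z * e y z = (B * B * (exp (quad x / 4) * exp (quad y / 4)) * exp (- cquad (\<lambda>i. 1 * x i
        + (- 1) * y i) / 4)) * exp (- cquad (\<lambda>i\<in>{..<m}. z i + - ?m i))" for z
    proof -
      have "cquad (\<lambda>i\<in>{..<m}. z i + - ?m i) = cquad (\<lambda>i. 1 * z i + (- 1) * ?m i)"
        by (simp add: cquad_def)
      then have "- cquad (\<lambda>i. 1 * x i + (- 1) * z i) / 2 + - cquad (\<lambda>i. 1 * y i + (- 1) * z i) / 2
          = - cquad (\<lambda>i. 1 * x i + (- 1) * y i) / 4 + - cquad (\<lambda>i\<in>{..<m}. z i + - ?m i)"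
        using cquad_parallelogram[of x z y] by (simp only:)
      then have "exp (- cquad (\<lambda>i. 1 * x i + (- 1) * z i) / 2) * exp (- cquad (\<lambda>i. 1 * y i + (- 1) * z i) / 2)
          = exp (- cquad (\<lambda>i. 1 * x i + (- 1) * y i) / 4) * exp (- cquad (\<lambda>i\<in>{..<m}. z i + - ?m i))"
        by (simp only: exp_add[symmetric])
      then show ?thesis unfolding e_def by (simp only: mult_ac)
    qed
    have ind: "(\<integral>\<^sup>+t. indicator {0..<min (weight x) (weight y)} t \<partial>lborel) = ennreal (min (weight x) (weight y))"
      using weight_pos[of x] weight_pos[of y] by simp
    have "(\<integral>\<^sup>+w. ennreal (\<rho> x w * \<rho> y w) \<partial>(M \<Otimes>\<^sub>M lborel))
        = (\<integral>\<^sup>+w. ennreal (e x (fst w) * e y (fst w)) * indicator {0..<min (weight x) (weight y)} (snd w)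
            \<partial>(M \<Otimes>\<^sub>M lborel))"
      by (intro nn_integral_cong) (auto simp: \<rho>_def indicator_def)
    also have "\<dots> = (\<integral>\<^sup>+z. (\<integral>\<^sup>+t. ennreal (e x z * e y z) * indicator {0..<min (weight x) (weight y)} t \<partial>lborel) \<partial>M)"
      using em by (subst lborel.nn_integral_fst[symmetric]) simp_all
    also have "\<dots> = (\<integral>\<^sup>+z. ennreal (e x z * e y z) * ennreal (min (weight x) (weight y)) \<partial>M)"
      by (simp add: nn_integral_cmult ind)
    also have "\<dots> = (\<integral>\<^sup>+z. ennreal (e x z * e y z) \<partial>M) * ennreal (min (weight x) (weight y))"
      using em by (simp add: nn_integral_multc)
    also have "(\<integral>\<^sup>+z. ennreal (e x z * e y z) \<partial>M) = ennreal (B * B * (exp (quad x / 4) * exp (quad y /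
        4)) * exp (- cquad (\<lambda>i. 1 * x i + (- 1) * y i) / 4)) * (\<integral>\<^sup>+z. ennreal (exp (- cquad (\<lambda>i\<in>{..<m}. z
        i + - ?m i))) \<partial>M)"
      unfolding ee using B by (subst nn_integral_cmult[symmetric]) (auto simp: cquad_def ennreal_mult)
    also have "(\<integral>\<^sup>+z. ennreal (exp (- cquad (\<lambda>i\<in>{..<m}. z i + - ?m i))) \<partial>M) = (\<integral>\<^sup>+z. ennreal (exp (- cquad z)) \<partial>M)"
      using nn_integral_block_space_translate[of "\<lambda>z. ennreal (exp (- cquad z))" m "\<lambda>i. - ?m i"]
      unfolding cquad_def by simp
    also have "\<dots> = ennreal Cc"
      unfolding Cc_def by (intro nn_integral_eq_integral ci) simp
    also have "ennreal (B * B * (exp (quad x / 4) * exp (quad y / 4)) * exp (- cquad (\<lambda>i. 1 * x i + (- 1)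
        * y i) / 4)) * ennreal Cc * ennreal (min (weight x) (weight y))
        = ennreal (B * B * (exp (quad x / 4) * exp (quad y / 4)) * exp (- cquad (\<lambda>i. 1 * x i + (- 1) * y
            i) / 4) * Cc * min (weight x) (weight y))"
      using Cc B weight_pos[of x] weight_pos[of y]
      by (simp only: ennreal_mult[symmetric] zero_le_mult_iff exp_ge_zero less_imp_le min_def simp_thms if_split)
    also have "B * B * (exp (quad x / 4) * exp (quad y / 4)) * exp (- cquad (\<lambda>i. 1 * x i + (- 1) * y i) /
        4) * Cc * min (weight x) (weight y) = kern x y"
      unfolding B2 kern_eq using Cc by simp
    finally show "ennreal (kern x y) = (\<integral>\<^sup>+w. ennreal (\<rho> x w * \<rho> y w) \<partial>(M \<Otimes>\<^sub>M lborel))" by simp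
  qed
qed

text \<open>\<open>barker_le_accept\<close> passes from Barker to Metropolis acceptance. The factor
  2 undoes the 1/2 in \<open>dirichlet\<close> and is how 4300 becomes 8600.\<close>

lemma dirichlet_ge:
  assumes f[measurable]: "f \<in> borel_measurable M" and fC: "\<And>y. \<bar>f y\<bar> \<le> C"
  shows "(\<integral>x. local_energy f x \<partial>N) \<le> 2 * K.dirichlet f"
proof -
  have C: "(f x)\<^sup>2 \<le> C\<^sup>2" for x using power_mono[OF fC[of x], of 2] by simp
  have L2: "f \<in> L2_functions N"
    unfolding L2_functions_def
    by (auto intro!: N.integrable_const_bound[where B="C\<^sup>2"] simp: C)
  note int = K.dirichlet_eq(2)[OF L2]
  have "(\<integral>x. local_energy f x \<partial>N) \<le> (\<integral>x. (\<integral>y. kern x y * (f x - f y)\<^sup>2 \<partial>N) \<partial>N)"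
  proof (rule Bochner_Integration.integral_mono)
    show "integrable N (local_energy f)"
      by (rule N.integrable_const_bound[where B="(2 * C)\<^sup>2"]) (use local_energy_bound[OF f fC] in auto)
    show "integrable N (\<lambda>x. \<integral>y. kern x y * (f x - f y)\<^sup>2 \<partial>N)"
      using NN.integrable_fst'[OF int] by simp
    fix x
    interpret P: prob_space "P x" by (rule prob_space_P)
    have sq: "(f y - f x)\<^sup>2 \<le> (2 * C)\<^sup>2" for y by (rule diff_square_le[OF fC fC])
    have "local_energy f x \<le> (\<integral>y. accept x y * (f x - f y)\<^sup>2 \<partial>P x)"
      unfolding local_energy_def
    proof (rule Bochner_Integration.integral_mono)
      show "integrable (P x) (\<lambda>y. barker x y * (f y - f x)\<^sup>2)"
        by (rule integrable_barker_mult(1)[of _ "(2 * C)\<^sup>2"]) (use sq in auto)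
      show "integrable (P x) (\<lambda>y. accept x y * (f x - f y)\<^sup>2)"
      proof (rule P.integrable_const_bound[where B="(2 * C)\<^sup>2"])
        have "accept x y * (f x - f y)\<^sup>2 \<le> (2 * C)\<^sup>2" for y
          using mult_mono[of "accept x y" 1 "(f x - f y)\<^sup>2" "(2 * C)\<^sup>2"] sq[of y] accept_bounds[of x y]
          by (simp add: power2_commute)
        then show "AE y in P x. norm (accept x y * (f x - f y)\<^sup>2) \<le> (2 * C)\<^sup>2"
          using accept_bounds by (simp add: abs_mult less_imp_le)
      qed simp
      show "barker x y * (f y - f x)\<^sup>2 \<le> accept x y * (f x - f y)\<^sup>2" for y
        using barker_le_accept[of x y] by (simp add: power2_commute mult_right_mono)
    qed
    also have "\<dots> = (\<integral>y. kern x y * (f x - f y)\<^sup>2 \<partial>N)"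
      by (rule integral_kern[symmetric]) simp
    finally show "local_energy f x \<le> (\<integral>y. kern x y * (f x - f y)\<^sup>2 \<partial>N)" .
  qed
  also have "\<dots> = 2 * K.dirichlet f"
    unfolding K.dirichlet_def using NN.integral_fst'[OF int] by simp
  finally show ?thesis .
qed

theorem mala_step_contraction:
  assumes f: "f \<in> L2_functions N" and h\<psi>: "2 * h * \<psi> \<le> 1"
  shows "(\<integral>x. (K.step f x - N.expectation f)\<^sup>2 \<partial>N) \<le> (1 - h * \<psi> / 8600)\<^sup>2 * (\<integral>x. (f x)\<^sup>2 \<partial>N)"
proof (rule K.step_contraction[OF kform_nonneg _ _ _ f])
  fix f :: "(nat \<Rightarrow> real) \<Rightarrow> real" assume f: "f \<in> L2_functions N"
  show "h * \<psi> / 8600 * N.variance f \<le> K.dirichlet f"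
  proof (rule K.gap_of_bounded[OF _ f])
    fix g :: "(nat \<Rightarrow> real) \<Rightarrow> real" and C assume g: "g \<in> borel_measurable N" "\<And>x. \<bar>g x\<bar> \<le> C"
    then have "N.variance g \<le> 4300 / (h * \<psi>) * (\<integral>x. local_energy g x \<partial>N)"
      by (intro variance_le_local_energy[OF _ _ h\<psi>]) auto
    also have "\<dots> \<le> 4300 / (h * \<psi>) * (2 * K.dirichlet g)"
      using g h_pos psi_pos by (intro mult_left_mono dirichlet_ge) auto
    finally show "h * \<psi> / 8600 * N.variance g \<le> K.dirichlet g"
      using h_pos psi_pos by (simp add: field_simps)
  qed
qed (use h_pos psi_pos h\<psi> in auto)

end

section \<open>Quadratic forms and spectra\<close>

text \<open>A minimiser on the unit sphere exists by compactness, and homogeneity extends its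
  inequality to all \<open>w\<close>. The index set is arbitrary, which covers one block as well as
  all coordinates of all blocks.\<close>

lemma quadratic_form_min:
  fixes c :: "'a \<Rightarrow> 'a \<Rightarrow> real"
  assumes I: "finite I" "I \<noteq> {}"
  shows "\<exists>v. (\<Sum>a\<in>I. (v a)\<^sup>2) = 1 \<and>
    (\<forall>w. (\<Sum>a\<in>I. \<Sum>b\<in>I. c a b * v a * v b) * (\<Sum>a\<in>I. (w a)\<^sup>2) \<le> (\<Sum>a\<in>I. \<Sum>b\<in>I. c a b * w a * w b))"
proof -
  let ?q = "\<lambda>w::'a \<Rightarrow> real. \<Sum>a\<in>I. \<Sum>b\<in>I. c a b * w a * w b"
  \<comment> \<open>Coordinates outside \<open>I\<close> are pinned to 0, which makes this cube a
    product of compact sets and hence compact in the function space.\<close>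
  define K where "K = Pi\<^sub>E UNIV (\<lambda>a. if a \<in> I then {-1..1::real} else {0})"
  define S where "S = K \<inter> {v. (\<Sum>a\<in>I. (v a)\<^sup>2) = 1}"
  have "compactin (product_topology (\<lambda>_. euclidean) UNIV) K"
    unfolding K_def by (subst compactin_PiE) auto
  then have "compact K"
    by (simp add: euclidean_product_topology)
  moreover have "closed {v::'a \<Rightarrow> real. (\<Sum>a\<in>I. (v a)\<^sup>2) = 1}"
    by (intro closed_Collect_eq continuous_intros continuous_on_product_coordinates)
  ultimately have S: "compact S" unfolding S_def by (rule compact_Int_closed)
  obtain a0 where a0: "a0 \<in> I" using I by auto
  have in_K: "v \<in> K" if "\<And>a. a \<notin> I \<Longrightarrow> v a = 0" "(\<Sum>a\<in>I. (v a)\<^sup>2) = 1" for v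
  proof -
    have "\<bar>v a\<bar> \<le> 1" if "a \<in> I" for a
    proof -
      have "(v a)\<^sup>2 \<le> (\<Sum>a\<in>I. (v a)\<^sup>2)" using I that by (intro member_le_sum) auto
      then show ?thesis using \<open>(\<Sum>a\<in>I. (v a)\<^sup>2) = 1\<close> by (simp add: abs_square_le_1)
    qed
    then show ?thesis using that(1) by (auto simp: K_def abs_le_iff)
  qed
  have "(\<lambda>a. if a = a0 then 1 else 0) \<in> S"
    using a0 I unfolding S_def by (intro IntI in_K CollectI) (auto simp: if_distrib[of "\<lambda>x. x\<^sup>2"] cong: if_cong)
  then have "S \<noteq> {}" by auto
  moreover have "continuous_on S ?q"
    by (intro continuous_intros continuous_on_subset[OF continuous_on_product_coordinates]) auto
  ultimately obtain v where v: "v \<in> S" "\<And>y. y \<in> S \<Longrightarrow> ?q v \<le> ?q y"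
    using continuous_attains_inf[OF S] by blast
  have "?q v * (\<Sum>a\<in>I. (w a)\<^sup>2) \<le> ?q w" for w
  proof (cases "(\<Sum>a\<in>I. (w a)\<^sup>2) = 0")
    case True
    then have "\<forall>a\<in>I. w a = 0" using I by (subst (asm) sum_nonneg_eq_0_iff) auto
    then show ?thesis using True by simp
  next
    case False
    define N where "N = (\<Sum>a\<in>I. (w a)\<^sup>2)"
    have N: "N > 0" using False sum_nonneg[of I "\<lambda>a. (w a)\<^sup>2"] by (simp add: N_def)
    define y where "y a = (if a \<in> I then w a / sqrt N else 0)" for a
    have "(\<Sum>a\<in>I. (y a)\<^sup>2) = 1"
    proof -
      have "(\<Sum>a\<in>I. (y a)\<^sup>2) = (\<Sum>a\<in>I. (w a)\<^sup>2 / N)"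
        using N by (intro sum.cong) (auto simp: y_def power_divide)
      then show ?thesis using N by (simp add: sum_divide_distrib[symmetric] N_def)
    qed
    then have "y \<in> S" by (auto simp: S_def y_def intro!: in_K)
    then have "?q v \<le> ?q y" by (rule v(2))
    also have "?q y = (\<Sum>a\<in>I. \<Sum>b\<in>I. c a b * w a * w b / N)"
      using N by (intro sum.cong refl) (auto simp: y_def)
    also have "\<dots> = ?q w / N" by (simp add: sum_divide_distrib)
    finally show ?thesis using N by (simp add: N_def[symmetric] field_simps)
  qed
  then show ?thesis using v(1) unfolding S_def by blast
qed

text \<open>The minimiser of the Rayleigh quotient is an eigenvector: along each coordinate
  direction \<open>dot m w (mv m a w) - l * dot m w w\<close> is a nonnegative quadratic in t that
  vanishes at 0, so its linear coefficient is 0.\<close>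

lemma symmetric_form_eigenvector:
  assumes sym: "\<And>i k. i < m \<Longrightarrow> k < m \<Longrightarrow> a i k = a k i" and m: "m > 0"
  shows "\<exists>v l. dot m v v = 1 \<and> (\<forall>i<m. mv m a v i = l * v i) \<and> (\<forall>w. l * dot m w w \<le> dot m w (mv m a w))"
proof -
  have q: "(\<Sum>i\<in>{..<m}. \<Sum>k\<in>{..<m}. a i k * w i * w k) = dot m w (mv m a w)" for w
    by (simp add: dot_def mv_def sum_distrib_left mult_ac)
  have n: "(\<Sum>i\<in>{..<m}. (w i)\<^sup>2) = dot m w w" for w by (simp add: dot_def power2_eq_square)
  obtain v where v: "dot m v v = 1" "\<And>w. dot m v (mv m a v) * dot m w w \<le> dot m w (mv m a w)"
    using quadratic_form_min[of "{..<m}" a] m unfolding q n by auto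
  define l where "l = dot m v (mv m a v)"
  have "mv m a v i = l * v i" if i: "i < m" for i
  proof -
    define w where "w = (\<lambda>k. if k = i then 1 else 0::real)"
    have e: "dot m w u = u i" for u
      using i by (simp add: dot_def w_def if_distrib[of "\<lambda>c. c * _"] cong: if_cong)
    have "(dot m w (mv m a v) - l * dot m w v)\<^sup>2 \<le> 0 * (dot m w (mv m a w) - l * dot m w w)"
    proof (rule quadratic_nonneg_discriminant)
      fix t
      have "0 \<le> dot m (\<lambda>i. 1 * v i + t * w i) (mv m a (\<lambda>i. 1 * v i + t * w i)) - l * dot m (\<lambda>i. 1 * v i +
          t * w i) (\<lambda>i. 1 * v i + t * w i)"
        using v(2)[of "\<lambda>i. 1 * v i + t * w i"] by (simp add: l_def)
      also have "\<dots> = 0 + 2 * t * (dot m w (mv m a v) - l * dot m w v) + t\<^sup>2 * (dot m w (mv m a w) - l * dot m w w)"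
        unfolding mv_lincomb dot_lincomb_left dot_lincomb_right
        using dot_mv_symmetric[of m a v w, OF sym] dot_commute[of m v w] v(1) l_def
        by (simp add: power2_eq_square algebra_simps)
      finally show "0 \<le> 0 + 2 * t * (dot m w (mv m a v) - l * dot m w v) + t\<^sup>2 * (dot m w (mv m a w) - l
          * dot m w w)" .
    qed
    then show ?thesis by (simp add: e)
  qed
  then show ?thesis using v l_def by blast
qed

section \<open>Spectrum, trace and inverse of library matrices\<close>

lemma scalar_prod_vec: "scalar_prod (Matrix.vec m u) w = dot m u (vec_index w)" if "dim_vec w = m"
  using that by (simp add: scalar_prod_def dot_def atLeast0LessThan)

lemma mult_mat_vec_index:
  assumes "B \<in> carrier_mat m m'" "i < m"
  shows "vec_index (B *\<^sub>v Matrix.vec m' v) i = (\<Sum>k<m'. B $$ (i, k) * v k)"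
  using assms by (simp add: scalar_prod_def atLeast0LessThan row_def)

lemma eigenvalue_of_mv:
  assumes A: "B \<in> carrier_mat m m" and v: "dot m v v = 1" and ev: "\<And>i. i < m \<Longrightarrow> mv m (\<lambda>i k. B $$ (i, k)) v i = l * v i"
  shows "l \<in> spectrum B"
proof -
  have "Matrix.vec m v \<noteq> 0\<^sub>v m"
  proof
    assume "Matrix.vec m v = 0\<^sub>v m"
    then have "v i = 0" if "i < m" for i using that by (metis index_vec index_zero_vec(1))
    then have "dot m v v = 0" by (simp add: dot_def)
    then show False using v by simp
  qed
  moreover have "B *\<^sub>v Matrix.vec m v = l \<cdot>\<^sub>v Matrix.vec m v"
  proof (rule eq_vecI)
    show "dim_vec (B *\<^sub>v Matrix.vec m v) = dim_vec (l \<cdot>\<^sub>v Matrix.vec m v)" using A by simp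
    fix i assume "i < dim_vec (l \<cdot>\<^sub>v Matrix.vec m v)"
    then have i: "i < m" by simp
    then show "vec_index (B *\<^sub>v Matrix.vec m v) i = vec_index (l \<cdot>\<^sub>v Matrix.vec m v) i"
      using ev[OF i] mult_mat_vec_index[OF A i] by (simp add: mv_def)
  qed
  ultimately have "eigenvector B (Matrix.vec m v) l" using A by (simp add: eigenvector_def)
  then show ?thesis unfolding spectrum_def eigenvalue_def by auto
qed

text \<open>The lowest eigenvector found variationally puts the lower bound into the spectrum; the
  upper bound is the same statement for the negated matrix. Finiteness and non-emptiness are what
  \<open>Min\<close> and \<open>Max\<close> require.\<close>

lemma spectrum_Rayleigh:
  assumes A: "B \<in> carrier_mat m m" and m: "m > 0"
    and sym: "\<And>i k. i < m \<Longrightarrow> k < m \<Longrightarrow> B $$ (i, k) = B $$ (k, i)"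
  shows "Min (spectrum B) * dot m w w \<le> dot m w (mv m (\<lambda>i k. B $$ (i, k)) w)"
    and "dot m w (mv m (\<lambda>i k. B $$ (i, k)) w) \<le> Max (spectrum B) * dot m w w"
    and "finite (spectrum B)" "spectrum B \<noteq> {}"
proof -
  show fin: "finite (spectrum B)" using card_finite_spectrum[OF A] by simp
  obtain v l where v: "dot m v v = 1" "\<And>i. i < m \<Longrightarrow> mv m (\<lambda>i k. B $$ (i, k)) v i = l * v i"
      "\<And>w. l * dot m w w \<le> dot m w (mv m (\<lambda>i k. B $$ (i, k)) w)"
    using symmetric_form_eigenvector[of m "\<lambda>i k. B $$ (i, k)"] sym m by blast
  have l: "l \<in> spectrum B" by (rule eigenvalue_of_mv[OF A v(1,2)])
  then show "spectrum B \<noteq> {}" by auto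
  have "Min (spectrum B) \<le> l" using fin l by simp
  then have "Min (spectrum B) * dot m w w \<le> l * dot m w w" by (intro mult_right_mono) auto
  then show "Min (spectrum B) * dot m w w \<le> dot m w (mv m (\<lambda>i k. B $$ (i, k)) w)" using v(3)[of w] by simp
  have neg: "mv m (\<lambda>i k. - B $$ (i, k)) w = (\<lambda>i. - mv m (\<lambda>i k. B $$ (i, k)) w i)" for w
    by (simp add: fun_eq_iff mv_def sum_negf)
  have negd: "dot m w (\<lambda>i. - u i) = - dot m w u" for w u by (simp add: dot_def sum_negf)
  obtain v' l' where v': "dot m v' v' = 1" "\<And>i. i < m \<Longrightarrow> mv m (\<lambda>i k. - B $$ (i, k)) v' i = l' * v' i"
      "\<And>w. l' * dot m w w \<le> dot m w (mv m (\<lambda>i k. - B $$ (i, k)) w)"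
    using symmetric_form_eigenvector[of m "\<lambda>i k. - B $$ (i, k)"] sym m by auto
  have "- l' \<in> spectrum B"
    by (rule eigenvalue_of_mv[OF A v'(1)]) (use v'(2) in \<open>simp add: neg\<close>, metis minus_minus)
  then have "- l' \<le> Max (spectrum B)" using fin by simp
  then have "- l' * dot m w w \<le> Max (spectrum B) * dot m w w" by (intro mult_right_mono) auto
  then show "dot m w (mv m (\<lambda>i k. B $$ (i, k)) w) \<le> Max (spectrum B) * dot m w w"
    using v'(3)[of w] unfolding neg negd by simp
qed

lemma mat_trace_square:
  assumes A: "B \<in> carrier_mat m m" and sym: "\<And>i k. i < m \<Longrightarrow> k < m \<Longrightarrow> B $$ (i, k) = B $$ (k, i)"
  shows "mat_trace (B ^\<^sub>m 2) = (\<Sum>i<m. \<Sum>k<m. (B $$ (i, k))\<^sup>2)"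
proof -
  have "B ^\<^sub>m 2 = B * B" using A by (simp add: numeral_2_eq_2)
  then have "mat_trace (B ^\<^sub>m 2) = (\<Sum>i<m. (B * B) $$ (i, i))" using A by (simp add: mat_trace_def)
  also have "\<dots> = (\<Sum>i<m. \<Sum>k<m. (B $$ (i, k))\<^sup>2)"
  proof (intro sum.cong refl)
    fix i assume "i \<in> {..<m}"
    then have "(B * B) $$ (i, i) = (\<Sum>k<m. B $$ (i, k) * B $$ (k, i))"
      using A by (simp add: scalar_prod_def atLeast0LessThan)
    also have "\<dots> = (\<Sum>k<m. (B $$ (i, k))\<^sup>2)"
      using sym \<open>i \<in> {..<m}\<close> by (intro sum.cong refl) (simp add: power2_eq_square)
    finally show "(B * B) $$ (i, i) = (\<Sum>k<m. (B $$ (i, k))\<^sup>2)" .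
  qed
  finally show ?thesis .
qed

text \<open>A kernel vector would annihilate the form, so the determinant is nonzero and
  \<open>mat_inverse\<close> does not return \<open>None\<close>. This gives meaning to
  \<open>the\<close> in \<open>cond_mean\<close>.\<close>

lemma mat_inverse_of_pos_def:
  assumes A: "B \<in> carrier_mat m m"
    and pd: "\<And>w. dot m w w \<noteq> 0 \<Longrightarrow> dot m w (mv m (\<lambda>i k. B $$ (i, k)) w) \<noteq> (0::real)"
  shows "\<exists>C. mat_inverse B = Some C \<and> C \<in> carrier_mat m m \<and> B * C = 1\<^sub>m m"
proof -
  have "det B \<noteq> 0"
  proof
    assume "det B = 0"
    then obtain u where u: "u \<in> carrier_vec m" "u \<noteq> 0\<^sub>v m" "B *\<^sub>v u = 0\<^sub>v m"
      using det_0_iff_vec_prod_zero[OF A] by auto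
    define w where "w = vec_index u"
    have uw: "u = Matrix.vec m w" using u(1) by (intro eq_vecI) (auto simp: w_def)
    have "\<exists>i<m. w i \<noteq> 0"
    proof (rule ccontr)
      assume "\<not> (\<exists>i<m. w i \<noteq> 0)"
      then have "u = 0\<^sub>v m" unfolding uw by (intro eq_vecI) auto
      then show False using u(2) by simp
    qed
    then have "dot m w w \<noteq> 0" unfolding dot_def by (subst sum_nonneg_eq_0_iff) auto
    moreover have "mv m (\<lambda>i k. B $$ (i, k)) w i = 0" if "i < m" for i
      using u(3) mult_mat_vec_index[OF A that, of w] that by (simp add: uw[symmetric] mv_def)
    then have "dot m w (mv m (\<lambda>i k. B $$ (i, k)) w) = 0" by (simp add: dot_def)
    ultimately show False using pd by blast
  qed
  then have "B \<in> Units (ring_mat TYPE(real) m ())" by (rule det_non_zero_imp_unit[OF A])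
  then obtain C where "mat_inverse B = Some C" using mat_inverse(1)[OF A, of "()"] by (cases "mat_inverse B") auto
  then show ?thesis using mat_inverse(2)[OF A] by auto
qed

section \<open>Conditioning on the other blocks\<close>

locale block_gaussian =
  fixes d :: nat and n :: "nat \<Rightarrow> nat" and \<mu> :: "nat \<Rightarrow> nat \<Rightarrow> real" and Q :: "nat \<Rightarrow> nat \<Rightarrow> real mat" and j :: nat
  assumes n_pos: "\<And>k. k \<in> {1..d} \<Longrightarrow> n k \<ge> 1"
    and pos_def: "block_pos_def d n Q"
    and j: "j \<in> {1..d}"
begin

definition coef :: "nat \<Rightarrow> nat \<Rightarrow> real" where "coef = (\<lambda>i k. Q j j $$ (i, k))"

definition qv :: "nat \<Rightarrow> nat \<Rightarrow> (nat \<Rightarrow> real) \<Rightarrow> nat \<Rightarrow> real" where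
  "qv k l v i = (\<Sum>p<n l. Q k l $$ (i, p) * v p)"

lemma carrier_Q: "k \<in> {1..d} \<Longrightarrow> l \<in> {1..d} \<Longrightarrow> Q k l \<in> carrier_mat (n k) (n l)"
  and transpose_Q: "k \<in> {1..d} \<Longrightarrow> l \<in> {1..d} \<Longrightarrow> Q l k = transpose_mat (Q k l)"
  using pos_def unfolding block_pos_def_def by blast+

lemma Q_sym:
  assumes "k \<in> {1..d}" "l \<in> {1..d}" "i < n k" "p < n l"
  shows "Q l k $$ (p, i) = Q k l $$ (i, p)"
  using transpose_Q[OF assms(1,2)] carrier_Q[OF assms(1,2)] assms(3,4) by simp

lemma block_form_eq: "block_form d n Q v = (\<Sum>k\<in>{1..d}. \<Sum>l\<in>{1..d}. dot (n k) (v k) (qv k l (v l)))"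
  unfolding block_form_def
proof (intro sum.cong refl)
  fix k l assume kl: "k \<in> {1..d}" "l \<in> {1..d}"
  have "dim_vec (Q k l *\<^sub>v Matrix.vec (n l) (v l)) = n k" using carrier_Q[OF kl] by simp
  then have "scalar_prod (Matrix.vec (n k) (v k)) (Q k l *\<^sub>v Matrix.vec (n l) (v l))
      = dot (n k) (v k) (vec_index (Q k l *\<^sub>v Matrix.vec (n l) (v l)))"
    by (rule scalar_prod_vec)
  also have "\<dots> = dot (n k) (v k) (qv k l (v l))"
    by (intro dot_cong refl) (simp add: mult_mat_vec_index[OF carrier_Q[OF kl]] qv_def)
  finally show "scalar_prod (Matrix.vec (n k) (v k)) (Q k l *\<^sub>v Matrix.vec (n l) (v l)) = dot (n k) (v k)
      (qv k l (v l))" .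
qed

lemma qv_jj: "qv j j = mv (n j) coef"
  by (auto simp: qv_def mv_def coef_def fun_eq_iff)

lemma dot_qv_commute:
  assumes kl: "k \<in> {1..d}" "l \<in> {1..d}"
  shows "dot (n l) w (qv l k v) = dot (n k) v (qv k l w)"
proof -
  have "dot (n l) w (qv l k v) = (\<Sum>p<n l. \<Sum>i<n k. w p * Q l k $$ (p, i) * v i)"
    by (simp add: dot_def qv_def sum_distrib_left mult_ac)
  also have "\<dots> = (\<Sum>i<n k. \<Sum>p<n l. w p * Q l k $$ (p, i) * v i)" by (rule sum.swap)
  also have "\<dots> = (\<Sum>i<n k. \<Sum>p<n l. v i * (Q k l $$ (i, p) * w p))"
    using Q_sym[OF kl] by (intro sum.cong refl) simp
  also have "\<dots> = dot (n k) v (qv k l w)" by (simp add: dot_def qv_def sum_distrib_left)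
  finally show ?thesis .
qed

text \<open>The product of the off-diagonal row of blocks Q_{j,-j} with v_{-j}.\<close>

definition cross :: "(nat \<Rightarrow> nat \<Rightarrow> real) \<Rightarrow> nat \<Rightarrow> real" where
  "cross v i = (\<Sum>k\<in>{1..d} - {j}. qv j k (v k) i)"

definition others :: "(nat \<Rightarrow> nat \<Rightarrow> real) \<Rightarrow> real" where
  "others v = (\<Sum>k\<in>{1..d} - {j}. \<Sum>l\<in>{1..d} - {j}. dot (n k) (v k) (qv k l (v l)))"

lemma block_form_split:
  "block_form d n Q v = dot (n j) (v j) (mv (n j) coef (v j)) + 2 * dot (n j) (v j) (cross v) + others v"
proof -
  let ?b = "\<lambda>k l. dot (n k) (v k) (qv k l (v l))"
  have s: "(\<Sum>k\<in>{1..d}. g k) = g j + (\<Sum>k\<in>{1..d} - {j}. g k)" for g :: "nat \<Rightarrow> real"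
    by (rule sum.remove) (use j in auto)
  have "(\<Sum>k\<in>{1..d} - {j}. ?b j k) = dot (n j) (v j) (cross v)"
    unfolding dot_def cross_def by (simp add: sum_distrib_left) (rule sum.swap)
  moreover have "(\<Sum>k\<in>{1..d} - {j}. ?b k j) = (\<Sum>k\<in>{1..d} - {j}. ?b j k)"
    using j by (intro sum.cong refl dot_qv_commute) auto
  moreover have "block_form d n Q v = ?b j j + (\<Sum>k\<in>{1..d} - {j}. ?b j k)
      + ((\<Sum>k\<in>{1..d} - {j}. ?b k j) + others v)"
    unfolding block_form_eq others_def sum.distrib[symmetric] by (simp only: s)
  ultimately show ?thesis by (simp add: qv_jj)
qed

lemma coef_sym: "i < n j \<Longrightarrow> k < n j \<Longrightarrow> coef i k = coef k i"
  unfolding coef_def using Q_sym[OF j j, of k i] by simp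

lemma coef_pos: assumes "dot (n j) w w \<noteq> 0" shows "0 < dot (n j) w (mv (n j) coef w)"
proof -
  define v where "v k = (if k = j then w else (\<lambda>_. 0))" for k
  have "\<exists>i<n j. w i \<noteq> 0"
  proof (rule ccontr)
    assume "\<not> (\<exists>i<n j. w i \<noteq> 0)"
    then have "dot (n j) w w = 0" unfolding dot_def by (intro sum.neutral) auto
    then show False using assms by simp
  qed
  then have "0 < block_form d n Q v" using pos_def j unfolding block_pos_def_def by (auto simp: v_def)
  moreover have "cross v = (\<lambda>_. 0)" by (auto simp: cross_def v_def qv_def fun_eq_iff)
  moreover have "others v = 0" by (auto simp: others_def v_def dot_def)
  ultimately show ?thesis unfolding block_form_split by (simp add: v_def dot_def)
qed

text \<open>Compactness upgrades strict positivity to a uniform bound; for this the blocks are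
  flattened to one index set of pairs. The bound makes the normalising integral of the target
  finite.\<close>

lemma block_form_coercive: "\<exists>\<kappa>>0. \<forall>v. \<kappa> * (\<Sum>k\<in>{1..d}. dot (n k) (v k) (v k)) \<le> block_form d n Q v"
proof -
  define I where "I = Sigma {1..d} (\<lambda>k. {..<n k})"
  define c where "c p q = Q (fst p) (fst q) $$ (snd p, snd q)" for p q :: "nat \<times> nat"
  have I: "finite I" by (simp add: I_def)
  have "(j, 0) \<in> I" using j n_pos[OF j] by (simp add: I_def)
  then have I': "I \<noteq> {}" by auto
  have sI: "(\<Sum>p\<in>I. F p) = (\<Sum>k\<in>{1..d}. \<Sum>i<n k. F (k, i))" for F :: "nat \<times> nat \<Rightarrow> real"
    unfolding I_def by (subst sum.Sigma) (auto simp: case_prod_unfold)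
  have q: "(\<Sum>p\<in>I. \<Sum>q\<in>I. c p q * w p * w q) = block_form d n Q (\<lambda>k i. w (k, i))" for w
  proof -
    have "(\<Sum>p\<in>I. \<Sum>q\<in>I. c p q * w p * w q)
        = (\<Sum>k\<in>{1..d}. \<Sum>i<n k. \<Sum>l\<in>{1..d}. \<Sum>p<n l. w (k, i) * (Q k l $$ (i, p) * w (l, p)))"
      unfolding sI by (simp add: c_def mult_ac)
    also have "\<dots> = block_form d n Q (\<lambda>k i. w (k, i))"
      unfolding block_form_eq by (rule sum.cong[OF refl], subst sum.swap) (simp add: dot_def qv_def sum_distrib_left)
    finally show ?thesis .
  qed
  have nn: "(\<Sum>p\<in>I. (w p)\<^sup>2) = (\<Sum>k\<in>{1..d}. dot (n k) (\<lambda>i. w (k, i)) (\<lambda>i. w (k, i)))" for w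
    unfolding sI by (simp add: dot_def power2_eq_square)
  obtain v where v: "(\<Sum>p\<in>I. (v p)\<^sup>2) = 1"
    "\<And>w. block_form d n Q (\<lambda>k i. v (k, i)) * (\<Sum>p\<in>I. (w p)\<^sup>2) \<le> block_form d n Q (\<lambda>k i. w (k, i))"
    using quadratic_form_min[OF I I', of c] unfolding q by blast
  have "\<exists>p\<in>I. v p \<noteq> 0"
  proof (rule ccontr)
    assume "\<not> (\<exists>p\<in>I. v p \<noteq> 0)"
    then have "(\<Sum>p\<in>I. (v p)\<^sup>2) = 0" by (intro sum.neutral) auto
    then show False using v(1) by simp
  qed
  then have "\<exists>k\<in>{1..d}. \<exists>i<n k. v (k, i) \<noteq> 0" by (auto simp: I_def)
  moreover have "(\<exists>k\<in>{1..d}. \<exists>i<n k. w k i \<noteq> 0) \<longrightarrow> 0 < block_form d n Q w" for w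
    using pos_def unfolding block_pos_def_def by blast
  from this[of "\<lambda>k i. v (k, i)"]
  have "0 < block_form d n Q (\<lambda>k i. v (k, i))" if "\<exists>k\<in>{1..d}. \<exists>i<n k. v (k, i) \<noteq> 0" using that by simp
  ultimately have "0 < block_form d n Q (\<lambda>k i. v (k, i))" by simp
  moreover have "block_form d n Q (\<lambda>k i. v (k, i)) * (\<Sum>k\<in>{1..d}. dot (n k) (w k) (w k)) \<le> block_form d n Q w" for w
    using v(2)[of "\<lambda>p. w (fst p) (snd p)"] unfolding nn by simp
  ultimately show ?thesis by blast
qed

definition Binv :: "real mat" where "Binv = the (mat_inverse (Q j j))"

lemma Binv: "Binv \<in> carrier_mat (n j) (n j)" "Q j j * Binv = 1\<^sub>m (n j)"
proof -
  obtain C where C: "mat_inverse (Q j j) = Some C" "C \<in> carrier_mat (n j) (n j)" "Q j j * C = 1\<^sub>m (n j)"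
    using mat_inverse_of_pos_def[OF carrier_Q[OF j j]] coef_pos unfolding coef_def
    by (metis less_irrefl)
  then show "Binv \<in> carrier_mat (n j) (n j)" "Q j j * Binv = 1\<^sub>m (n j)" by (simp_all add: Binv_def)
qed

lemma mv_Binv: 
  assumes i: "i < n j"
  shows "mv (n j) coef (vec_index (Binv *\<^sub>v Matrix.vec (n j) u)) i = u i"
proof -
  let ?b = "Binv *\<^sub>v Matrix.vec (n j) u"
  have b: "?b = Matrix.vec (n j) (vec_index ?b)" using Binv(1) by (intro eq_vecI) auto
  have "Q j j *\<^sub>v ?b = (Q j j * Binv) *\<^sub>v Matrix.vec (n j) u"
    using Binv(1) carrier_Q[OF j j] by (intro assoc_mult_mat_vec[symmetric]) auto
  also have "\<dots> = Matrix.vec (n j) u" unfolding Binv(2) by simp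
  finally have "vec_index (Q j j *\<^sub>v ?b) i = u i" using i by simp
  moreover have "vec_index (Q j j *\<^sub>v ?b) i = (\<Sum>k<n j. Q j j $$ (i, k) * vec_index ?b k)"
    using mult_mat_vec_index[OF carrier_Q[OF j j] i, of "vec_index ?b"] b by simp
  ultimately show ?thesis by (simp add: mv_def coef_def)
qed

definition shift :: "(nat \<Rightarrow> nat \<Rightarrow> real) \<Rightarrow> nat \<Rightarrow> real" where
  "shift x = vec_index (Binv *\<^sub>v Matrix.vec (n j) (cross (\<lambda>k i. x k i - \<mu> k i)))"

definition cen :: "(nat \<Rightarrow> nat \<Rightarrow> real) \<Rightarrow> nat \<Rightarrow> real" where
  "cen x i = \<mu> j i - shift x i"

text \<open>What remains after completing the square in block j: the Schur complement form of the
  other blocks. By \<open>rest_upd\<close> it is constant along the block, so it cancels in every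
  ratio.\<close>

definition rest :: "(nat \<Rightarrow> nat \<Rightarrow> real) \<Rightarrow> real" where
  "rest x = others (\<lambda>k i. x k i - \<mu> k i) - dot (n j) (shift x) (mv (n j) coef (shift x))"

lemma cross_upd[simp]: "cross (\<lambda>k i. (x(j := z)) k i - \<mu> k i) = cross (\<lambda>k i. x k i - \<mu> k i)"
  unfolding cross_def fun_eq_iff by (intro allI sum.cong refl) auto

lemma others_upd[simp]: "others (\<lambda>k i. (x(j := z)) k i - \<mu> k i) = others (\<lambda>k i. x k i - \<mu> k i)"
  unfolding others_def by (intro sum.cong refl) auto

lemma shift_upd[simp]: "shift (x(j := z)) = shift x"
  unfolding shift_def cross_upd ..

lemma cen_upd[simp]: "cen (x(j := z)) = cen x"
  by (simp add: cen_def[abs_def])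

lemma rest_upd[simp]: "rest (x(j := z)) = rest x"
  unfolding rest_def others_upd shift_upd ..

lemma cond_mean_index: assumes i: "i < n j" shows "vec_index (cond_mean d n \<mu> Q j x) i = cen x i"
proof -
  have "Matrix.vec (n j) (\<lambda>i. \<Sum>k\<in>{1..d} - {j}. vec_index (Q j k *\<^sub>v Matrix.vec (n k) (\<lambda>l. x k l - \<mu> k l)) i)
      = Matrix.vec (n j) (cross (\<lambda>k i. x k i - \<mu> k i))"
    using j mult_mat_vec_index[OF carrier_Q[OF j]]
    by (intro eq_vecI) (auto simp: cross_def qv_def intro!: sum.cong)
  then show ?thesis
    using i Binv(1) unfolding cond_mean_def cen_def shift_def Binv_def[symmetric] by simp
qed

lemma dim_cond_mean: "dim_vec (cond_mean d n \<mu> Q j x) = n j"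
  using Binv(1) by (simp add: cond_mean_def Binv_def[symmetric])

lemma complete_square:
  "block_form d n Q (\<lambda>k i. x k i - \<mu> k i)
    = dot (n j) (\<lambda>i. x j i - cen x i) (mv (n j) coef (\<lambda>i. x j i - cen x i)) + rest x"
proof -
  let ?v = "\<lambda>k i. x k i - \<mu> k i" and ?s = "shift x"
  have e: "(\<lambda>i. x j i - cen x i) = (\<lambda>i. 1 * ?v j i + 1 * ?s i)" by (auto simp: cen_def)
  have c: "dot (n j) w (mv (n j) coef ?s) = dot (n j) w (cross ?v)" for w
    by (rule dot_cong) (simp_all add: shift_def mv_Binv)
  have "dot (n j) ?s (mv (n j) coef (?v j)) = dot (n j) (?v j) (cross ?v)"
    using dot_mv_symmetric[of "n j" coef ?s "?v j", OF coef_sym] c by simp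
  then show ?thesis
    unfolding block_form_split rest_def e mv_lincomb dot_lincomb_left dot_lincomb_right
    by (simp add: c)
qed

end

section \<open>One block in centred coordinates\<close>

locale block_mala = block_gaussian +
  fixes h :: real
  assumes h_pos: "h > 0"
    and h_le: "h \<le> 1 / (2 * Max (spectrum (Q j j)))"
    and h_trace: "h\<^sup>2 \<le> 1 / (10 * mat_trace (Q j j ^\<^sub>m 2))"
begin

abbreviation "\<psi> \<equiv> Min (spectrum (Q j j))"

lemma nj_pos: "n j > 0" using n_pos[OF j] by simp

lemma Rayleigh:
  "\<psi> * dot (n j) w w \<le> dot (n j) w (mv (n j) coef w)"
  "dot (n j) w (mv (n j) coef w) \<le> Max (spectrum (Q j j)) * dot (n j) w w"
  "finite (spectrum (Q j j))" "spectrum (Q j j) \<noteq> {}"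
proof -
  have sym: "Q j j $$ (i, k) = Q j j $$ (k, i)" if "i < n j" "k < n j" for i k
    using coef_sym[OF that] by (simp add: coef_def)
  note R = spectrum_Rayleigh[OF carrier_Q[OF j j] nj_pos sym]
  show "\<psi> * dot (n j) w w \<le> dot (n j) w (mv (n j) coef w)"
    "dot (n j) w (mv (n j) coef w) \<le> Max (spectrum (Q j j)) * dot (n j) w w"
    "finite (spectrum (Q j j))" "spectrum (Q j j) \<noteq> {}"
    using R(1,2)[of w] R(3,4) unfolding coef_def by blast+
qed

lemma eigenvalue_pos: assumes "l \<in> spectrum (Q j j)" shows "l > 0"
proof -
  obtain u where u: "u \<in> carrier_vec (n j)" "u \<noteq> 0\<^sub>v (n j)" "Q j j *\<^sub>v u = l \<cdot>\<^sub>v u"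
    using assms carrier_Q[OF j j] by (auto simp: spectrum_def eigenvalue_def eigenvector_def)
  define w where "w = vec_index u"
  have uw: "u = Matrix.vec (n j) w" using u(1) by (intro eq_vecI) (auto simp: w_def)
  have "\<exists>i<n j. w i \<noteq> 0"
  proof (rule ccontr)
    assume "\<not> (\<exists>i<n j. w i \<noteq> 0)"
    then have "u = 0\<^sub>v (n j)" unfolding uw by (intro eq_vecI) auto
    then show False using u(2) by simp
  qed
  then have nz: "dot (n j) w w \<noteq> 0" unfolding dot_def by (subst sum_nonneg_eq_0_iff) auto
  have "mv (n j) coef w i = l * w i" if "i < n j" for i
  proof -
    have "vec_index (Q j j *\<^sub>v u) i = (\<Sum>k<n j. Q j j $$ (i, k) * w k)"
      using mult_mat_vec_index[OF carrier_Q[OF j j] that, of w] by (simp only: uw[symmetric])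
    moreover have "vec_index (Q j j *\<^sub>v u) i = l * w i" using that u(1,3) by (simp add: w_def)
    ultimately show ?thesis by (simp add: mv_def coef_def)
  qed
  then have "dot (n j) w (mv (n j) coef w) = l * dot (n j) w w"
    by (simp add: dot_def sum_distrib_left mult.left_commute)
  then have "0 < l * dot (n j) w w" using coef_pos[OF nz] by simp
  moreover have "0 \<le> dot (n j) w w" by simp
  ultimately show ?thesis by (simp add: zero_less_mult_iff)
qed

lemma psi_pos: "\<psi> > 0" and Max_pos: "Max (spectrum (Q j j)) > 0"
  using eigenvalue_pos Rayleigh(3,4) by auto

lemma h_Max: "2 * h * Max (spectrum (Q j j)) \<le> 1"
  using h_le Max_pos by (simp add: field_simps)

lemma h_psi: "2 * h * \<psi> \<le> 1"
proof -
  have "\<psi> \<le> Max (spectrum (Q j j))" using Rayleigh(3,4) by (meson Max_in Min_le)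
  then have "2 * h * \<psi> \<le> 2 * h * Max (spectrum (Q j j))" using h_pos by (intro mult_left_mono) auto
  then show ?thesis using h_Max by simp
qed

sublocale G: mala_block "n j" coef \<psi> h
proof
  fix v u :: "nat \<Rightarrow> real" and i k
  show "i < n j \<Longrightarrow> k < n j \<Longrightarrow> coef i k = coef k i" by (rule coef_sym)
  show "\<psi> > 0" by (rule psi_pos)
  show "\<psi> * dot (n j) v v \<le> dot (n j) v (mv (n j) coef v)" by (rule Rayleigh)
  show "\<exists>w. \<forall>i<n j. mv (n j) coef w i = u i" using mv_Binv by blast
  show "h > 0" by (rule h_pos)
  have "2 * h * dot (n j) v (mv (n j) coef v) \<le> 2 * h * (Max (spectrum (Q j j)) * dot (n j) v v)"
    using h_pos by (intro mult_left_mono Rayleigh) auto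
  also have "\<dots> \<le> 1 * dot (n j) v v"
    unfolding mult.assoc[symmetric] by (intro mult_right_mono h_Max) simp
  finally show "2 * h * dot (n j) v (mv (n j) coef v) \<le> dot (n j) v v" by simp
  have tr: "mat_trace (Q j j ^\<^sub>m 2) = (\<Sum>i<n j. \<Sum>k<n j. (coef i k)\<^sup>2)"
    unfolding coef_def using coef_sym by (intro mat_trace_square carrier_Q j) (simp add: coef_def)
  define T where "T = (\<Sum>i<n j. \<Sum>k<n j. (coef i k)\<^sup>2)"
  have "T \<ge> 0" unfolding T_def by (intro sum_nonneg) auto
  \<comment> \<open>The step-size condition divides by the trace, and division by 0 gives 0; a zero
    trace would force \<open>h\<^sup>2 \<le> 0\<close>.\<close>
  moreover have "T \<noteq> 0"
  proof
    assume "T = 0"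
    then have "h\<^sup>2 \<le> 0" using h_trace unfolding tr T_def by simp
    then show False using h_pos by simp
  qed
  ultimately have "h\<^sup>2 * T \<le> 1 / 10" using h_trace unfolding tr T_def[symmetric] by (simp add: field_simps)
  then show "h\<^sup>2 * (\<Sum>i<n j. \<Sum>k<n j. (coef i k)\<^sup>2) \<le> 1 / 10" by (simp add: T_def)
qed

abbreviation "S \<equiv> state_space d n"
abbreviation "M \<equiv> block_space (n j)"

definition dev :: "(nat \<Rightarrow> nat \<Rightarrow> real) \<Rightarrow> (nat \<Rightarrow> real) \<Rightarrow> nat \<Rightarrow> real" where
  "dev x z i = z i - cen x i"

lemma measurable_dev[measurable (raw)]:
  assumes "\<And>i. i < n j \<Longrightarrow> (\<lambda>p. f p i) \<in> borel_measurable K"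
  shows "i < n j \<Longrightarrow> (\<lambda>p. dev x (f p) i) \<in> borel_measurable K"
  unfolding dev_def using assms by measurable

lemma form_dev: "block_form d n Q (\<lambda>k i. x k i - \<mu> k i) = G.quad (dev x (x j)) + rest x"
  using complete_square[of x] by (simp add: G.quad_def dev_def[abs_def])

lemma dev_upd[simp]: "dev (x(j := z)) = dev x"
  by (simp add: dev_def[abs_def])

sublocale SS: product_sigma_finite "\<lambda>k. block_space (n k)"
  by (simp add: product_sigma_finite_def sigma_finite_block_space)

lemma measurable_state_component[measurable]:
  assumes k: "k \<in> {1..d}" and i: "i < n k"
  shows "(\<lambda>x. x k i) \<in> borel_measurable S"
proof -
  have "(\<lambda>x. x k) \<in> measurable S (block_space (n k))"
    unfolding state_space_def by (rule measurable_component_singleton[OF k])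
  from measurable_compose[OF this measurable_block_component[OF i]] show ?thesis .
qed

lemma measurable_cross[measurable (raw)]:
  "i < n j \<Longrightarrow> (\<lambda>x. cross (\<lambda>k i. x k i - \<mu> k i) i) \<in> borel_measurable S"
  unfolding cross_def qv_def
  by (intro borel_measurable_sum borel_measurable_times borel_measurable_diff) auto

lemma shift_eq: "i < n j \<Longrightarrow> shift x i = (\<Sum>k<n j. Binv $$ (i, k) * cross (\<lambda>k i. x k i - \<mu> k i) k)"
  unfolding shift_def by (rule mult_mat_vec_index[OF Binv(1)])

lemma measurable_shift: "i < n j \<Longrightarrow> (\<lambda>x. shift x i) \<in> borel_measurable S"
  by (simp only: shift_eq) (intro borel_measurable_sum borel_measurable_times measurable_cross, auto)

lemma measurable_cen[measurable]: "i < n j \<Longrightarrow> (\<lambda>x. cen x i) \<in> borel_measurable S"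
  unfolding cen_def using measurable_shift by measurable

lemma measurable_form[measurable]: "(\<lambda>x. block_form d n Q (\<lambda>k i. x k i - \<mu> k i)) \<in> borel_measurable S"
  unfolding block_form_eq dot_def qv_def
  by (intro borel_measurable_sum borel_measurable_times borel_measurable_diff) auto

definition Z0 :: real where
  "Z0 = (\<integral>x. exp (- block_form d n Q (\<lambda>k i. x k i - \<mu> k i) / 2) \<partial>S)"

text \<open>Coercivity dominates the integrand by a product of Gaussians. Integrability has to be
  secured, since the Bochner integral of a non-integrable function is 0 and the target density would
  then vanish identically.\<close>

lemma Z0_pos: "Z0 > 0"
proof -
  let ?q = "\<lambda>x. block_form d n Q (\<lambda>k i. x k i - \<mu> k i)"
  obtain \<kappa> where \<kappa>: "\<kappa> > 0" "\<And>v. \<kappa> * (\<Sum>k\<in>{1..d}. dot (n k) (v k) (v k)) \<le> block_form d n Q v"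
    using block_form_coercive by blast
  let ?g = "\<lambda>x. \<Prod>k\<in>{1..d}. \<Prod>i<n k. exp (- (\<kappa> / 2) * (x k i - \<mu> k i)\<^sup>2)"
  have gi: "integrable S ?g"
    unfolding state_space_def
    by (intro SS.product_integrable_prod integrable_prod_exp_neg_square) (use \<kappa> in auto)
  have gb: "exp (- ?q x / 2) \<le> ?g x" for x
  proof -
    have "?g x = exp (- (\<kappa> * (\<Sum>k\<in>{1..d}. dot (n k) (\<lambda>i. x k i - \<mu> k i) (\<lambda>i. x k i - \<mu> k i))) / 2)"
      by (simp add: exp_sum[symmetric] dot_def sum_distrib_left sum_divide_distrib power2_eq_square sum_negf)
    then show ?thesis using \<kappa>(2)[of "\<lambda>k i. x k i - \<mu> k i"] by simp
  qed
  have int: "integrable S (\<lambda>x. exp (- ?q x / 2))"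
  proof (rule Bochner_Integration.integrable_bound[OF gi])
    show "AE x in S. norm (exp (- ?q x / 2)) \<le> norm (?g x)"
      using gb by (intro AE_I2) (simp add: abs_of_nonneg prod_nonneg)
  qed simp
  have ne: "emeasure S (space S) \<noteq> 0"
  proof -
    have "emeasure S (space S) = (\<Prod>k\<in>{1..d}. emeasure (block_space (n k)) (space (block_space (n k))))"
      unfolding state_space_def space_PiM by (intro SS.emeasure_PiM) auto
    then show ?thesis by (simp add: emeasure_space_block_space)
  qed
  show ?thesis unfolding Z0_def by (rule integral_pos[OF int _ ne]) simp
qed

lemma target_density_eq:
  "target_density d n \<mu> Q x = exp (- rest x / 2) / Z0 * exp (- G.quad (dev x (x j)) / 2)"
proof -
  have "exp (- (G.quad (dev x (x j)) + rest x) / 2) = exp (- rest x / 2) * exp (- G.quad (dev x (x j)) / 2)"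
    unfolding exp_add[symmetric] by (rule arg_cong[where f=exp]) (simp add: field_simps)
  then show ?thesis
    unfolding target_density_def gauss_density_def Z0_def[symmetric] unfolding form_dev by simp
qed

text \<open>Along one coordinate the logarithm of the density is a quadratic polynomial in t around
  the current point, so the derivative is its linear coefficient.\<close>

lemma grad_eq:
  assumes i: "i < n j"
  shows "grad_log_density d n \<mu> Q j x i = - mv (n j) coef (dev x (x j)) i"
proof -
  let ?u = "dev x (x j)"
  define e where "e = (\<lambda>k. if k = i then 1 else 0::real)"
  have de: "dot (n j) e w = w i" for w
    using i by (simp add: dot_def e_def if_distrib[of "\<lambda>c. c * _"] cong: if_cong)
  have dev: "dev x ((x j)(i := t)) = (\<lambda>k. 1 * ?u k + (t - x j i) * e k)" for t
    by (auto simp: dev_def e_def)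
  have "dot (n j) ?u (mv (n j) coef e) = mv (n j) coef ?u i"
    using G.dot_A_commute[of ?u e] de by simp
  then have q: "G.quad (dev x ((x j)(i := t))) = G.quad ?u + 2 * (t - x j i) * mv (n j) coef ?u i + (t -
      x j i)\<^sup>2 * G.quad e" for t
    unfolding dev G.quad_lincomb by simp
  have "ln (target_density d n \<mu> Q (x(j := (x j)(i := t))))
      = (- rest x / 2 - ln Z0) - (G.quad ?u + 2 * (t - x j i) * mv (n j) coef ?u i + (t - x j i)\<^sup>2 *
          G.quad e) / 2" for t
    using Z0_pos unfolding target_density_eq rest_upd dev_upd fun_upd_same q
    by (simp add: ln_mult ln_div) (simp add: add_divide_distrib diff_divide_distrib minus_divide_left)
  moreover have "((\<lambda>t. (- rest x / 2 - ln Z0) - (G.quad ?u + 2 * (t - x j i) * mv (n j) coef ?u i + (t -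
      x j i)\<^sup>2 * G.quad e) / 2)
      has_real_derivative - mv (n j) coef ?u i) (at (x j i))"
    by (auto intro!: derivative_eq_intros)
  ultimately show ?thesis unfolding grad_log_density_def by (simp add: DERIV_imp_deriv)
qed

lemma normal_density_shift: "normal_density (e - c) \<sigma> (y - c) = normal_density e \<sigma> y" for c e y \<sigma> :: real
  by (simp add: normal_density_def)

lemma proposal_eq:
  "proposal_density d n \<mu> Q j h x (x(j := z)) = G.pdens (dev x (x j)) (dev x z)"
  unfolding proposal_density_def G.pdens_def
proof (intro prod.cong refl)
  fix i assume "i \<in> {..<n j}"
  then have i: "i < n j" by simp
  have "G.drift (dev x (x j)) i = (x j i + h * grad_log_density d n \<mu> Q j x i) - cen x i"
    by (simp add: G.drift_def grad_eq[OF i] dev_def)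
  then show "normal_density (x j i + h * grad_log_density d n \<mu> Q j x i) (sqrt (2 * h)) ((x(j := z)) j i)
      = normal_density (G.drift (dev x (x j)) i) (sqrt (2 * h)) (dev x z i)"
    by (simp add: normal_density_shift dev_def)
qed

lemma proposal_rev_eq:
  "proposal_density d n \<mu> Q j h (x(j := z)) x = G.pdens (dev x z) (dev x (x j))"
  using proposal_eq[of "x(j := z)" "x j"] by simp

text \<open>By \<open>pdens_balance\<close> the flows in the two directions share a symmetric
  factor, since \<open>cquad\<close> is even; their ratio is therefore the ratio of the weights. The
  factor with \<open>rest x\<close> cancels.\<close>

lemma accept_eq: "accept_prob d n \<mu> Q j h x (x(j := z)) = G.accept (dev x (x j)) (dev x z)"
proof -
  let ?u = "dev x (x j)" and ?w = "dev x z"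
  have D: "exp (- G.D ?u ?w) = G.weight ?w / G.weight ?u"
    unfolding G.weight_def G.D_def exp_diff[symmetric] by (simp add: algebra_simps)
  have c: "G.cquad (\<lambda>i. 1 * ?w i + (- 1) * ?u i) = G.cquad (\<lambda>i. 1 * ?u i + (- 1) * ?w i)"
    unfolding G.cquad_lincomb by (simp add: G.dot_A_commute[of ?w ?u] dot_commute[of _ ?w ?u])
  have "exp (- G.quad ?w / 2) * G.pdens ?w ?u * G.weight ?u = exp (- G.quad ?u / 2) * G.pdens ?u ?w * G.weight ?w"
    unfolding G.pdens_balance c by (simp only: mult_ac)
  then have r: "exp (- G.quad ?w / 2) * G.pdens ?w ?u / (exp (- G.quad ?u / 2) * G.pdens ?u ?w) =
      G.weight ?w / G.weight ?u"
    using G.pdens_pos[of ?u ?w] G.weight_pos[of ?u] by (simp add: field_simps)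
  have "exp (- rest x / 2) / Z0 \<noteq> 0" using Z0_pos by simp
  then have "k * a * b / (k * a' * b') = a * b / (a' * b')" if "k = exp (- rest x / 2) / Z0" for a a' b b' k :: real
    using that by simp
  from this[OF refl] show ?thesis
    unfolding accept_prob_def G.accept_def D target_density_eq proposal_eq proposal_rev_eq rest_upd
        dev_upd fun_upd_same
    using r by simp
qed

definition recentre :: "(nat \<Rightarrow> nat \<Rightarrow> real) \<Rightarrow> (nat \<Rightarrow> real) \<Rightarrow> nat \<Rightarrow> real" where
  "recentre x z = (\<lambda>i\<in>{..<n j}. z i + cen x i)"

lemma measurable_recentre[measurable]: "recentre x \<in> measurable M M"
  unfolding recentre_def by measurable

lemma dev_recentre: "i < n j \<Longrightarrow> dev x (recentre x z) i = z i"
  by (simp add: dev_def recentre_def)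

text \<open>Recentring restricts to indices below \<open>n j\<close>, so
  \<open>dev x (recentre x z)\<close> agrees with \<open>z\<close> only there. These congruences
  allow one to be replaced by the other.\<close>

lemma coordinate_cong:
  assumes "\<And>i. i < n j \<Longrightarrow> u i = u' i" "\<And>i. i < n j \<Longrightarrow> w i = w' i"
  shows "G.quad u = G.quad u'" "G.pdens u w = G.pdens u' w'" "G.accept u w = G.accept u' w'"
proof -
  have A: "mv (n j) coef u = mv (n j) coef u'" "mv (n j) coef w = mv (n j) coef w'"
    by (rule mv_cong; simp add: assms)+
  show "G.quad u = G.quad u'"
    unfolding G.quad_def A by (rule dot_cong) (simp_all add: assms)
  show "G.pdens u w = G.pdens u' w'"
    unfolding G.pdens_def G.drift_def A using assms by (intro prod.cong) auto
  show "G.accept u w = G.accept u' w'" unfolding G.accept_def G.D_def A ..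
qed

lemma quad_dev_recentre[simp]: "G.quad (dev x (recentre x z)) = G.quad z"
  by (rule coordinate_cong(1)[OF dev_recentre refl])

lemma gauss_density_cond:
  "gauss_density M (\<lambda>z. let u = Matrix.vec (n j) z - cond_mean d n \<mu> Q j x in scalar_prod u (Q j j *\<^sub>v u)) z
    = exp (- G.quad (dev x z) / 2) / G.Z"
proof -
  have q: "(let u = Matrix.vec (n j) z - cond_mean d n \<mu> Q j x in scalar_prod u (Q j j *\<^sub>v u)) = G.quad
      (dev x z)" for z
  proof -
    have u: "Matrix.vec (n j) z - cond_mean d n \<mu> Q j x = Matrix.vec (n j) (dev x z)"
      by (rule eq_vecI) (auto simp: dim_cond_mean cond_mean_index dev_def)
    have "dim_vec (Q j j *\<^sub>v Matrix.vec (n j) (dev x z)) = n j" using carrier_Q[OF j j] by simp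
    then show ?thesis
      unfolding Let_def u G.quad_def
      by (subst scalar_prod_vec, assumption, intro dot_cong refl)
        (simp only: mult_mat_vec_index[OF carrier_Q[OF j j]] mv_def coef_def)
  qed
  have "(\<lambda>z. exp (- G.quad (dev x z) / 2)) \<in> borel_measurable M"
    unfolding dev_def by measurable
  from integral_block_space_translate[OF this, of "cen x"]
  have "(\<integral>z. exp (- G.quad (dev x z) / 2) \<partial>M) = G.Z"
    unfolding recentre_def[symmetric] G.Z_def by simp
  then show ?thesis unfolding gauss_density_def q by simp
qed

lemma integral_cond_dist:
  fixes g :: "_ \<Rightarrow> real"
  assumes [measurable]: "g \<in> borel_measurable M"
  shows "(\<integral>z. g z \<partial>cond_dist d n \<mu> Q j x) = (\<integral>z. exp (- G.quad (dev x z) / 2) / G.Z * g z \<partial>M)"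
    and "(\<integral>z. g z \<partial>cond_dist d n \<mu> Q j x) = (\<integral>z. g (recentre x z) \<partial>G.N)"
proof -
  have q[measurable]: "(\<lambda>z. G.quad (dev x z)) \<in> borel_measurable M"
    by measurable
  show 1: "(\<integral>z. g z \<partial>cond_dist d n \<mu> Q j x) = (\<integral>z. exp (- G.quad (dev x z) / 2) / G.Z * g z \<partial>M)"
    unfolding cond_dist_def gauss_density_cond
  proof (rule integral_real_density)
    show "AE z in M. 0 \<le> exp (- G.quad (dev x z) / 2) / G.Z"
      using G.Z_pos by (intro AE_I2) (simp add: less_imp_le)
  qed measurable
  have "(\<lambda>z. exp (- G.quad (dev x z) / 2) / G.Z * g z) \<in> borel_measurable M" by measurable
  from integral_block_space_translate[OF this, of "cen x", symmetric]
  show "(\<integral>z. g z \<partial>cond_dist d n \<mu> Q j x) = (\<integral>z. g (recentre x z) \<partial>G.N)"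
    unfolding 1 recentre_def[symmetric] by (subst G.integral_N) simp_all
qed

end

section \<open>The operators on the full space\<close>

context block_mala begin

definition uni :: "real measure" where "uni = uniform_measure lborel {0..1}"

lemma prob_space_uni: "prob_space uni"
  unfolding uni_def by (rule prob_space_uniform_measure) auto

sublocale U: prob_space uni by (rule prob_space_uni)

lemma sets_uni[simp, measurable_cong]: "sets uni = sets borel" by (simp add: uni_def)
lemma space_uni[simp]: "space uni = UNIV" by (simp add: uni_def)

lemma prob_uni_atMost: "0 \<le> t \<Longrightarrow> t \<le> 1 \<Longrightarrow> U.prob {..t} = t"
proof -
  assume t: "0 \<le> t" "t \<le> 1"
  have "{0..1} \<inter> {..t} = {0..t}" using t by auto
  then show ?thesis using t by (simp add: uni_def measure_uniform_measure)
qed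

lemma measurable_upd:
  assumes "f \<in> measurable K S" "g \<in> measurable K M"
  shows "(\<lambda>p. (f p)(j := g p)) \<in> measurable K S"
  using assms unfolding state_space_def
  by (intro measurable_fun_upd[where I="{1..d}"]) (use j in auto)

lemma measurable_cen_comp:
  assumes "f \<in> measurable K S" shows "i < n j \<Longrightarrow> (\<lambda>p. cen (f p) i) \<in> borel_measurable K"
  using measurable_compose[OF assms measurable_cen] .

lemma measurable_j_comp:
  assumes "f \<in> measurable K S" shows "i < n j \<Longrightarrow> (\<lambda>p. f p j i) \<in> borel_measurable K"
  using measurable_compose[OF assms measurable_state_component[OF j]] .

lemma measurable_dev_gen:
  assumes "f \<in> measurable K S" "\<And>i. i < n j \<Longrightarrow> (\<lambda>p. g p i) \<in> borel_measurable K"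
  shows "i < n j \<Longrightarrow> (\<lambda>p. dev (f p) (g p) i) \<in> borel_measurable K"
  unfolding dev_def using assms by (intro borel_measurable_diff measurable_cen_comp)

lemma measurable_M_comp:
  assumes "g \<in> measurable K M" shows "i < n j \<Longrightarrow> (\<lambda>p. g p i) \<in> borel_measurable K"
  using measurable_compose[OF assms measurable_block_component] .

definition jump :: "((nat \<Rightarrow> nat \<Rightarrow> real) \<Rightarrow> real) \<Rightarrow> (nat \<Rightarrow> nat \<Rightarrow> real) \<Rightarrow> (nat \<Rightarrow> real) \<times> real \<Rightarrow> real" where
  "jump f x p = (if snd p \<le> G.accept (dev x (x j)) (dev x (fst p)) then f (x(j := fst p)) else f x)"

lemma measurable_joint:
  assumes f[measurable]: "f \<in> borel_measurable S"
  shows "(\<lambda>(x, p). jump f x p) \<in> borel_measurable (S \<Otimes>\<^sub>M (M \<Otimes>\<^sub>M uni))"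
    and "(\<lambda>(x, p). G.pdens (dev x (x j)) (dev x (fst p))) \<in> borel_measurable (S \<Otimes>\<^sub>M (M \<Otimes>\<^sub>M uni))"
    and "(\<lambda>(x, z). exp (- G.quad (dev x z) / 2) / G.Z * f (x(j := z))) \<in> borel_measurable (S \<Otimes>\<^sub>M M)"
proof -
  let ?K = "S \<Otimes>\<^sub>M (M \<Otimes>\<^sub>M uni)"
  have 0: "(\<lambda>q. snd (snd q)) \<in> borel_measurable ?K" by measurable
  have 1: "fst \<in> measurable ?K S" by measurable
  have 2: "(\<lambda>q. fst (snd q)) \<in> measurable ?K M" by measurable
  note d1 = measurable_dev_gen[OF 1 measurable_j_comp[OF 1]]
  note d2 = measurable_dev_gen[OF 1 measurable_M_comp[OF 2]]
  have a: "(\<lambda>q. G.accept (dev (fst q) (fst q j)) (dev (fst q) (fst (snd q)))) \<in> borel_measurable ?K"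
    by (rule G.measurable_accept[OF d1 d2])
  have f1: "(\<lambda>q. f ((fst q)(j := fst (snd q)))) \<in> borel_measurable ?K"
    by (rule measurable_compose[OF measurable_upd[OF 1 2] f])
  show "(\<lambda>(x, p). jump f x p) \<in> borel_measurable ?K"
    unfolding jump_def case_prod_unfold
    by (rule measurable_If[OF f1 measurable_compose[OF 1 f] borel_measurable_le[OF 0 a]])
  show "(\<lambda>(x, p). G.pdens (dev x (x j)) (dev x (fst p))) \<in> borel_measurable ?K"
    unfolding case_prod_unfold by (rule G.measurable_pdens[OF d1 d2])
  have 3: "fst \<in> measurable (S \<Otimes>\<^sub>M M) S" "snd \<in> measurable (S \<Otimes>\<^sub>M M) M" by measurable
  have q: "(\<lambda>q. G.quad (dev (fst q) (snd q))) \<in> borel_measurable (S \<Otimes>\<^sub>M M)"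
    by (rule G.measurable_quad_gen[OF measurable_dev_gen[OF 3(1) measurable_M_comp[OF 3(2)]]])
  have f2: "(\<lambda>q. f ((fst q)(j := snd q))) \<in> borel_measurable (S \<Otimes>\<^sub>M M)"
    by (rule measurable_compose[OF measurable_upd[OF 3] f])
  show "(\<lambda>(x, z). exp (- G.quad (dev x z) / 2) / G.Z * f (x(j := z))) \<in> borel_measurable (S \<Otimes>\<^sub>M M)"
    unfolding case_prod_unfold
    by (intro borel_measurable_times borel_measurable_divide borel_measurable_const f2
        measurable_compose[OF _ borel_measurable_exp] borel_measurable_uminus q)
qed

lemma measurable_section: "(\<lambda>(x, p). k x p) \<in> borel_measurable (S \<Otimes>\<^sub>M L) \<Longrightarrow> x \<in> space S \<Longrightarrow> k x \<in> borel_measurable L"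
  using measurable_Pair2[of "\<lambda>(x, p). k x p" S L borel x] by simp

definition prop_law :: "(nat \<Rightarrow> nat \<Rightarrow> real) \<Rightarrow> (nat \<Rightarrow> real) measure" where
  "prop_law x = density M (\<lambda>z. ennreal (proposal_density d n \<mu> Q j h x (x(j := z))))"

lemma prop_law_eq: "prop_law x = density M (\<lambda>z. ennreal (G.pdens (dev x (x j)) (dev x z)))"
  by (simp add: prop_law_def proposal_eq)

lemma measurable_dev_const:
  "(\<lambda>z. G.pdens u (dev x z)) \<in> borel_measurable M" "(\<lambda>z. G.accept u (dev x z)) \<in> borel_measurable M"
  by (rule G.measurable_pdens G.measurable_accept;
      intro measurable_dev measurable_block_component borel_measurable_const; assumption)+

lemma measurable_recentre_P: "recentre x \<in> measurable (G.P u) M"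
  by (subst measurable_cong_sets[OF G.sets_P refl]) (rule measurable_recentre)

lemma prop_law_distr: "prop_law x = distr (G.P (dev x (x j))) M (recentre x)"
proof (rule measure_eqI)
  fix B assume "B \<in> sets (prop_law x)"
  then have B[measurable]: "B \<in> sets M" by (simp add: prop_law_def)
  have m1: "(\<lambda>z. ennreal (G.pdens (dev x (x j)) (dev x z))) \<in> borel_measurable M"
    by (intro measurable_compose[OF measurable_dev_const(1)] measurable_ennreal)
  have "emeasure (prop_law x) B = (\<integral>\<^sup>+z. ennreal (G.pdens (dev x (x j)) (dev x z)) * indicator B z \<partial>M)"
    unfolding prop_law_eq by (rule emeasure_density[OF m1 B])
  also have "\<dots> = (\<integral>\<^sup>+z. ennreal (G.pdens (dev x (x j)) (dev x (recentre x z))) * indicator B (recentre x z) \<partial>M)"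
    unfolding recentre_def
    by (rule nn_integral_block_space_translate[where F="\<lambda>z. ennreal (G.pdens (dev x (x j)) (dev x z)) *
        indicator B z", symmetric])
      (intro borel_measurable_times_ennreal m1 borel_measurable_indicator B)
  also have "\<dots> = (\<integral>\<^sup>+z. ennreal (G.pdens (dev x (x j)) z) * indicator (recentre x -` B \<inter> space M) z \<partial>M)"
    by (intro nn_integral_cong) (auto simp: coordinate_cong(2)[OF refl dev_recentre] indicator_def)
  also have "\<dots> = emeasure (G.P (dev x (x j))) (recentre x -` B \<inter> space M)"
    unfolding G.P_def
  proof (rule emeasure_density[symmetric])
    show "(\<lambda>y. ennreal (G.pdens (dev x (x j)) y)) \<in> borel_measurable M"
      by (intro measurable_compose[OF _ measurable_ennreal] G.measurable_pdens measurable_block_component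
          borel_measurable_const)
    show "recentre x -` B \<inter> space M \<in> sets M" by (rule measurable_sets[OF measurable_recentre B])
  qed
  also have "\<dots> = emeasure (distr (G.P (dev x (x j))) M (recentre x)) B"
    by (simp only: emeasure_distr[OF measurable_recentre_P B] G.space_P)
  finally show "emeasure (prop_law x) B = emeasure (distr (G.P (dev x (x j))) M (recentre x)) B" .
qed (simp add: prop_law_def)

lemma mala_op_jump:
  assumes f: "f \<in> borel_measurable S" and x: "x \<in> space S"
  shows "mala_op d n \<mu> Q j h f x = (\<integral>p. jump f x p \<partial>(prop_law x \<Otimes>\<^sub>M uni))"
proof -
  have s: "sets (prop_law x \<Otimes>\<^sub>M uni) = sets (M \<Otimes>\<^sub>M uni)"
    by (intro sets_pair_measure_cong) (simp_all add: prop_law_def)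
  have 2: "fst \<in> measurable (M \<Otimes>\<^sub>M uni) M" by measurable
  have c: "(\<lambda>_. x) \<in> measurable (M \<Otimes>\<^sub>M uni) S" using x by simp
  have a: "(\<lambda>q. G.accept (dev x (x j)) (dev x (fst q))) \<in> borel_measurable (M \<Otimes>\<^sub>M uni)"
    by (rule G.measurable_accept[OF _ measurable_dev_gen[OF c measurable_M_comp[OF 2]]]) simp
  have sm: "snd \<in> borel_measurable (M \<Otimes>\<^sub>M uni)" by measurable
  have phi: "(\<lambda>(z, u). if u \<le> accept_prob d n \<mu> Q j h x (x(j := z)) then x(j := z) else x)
      \<in> measurable (prop_law x \<Otimes>\<^sub>M uni) S"
    unfolding measurable_cong_sets[OF s refl] accept_eq case_prod_unfold
    by (rule measurable_If[OF measurable_upd[OF c 2] c borel_measurable_le[OF sm a]])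
  have "mala_op d n \<mu> Q j h f x = (\<integral>p. f (case p of (z, u) \<Rightarrow> if u \<le> accept_prob d n \<mu> Q j h x (x(j := z))
      then x(j := z) else x) \<partial>(prop_law x \<Otimes>\<^sub>M uni))"
    unfolding mala_op_def mala_kernel_def prop_law_def[symmetric] uni_def[symmetric]
    by (rule integral_distr[OF phi f])
  also have "\<dots> = (\<integral>p. jump f x p \<partial>(prop_law x \<Otimes>\<^sub>M uni))"
    unfolding jump_def accept_eq by (intro Bochner_Integration.integral_cong refl) (auto simp: case_prod_unfold)
  finally show ?thesis .
qed

text \<open>The kernel is a measure that varies with x. Moving the proposal density into the
  integrand leaves an integral over a fixed measure, with an integrand that is jointly measurable in
  x and the integration variable.\<close>

lemma measurable_mala_op:
  assumes f: "f \<in> borel_measurable S"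
  shows "mala_op d n \<mu> Q j h f \<in> borel_measurable S"
proof -
  interpret MU: pair_sigma_finite M uni
    by (intro pair_sigma_finite.intro sigma_finite_block_space U.sigma_finite_measure_axioms)
  let ?r = "\<lambda>x p. G.pdens (dev x (x j)) (dev x (fst p))"
  have eq: "mala_op d n \<mu> Q j h f x = (\<integral>p. ?r x p * jump f x p \<partial>(M \<Otimes>\<^sub>M uni))" if x: "x \<in> space S" for x
  proof -
    have r: "(\<lambda>p. ?r x p) \<in> borel_measurable (M \<Otimes>\<^sub>M uni)"
      by (rule measurable_section[OF measurable_joint(2)[OF f] x])
    have m1: "(\<lambda>z. ennreal (G.pdens (dev x (x j)) (dev x z))) \<in> borel_measurable M"
    by (intro measurable_compose[OF measurable_dev_const(1)] measurable_ennreal)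
    have "prop_law x \<Otimes>\<^sub>M uni = density M (\<lambda>z. ennreal (G.pdens (dev x (x j)) (dev x z))) \<Otimes>\<^sub>M density uni (\<lambda>_. 1)"
      by (simp add: prop_law_eq density_1)
    also have "\<dots> = density (M \<Otimes>\<^sub>M uni) (\<lambda>(z, u). ennreal (G.pdens (dev x (x j)) (dev x z)) * 1)"
      by (rule pair_measure_density[OF m1]) (simp_all add: density_1 sigma_finite_block_space
          U.sigma_finite_measure_axioms)
    also have "\<dots> = density (M \<Otimes>\<^sub>M uni) (\<lambda>p. ennreal (?r x p))" by (simp add: case_prod_unfold)
    finally have "mala_op d n \<mu> Q j h f x = (\<integral>p. jump f x p \<partial>density (M \<Otimes>\<^sub>M uni) (\<lambda>p. ennreal (?r x p)))"
      using mala_op_jump[OF f x] by simp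
    also have "\<dots> = (\<integral>p. ?r x p * jump f x p \<partial>(M \<Otimes>\<^sub>M uni))"
      by (rule integral_real_density[OF r _ measurable_section[OF measurable_joint(1)[OF f] x]])
        (simp add: less_imp_le[OF G.pdens_pos])
    finally show ?thesis .
  qed
  have "(\<lambda>(x, p). ?r x p * jump f x p) \<in> borel_measurable (S \<Otimes>\<^sub>M (M \<Otimes>\<^sub>M uni))"
    using borel_measurable_times[OF measurable_joint(2)[OF f] measurable_joint(1)[OF f]]
    unfolding case_prod_unfold .
  then have "(\<lambda>x. \<integral>p. ?r x p * jump f x p \<partial>(M \<Otimes>\<^sub>M uni)) \<in> borel_measurable S"
    by (rule sigma_finite_measure.borel_measurable_lebesgue_integral[OF MU.sigma_finite_measure_axioms])
  then show ?thesis by (rule measurable_cong[THEN iffD2, OF eq, rotated])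
qed

lemma gibbs_op_eq:
  assumes f: "f \<in> borel_measurable S" and x: "x \<in> space S"
  shows "gibbs_op d n \<mu> Q j f x = (\<integral>z. exp (- G.quad (dev x z) / 2) / G.Z * f (x(j := z)) \<partial>M)"
    and "gibbs_op d n \<mu> Q j f x = (\<integral>z. f (x(j := recentre x z)) \<partial>G.N)"
proof -
  have "(\<lambda>z. x(j := z)) \<in> measurable M S"
    by (rule measurable_upd[OF measurable_const[OF x] measurable_ident_sets[OF refl, unfolded id_def]])
  from measurable_compose[OF this f] have m: "(\<lambda>z. f (x(j := z))) \<in> borel_measurable M" .
  show "gibbs_op d n \<mu> Q j f x = (\<integral>z. exp (- G.quad (dev x z) / 2) / G.Z * f (x(j := z)) \<partial>M)"
    "gibbs_op d n \<mu> Q j f x = (\<integral>z. f (x(j := recentre x z)) \<partial>G.N)"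
    unfolding gibbs_op_def using integral_cond_dist[OF m, of x] by simp_all
qed

lemma measurable_gibbs_op:
  assumes f: "f \<in> borel_measurable S"
  shows "gibbs_op d n \<mu> Q j f \<in> borel_measurable S"
proof -
  have "(\<lambda>x. \<integral>z. exp (- G.quad (dev x z) / 2) / G.Z * f (x(j := z)) \<partial>M) \<in> borel_measurable S"
    by (rule sigma_finite_measure.borel_measurable_lebesgue_integral[OF sigma_finite_block_space
        measurable_joint(3)[OF f]])
  then show ?thesis by (rule measurable_cong[THEN iffD2, OF gibbs_op_eq(1)[OF f], rotated])
qed

text \<open>Integrating out the uniform variable turns the accept indicator into the acceptance
  probability. Assumption \<open>int\<close> makes the accepted part integrable, so that the Bochner
  integral splits into accepted and rejected moves.\<close>

lemma mala_op_step:
  assumes f: "f \<in> borel_measurable S" and x: "x \<in> space S"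
  defines "F \<equiv> \<lambda>z. f (x(j := recentre x z))"
  assumes int: "integrable (G.P (dev x (x j))) (\<lambda>z. G.accept (dev x (x j)) z * F z)"
  shows "mala_op d n \<mu> Q j h f x
    = (\<integral>z. G.accept (dev x (x j)) z * F z \<partial>G.P (dev x (x j))) + (1 - (\<integral>z. G.accept (dev x (x j)) z \<partial>G.P
        (dev x (x j)))) * f x"
proof -
  let ?u = "dev x (x j)"
  interpret PP: prob_space "G.P ?u" by (rule G.prob_space_P)
  have rm: "recentre x \<in> measurable (G.P ?u) M" by (rule measurable_recentre_P)
  interpret L: prob_space "prop_law x" unfolding prop_law_distr by (rule PP.prob_space_distr[OF rm])
  interpret LU: pair_prob_space "prop_law x" uni ..
  have sL: "sets (prop_law x) = sets M" by (simp add: prop_law_def)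
  have s: "sets (prop_law x \<Otimes>\<^sub>M uni) = sets (M \<Otimes>\<^sub>M uni)"
    by (intro sets_pair_measure_cong) (simp_all add: sL)
  have "(\<lambda>z. x(j := z)) \<in> measurable M S"
    by (rule measurable_upd[OF measurable_const[OF x] measurable_ident_sets[OF refl, unfolded id_def]])
  from measurable_compose[OF this f] have fm: "(\<lambda>z. f (x(j := z))) \<in> borel_measurable M" .
  have am: "(\<lambda>z. G.accept ?u (dev x z)) \<in> borel_measurable M" by (rule measurable_dev_const)
  have accept_r: "G.accept ?u (dev x (recentre x z)) = G.accept ?u z" for z
    by (rule coordinate_cong(3)[OF refl dev_recentre])
  let ?k1 = "\<lambda>z. G.accept ?u (dev x z) * f (x(j := z))"
  have k1m: "?k1 \<in> borel_measurable M" by (rule borel_measurable_times[OF am fm])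
  have i1: "integrable (prop_law x) ?k1"
    unfolding prop_law_distr integrable_distr_eq[OF rm k1m] accept_r using int by (simp add: F_def)
  have e1: "(\<integral>z. ?k1 z \<partial>prop_law x) = (\<integral>z. G.accept ?u z * F z \<partial>G.P ?u)"
    unfolding prop_law_distr integral_distr[OF rm k1m] accept_r by (simp add: F_def)
  have e2: "(\<integral>z. G.accept ?u (dev x z) \<partial>prop_law x) = (\<integral>z. G.accept ?u z \<partial>G.P ?u)"
    unfolding prop_law_distr integral_distr[OF rm am] accept_r ..
  have i2: "integrable (prop_law x) (\<lambda>z. G.accept ?u (dev x z))"
  proof (rule L.integrable_const_bound[where B=1])
    show "AE z in prop_law x. norm (G.accept ?u (dev x z)) \<le> 1"
      using G.accept_bounds[of ?u] by (intro AE_I2) (simp add: less_imp_le abs_of_pos)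
    show "(\<lambda>z. G.accept ?u (dev x z)) \<in> borel_measurable (prop_law x)"
      by (simp only: measurable_cong_sets[OF sL refl] am)
  qed
  let ?b = "\<lambda>p. if snd p \<le> G.accept ?u (dev x (fst p)) then 1 else 0 :: real"
  let ?J1 = "\<lambda>p. ?b p * f (x(j := fst p))" and ?J2 = "\<lambda>p. (1 - ?b p) * f x"
  have aM: "(\<lambda>p. G.accept ?u (dev x (fst p))) \<in> borel_measurable (M \<Otimes>\<^sub>M uni)"
    by (rule measurable_compose[OF measurable_fst am])
  have sm: "snd \<in> borel_measurable (M \<Otimes>\<^sub>M uni)" by measurable
  have bM: "?b \<in> borel_measurable (M \<Otimes>\<^sub>M uni)"
    by (rule measurable_If[OF borel_measurable_const borel_measurable_const borel_measurable_le[OF sm aM]])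
  have J1m: "?J1 \<in> borel_measurable (prop_law x \<Otimes>\<^sub>M uni)"
    unfolding measurable_cong_sets[OF s refl]
    by (rule borel_measurable_times[OF bM measurable_compose[OF measurable_fst fm]])
  have J2m: "?J2 \<in> borel_measurable (prop_law x \<Otimes>\<^sub>M uni)"
    unfolding measurable_cong_sets[OF s refl]
    by (intro borel_measurable_times borel_measurable_diff borel_measurable_const bM)
  have U1: "integrable uni (\<lambda>u. (if u \<le> t then 1 else 0) * c)"
      "(\<integral>u. (if u \<le> t then 1 else 0) * c \<partial>uni) = t * c" if "0 \<le> t" "t \<le> 1" for t c :: real
  proof -
    have e: "(\<lambda>u. (if u \<le> t then 1 else 0) * c) = (\<lambda>u. indicator {..t} u * c)" by (auto simp: indicator_def)
    show "integrable uni (\<lambda>u. (if u \<le> t then 1 else 0) * c)"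
      unfolding e by (intro integrable_mult_left U.integrable_const_bound[where B=1]) (auto simp: indicator_def)
    show "(\<integral>u. (if u \<le> t then 1 else 0) * c \<partial>uni) = t * c"
      unfolding e using prob_uni_atMost[OF that] by simp
  qed
  have t01: "0 \<le> G.accept ?u w" "G.accept ?u w \<le> 1" for w using G.accept_bounds[of ?u w] by auto
  have J1i: "integrable (prop_law x \<Otimes>\<^sub>M uni) ?J1"
  proof (rule LU.Fubini_integrable[OF J1m])
    have "(\<integral>u. norm (?J1 (z, u)) \<partial>uni) = \<bar>?k1 z\<bar>" for z
    proof -
      have "norm (?J1 (z, u)) = (if u \<le> G.accept ?u (dev x z) then 1 else 0) * \<bar>f (x(j := z))\<bar>" for u by simp
      then show ?thesis using U1(2)[OF t01] t01 by (simp add: abs_mult)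
    qed
    then show "integrable (prop_law x) (\<lambda>z. \<integral>u. norm (?J1 (z, u)) \<partial>uni)"
      using integrable_abs[OF i1] by (simp only:)
    show "AE z in prop_law x. integrable uni (\<lambda>u. ?J1 (z, u))"
      by (intro AE_I2) (simp only: fst_conv snd_conv U1(1)[OF t01])
  qed
  have J2i: "integrable (prop_law x \<Otimes>\<^sub>M uni) ?J2"
    by (rule LU.P.integrable_const_bound[where B="\<bar>f x\<bar>", OF _ J2m]) simp
  have "mala_op d n \<mu> Q j h f x = (\<integral>p. ?J1 p + ?J2 p \<partial>(prop_law x \<Otimes>\<^sub>M uni))"
    unfolding mala_op_jump[OF f x] jump_def by (intro Bochner_Integration.integral_cong refl) auto
  also have "\<dots> = (\<integral>p. ?J1 p \<partial>(prop_law x \<Otimes>\<^sub>M uni)) + (\<integral>p. ?J2 p \<partial>(prop_law x \<Otimes>\<^sub>M uni))"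
    by (rule Bochner_Integration.integral_add[OF J1i J2i])
  also have "(\<integral>p. ?J1 p \<partial>(prop_law x \<Otimes>\<^sub>M uni)) = (\<integral>z. ?k1 z \<partial>prop_law x)"
    unfolding LU.integral_fst'[OF J1i, symmetric] by (simp only: fst_conv snd_conv U1(2)[OF t01])
  also have "(\<integral>p. ?J2 p \<partial>(prop_law x \<Otimes>\<^sub>M uni)) = (\<integral>z. (1 - G.accept ?u (dev x z)) * f x \<partial>prop_law x)"
  proof -
    have "(\<integral>u. ?J2 (z, u) \<partial>uni) = (1 - G.accept ?u (dev x z)) * f x" for z
    proof -
      have "(\<integral>u. ?J2 (z, u) \<partial>uni) = (\<integral>u. f x - (if u \<le> G.accept ?u (dev x z) then 1 else 0) * f x \<partial>uni)"
        by (intro Bochner_Integration.integral_cong refl) auto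
      also have "\<dots> = f x - G.accept ?u (dev x z) * f x"
        using Bochner_Integration.integral_diff[OF U.integrable_const[of "f x"] U1(1)[OF t01, of _ "f x"]]
          U1(2)[OF t01] U.prob_space by simp
      finally show ?thesis by (simp add: algebra_simps)
    qed
    then show ?thesis unfolding LU.integral_fst'[OF J2i, symmetric] by (simp only:)
  qed
  also have "\<dots> = (1 - (\<integral>z. G.accept ?u (dev x z) \<partial>prop_law x)) * f x"
    using i2 L.prob_space by simp
  finally show ?thesis unfolding e1 e2 .
qed

section \<open>Fibres with the other blocks fixed\<close>

abbreviation "I' \<equiv> {1..d} - {j}"

lemma slice_in_S: "x \<in> space (\<Pi>\<^sub>M k\<in>I'. block_space (n k)) \<Longrightarrow> z \<in> space M \<Longrightarrow> x(j := z) \<in> space S"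
  using j unfolding state_space_def space_PiM by (auto simp: PiE_def extensional_def Pi_def)

lemma recentre_space: "recentre x z \<in> space M"
  by (simp add: recentre_def space_block_space)

text \<open>Disintegration of the target: the factor in front is the marginal density of the other
  blocks at x, and \<open>N\<close>, recentred, is the conditional law of block j.\<close>

lemma slice_integral:
  assumes x: "x \<in> space (\<Pi>\<^sub>M k\<in>I'. block_space (n k))" and g: "(\<lambda>z. g (x(j := z))) \<in> borel_measurable M"
  shows "(\<integral>\<^sup>+z. ennreal (target_density d n \<mu> Q (x(j := z))) * g (x(j := z)) \<partial>M)
    = ennreal (exp (- rest x / 2) / Z0 * G.Z) * (\<integral>\<^sup>+z. g (x(j := recentre x z)) \<partial>G.N)"
proof -
  let ?C = "exp (- rest x / 2) / Z0"
  have C: "0 \<le> ?C" using Z0_pos by simp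
  note g[measurable]
  have gr[measurable]: "(\<lambda>z. g (x(j := recentre x z))) \<in> borel_measurable M"
    by (rule measurable_compose[OF measurable_recentre g])
  have "(\<integral>\<^sup>+z. ennreal (target_density d n \<mu> Q (x(j := z))) * g (x(j := z)) \<partial>M)
      = (\<integral>\<^sup>+z. ennreal (?C * exp (- G.quad (dev x z) / 2)) * g (x(j := z)) \<partial>M)"
    by (simp add: target_density_eq)
  also have "\<dots> = (\<integral>\<^sup>+z. ennreal (?C * exp (- G.quad (dev x (recentre x z)) / 2)) * g (x(j := recentre x z)) \<partial>M)"
    unfolding recentre_def
    by (rule nn_integral_block_space_translate[where F="\<lambda>z. ennreal (?C * exp (- G.quad (dev x z) / 2)) *
        g (x(j := z))", symmetric]) measurable
  also have "\<dots> = (\<integral>\<^sup>+z. ennreal (?C * G.Z) * (ennreal (exp (- G.quad z / 2) / G.Z) * g (x(j := recentre x z))) \<partial>M)"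
  proof (rule nn_integral_cong)
    fix z
    have "ennreal (?C * exp (- G.quad z / 2)) = ennreal (?C * G.Z) * ennreal (exp (- G.quad z / 2) / G.Z)"
      using Z0_pos G.Z_pos by (subst ennreal_mult[symmetric]) (simp_all add: less_imp_le)
    then show "ennreal (?C * exp (- G.quad (dev x (recentre x z)) / 2)) * g (x(j := recentre x z))
        = ennreal (?C * G.Z) * (ennreal (exp (- G.quad z / 2) / G.Z) * g (x(j := recentre x z)))"
      by (simp only: quad_dev_recentre mult.assoc)
  qed
  also have "\<dots> = ennreal (?C * G.Z) * (\<integral>\<^sup>+z. g (x(j := recentre x z)) \<partial>G.N)"
    by (subst nn_integral_cmult) (simp_all add: G.nn_integral_N)
  finally show ?thesis .
qed

definition op_diff :: "((nat \<Rightarrow> nat \<Rightarrow> real) \<Rightarrow> real) \<Rightarrow> (nat \<Rightarrow> nat \<Rightarrow> real) \<Rightarrow> real" where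
  "op_diff f x = mala_op d n \<mu> Q j h f x - gibbs_op d n \<mu> Q j f x"

lemma measurable_op_diff: "f \<in> borel_measurable S \<Longrightarrow> op_diff f \<in> borel_measurable S"
  unfolding op_diff_def[abs_def] by (intro borel_measurable_diff measurable_mala_op measurable_gibbs_op)

lemma slice_contraction:
  assumes f: "f \<in> borel_measurable S" and x: "x \<in> space (\<Pi>\<^sub>M k\<in>I'. block_space (n k))"
  shows "(\<integral>\<^sup>+z. ennreal ((op_diff f (x(j := recentre x z)))\<^sup>2) \<partial>G.N)
    \<le> ennreal ((1 - h * \<psi> / 8600)\<^sup>2) * (\<integral>\<^sup>+z. ennreal ((f (x(j := recentre x z)))\<^sup>2) \<partial>G.N)"
proof (cases "(\<integral>\<^sup>+z. ennreal ((f (x(j := recentre x z)))\<^sup>2) \<partial>G.N) = \<infinity>")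
  case True
  \<comment> \<open>Strict positivity matters, because 0 times infinity is 0 in
    \<open>ennreal\<close>.\<close>
  have "(1 - h * \<psi> / 8600)\<^sup>2 > 0" using h_psi by simp
  then show ?thesis unfolding True by (simp add: ennreal_mult_top)
next
  case False
  define F where "F = (\<lambda>z. f (x(j := recentre x z)))"
  have inS: "x(j := recentre x z) \<in> space S" for z by (rule slice_in_S[OF x recentre_space])
  have sl: "(\<lambda>z. x(j := recentre x z)) \<in> measurable M S"
  proof -
    obtain z0 where z0: "z0 \<in> space M" using recentre_space by blast
    have "(\<lambda>z. (x(j := z0))(j := recentre x z)) \<in> measurable M S"
      by (rule measurable_upd[OF measurable_const[OF slice_in_S[OF x z0]] measurable_recentre])
    then show ?thesis by simp
  qed
  have Fm[measurable]: "F \<in> borel_measurable M"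
    unfolding F_def by (rule measurable_compose[OF sl f])
  have F2: "integrable G.N (\<lambda>z. (F z)\<^sup>2)"
  proof (rule integrableI_nonneg)
    show "(\<lambda>z. (F z)\<^sup>2) \<in> borel_measurable G.N"
      unfolding G.measurable_N_iff by (rule borel_measurable_power[OF Fm])
    show "(\<integral>\<^sup>+z. ennreal ((F z)\<^sup>2) \<partial>G.N) < \<infinity>" using False by (simp add: F_def less_top)
  qed simp
  then have FL: "F \<in> L2_functions G.N" using Fm by (simp add: L2_functions_def)
  have "AE z in G.N. integrable G.N (\<lambda>y. G.kern z y * F y)"
    using G.NN.AE_integrable_fst'[OF G.K.integrable_kform[OF G.K.const_L2[of 1] FL]] by simp
  \<comment> \<open>The identification with \<open>step\<close> rests on integrability of the
    accepted part, which Fubini grants for almost every \<open>z\<close> only; under the integral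
    this suffices.\<close>
  then have ae: "AE z in G.N. (op_diff f (x(j := recentre x z)))\<^sup>2 = (G.K.step F z - G.N.expectation F)\<^sup>2"
  proof eventually_elim
    case (elim z)
    let ?y = "x(j := recentre x z)"
    let ?u = "dev ?y (?y j)"
    have u: "?u i = z i" if "i < n j" for i using dev_recentre[OF that] by simp
    have P: "G.P ?u = G.P z" unfolding G.P_def using coordinate_cong(2)[OF u refl] by simp
    have a: "G.accept ?u w = G.accept z w" for w by (rule coordinate_cong(3)[OF u refl])
    have r: "recentre ?y = recentre x" by (simp add: recentre_def[abs_def])
    have Fy: "f (?y(j := recentre ?y w)) = F w" for w unfolding r by (simp add: F_def)
    have "integrable M (\<lambda>y. exp (- G.quad y / 2) / G.Z * (G.kern z y * F y))"
      using elim G.Z_pos unfolding G.N_def by (subst (asm) integrable_real_density) (auto simp: less_imp_le)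
    also have "(\<lambda>y. exp (- G.quad y / 2) / G.Z * (G.kern z y * F y)) = (\<lambda>y. G.pdens z y * (G.accept z y * F y))"
      unfolding mult.assoc[symmetric] G.kern_weight ..
    finally have "integrable (G.P z) (\<lambda>y. G.accept z y * F y)" by (subst G.integrable_P_iff) simp_all
    then have "mala_op d n \<mu> Q j h f ?y = G.K.step F z"
      using mala_op_step[OF f inS, of z] unfolding P a Fy G.step_eq[OF Fm] by (simp add: F_def)
    moreover have "gibbs_op d n \<mu> Q j f ?y = G.N.expectation F"
      unfolding gibbs_op_eq(2)[OF f inS] Fy ..
    ultimately show ?case by (simp add: op_diff_def)
  qed
  have sL: "G.K.step F \<in> L2_functions G.N" by (rule G.K.step_L2[OF FL])
  have si: "integrable G.N (\<lambda>z. (G.K.step F z - G.N.expectation F)\<^sup>2)"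
    using G.K.L2_D(2)[OF G.K.add_mult_L2[OF sL G.K.const_L2[of 1], of "- G.N.expectation F"]]
    by (simp only: mult_1_right add_uminus_conv_diff)
  have "(\<integral>\<^sup>+z. ennreal ((op_diff f (x(j := recentre x z)))\<^sup>2) \<partial>G.N) = (\<integral>\<^sup>+z. ennreal ((G.K.step F z -
      G.N.expectation F)\<^sup>2) \<partial>G.N)"
    by (rule nn_integral_cong_AE) (use ae in eventually_elim, simp)
  also have "\<dots> = ennreal (\<integral>z. (G.K.step F z - G.N.expectation F)\<^sup>2 \<partial>G.N)"
    by (rule nn_integral_eq_integral[OF si]) simp
  also have "\<dots> \<le> ennreal ((1 - h * \<psi> / 8600)\<^sup>2 * (\<integral>z. (F z)\<^sup>2 \<partial>G.N))"
    by (intro ennreal_leI G.mala_step_contraction FL h_psi)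
  also have "\<dots> = ennreal ((1 - h * \<psi> / 8600)\<^sup>2) * (\<integral>\<^sup>+z. ennreal ((F z)\<^sup>2) \<partial>G.N)"
    using nn_integral_eq_integral[OF F2] by (simp add: ennreal_mult)
  finally show ?thesis by (simp add: F_def)
qed

lemma nn_integral_target:
  assumes g: "g \<in> borel_measurable S"
  shows "(\<integral>\<^sup>+x. g x \<partial>target d n \<mu> Q)
    = (\<integral>\<^sup>+x. (\<integral>\<^sup>+z. ennreal (target_density d n \<mu> Q (x(j := z))) * g (x(j := z)) \<partial>M) \<partial>(\<Pi>\<^sub>M k\<in>I'. block_space (n k)))"
proof -
  have td: "(\<lambda>x. ennreal (target_density d n \<mu> Q x)) \<in> borel_measurable S"
    unfolding target_density_def gauss_density_def by measurable
  have ins: "insert j I' = {1..d}" using j by auto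
  have "(\<integral>\<^sup>+x. g x \<partial>target d n \<mu> Q) = (\<integral>\<^sup>+x. ennreal (target_density d n \<mu> Q x) * g x \<partial>S)"
    unfolding target_def by (rule nn_integral_density[OF td g])
  also have "\<dots> = (\<integral>\<^sup>+x. ennreal (target_density d n \<mu> Q x) * g x \<partial>(\<Pi>\<^sub>M k\<in>insert j I'. block_space (n k)))"
    by (simp only: ins state_space_def)
  also have "\<dots> = (\<integral>\<^sup>+x. (\<integral>\<^sup>+z. ennreal (target_density d n \<mu> Q (x(j := z))) * g (x(j := z)) \<partial>M) \<partial>(\<Pi>\<^sub>M
      k\<in>I'. block_space (n k)))"
  proof (rule SS.product_nn_integral_insert)
    show "(\<lambda>x. ennreal (target_density d n \<mu> Q x) * g x) \<in> borel_measurable (\<Pi>\<^sub>M k\<in>insert j I'. block_space (n k))"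
      unfolding ins state_space_def[symmetric] by (rule borel_measurable_times_ennreal[OF td g])
  qed simp_all
  finally show ?thesis .
qed

text \<open>The contraction factor is the same in every fibre, so it passes through the integral
  over the other blocks. Working with nonnegative integrals makes square integrability of the
  difference a consequence.\<close>

theorem op_diff_contraction:
  assumes f: "f \<in> borel_measurable S"
  shows "(\<integral>\<^sup>+x. ennreal ((op_diff f x)\<^sup>2) \<partial>target d n \<mu> Q)
    \<le> ennreal ((1 - h * \<psi> / 8600)\<^sup>2) * (\<integral>\<^sup>+x. ennreal ((f x)\<^sup>2) \<partial>target d n \<mu> Q)"
proof -
  let ?c = "ennreal ((1 - h * \<psi> / 8600)\<^sup>2)"
  let ?S' = "\<Pi>\<^sub>M k\<in>I'. block_space (n k)"
  have g1: "(\<lambda>x. ennreal ((op_diff f x)\<^sup>2)) \<in> borel_measurable S" using measurable_op_diff[OF f] by measurable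
  have g2: "(\<lambda>x. ennreal ((f x)\<^sup>2)) \<in> borel_measurable S" using f by measurable
  have sl: "(\<lambda>z. x(j := z)) \<in> measurable M S" if x: "x \<in> space ?S'" for x
  proof -
    obtain z0 where z0: "z0 \<in> space M" using recentre_space by blast
    have "(\<lambda>z. (x(j := z0))(j := z)) \<in> measurable M S"
      by (rule measurable_upd[OF measurable_const[OF slice_in_S[OF x z0]] measurable_ident_sets[OF refl,
          unfolded id_def]])
    then show ?thesis by simp
  qed
  have td: "(\<lambda>x. ennreal (target_density d n \<mu> Q x)) \<in> borel_measurable S"
    unfolding target_density_def gauss_density_def by measurable
  have "(\<integral>\<^sup>+x. ennreal ((op_diff f x)\<^sup>2) \<partial>target d n \<mu> Q)
      = (\<integral>\<^sup>+x. ennreal (exp (- rest x / 2) / Z0 * G.Z) * (\<integral>\<^sup>+z. ennreal ((op_diff f (x(j := recentre x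
          z)))\<^sup>2) \<partial>G.N) \<partial>?S')"
    unfolding nn_integral_target[OF g1]
    by (intro nn_integral_cong slice_integral measurable_compose[OF sl g1]) auto
  also have "\<dots> \<le> (\<integral>\<^sup>+x. ennreal (exp (- rest x / 2) / Z0 * G.Z) * (?c * (\<integral>\<^sup>+z. ennreal ((f (x(j :=
      recentre x z)))\<^sup>2) \<partial>G.N)) \<partial>?S')"
    by (intro nn_integral_mono mult_left_mono slice_contraction f) auto
  also have "\<dots> = (\<integral>\<^sup>+x. ?c * (\<integral>\<^sup>+z. ennreal (target_density d n \<mu> Q (x(j := z))) * ennreal ((f (x(j :=
      z)))\<^sup>2) \<partial>M) \<partial>?S')"
  proof (rule nn_integral_cong)
    fix x assume x: "x \<in> space ?S'"
    show "ennreal (exp (- rest x / 2) / Z0 * G.Z) * (?c * (\<integral>\<^sup>+z. ennreal ((f (x(j := recentre x z)))\<^sup>2) \<partial>G.N))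
        = ?c * (\<integral>\<^sup>+z. ennreal (target_density d n \<mu> Q (x(j := z))) * ennreal ((f (x(j := z)))\<^sup>2) \<partial>M)"
      unfolding slice_integral[where g="\<lambda>x. ennreal ((f x)\<^sup>2)", OF x measurable_compose[OF sl[OF x] g2]]
      by (rule mult.left_commute)
  qed
  also have "\<dots> = ?c * (\<integral>\<^sup>+x. ennreal ((f x)\<^sup>2) \<partial>target d n \<mu> Q)"
  proof -
    have "(\<lambda>q. (fst q)(j := snd q)) \<in> measurable (?S' \<Otimes>\<^sub>M M) S"
      unfolding state_space_def by (rule measurable_fun_upd[where J=I']) (use j in auto)
    from measurable_compose[OF this borel_measurable_times_ennreal[OF td g2]]
    have "(\<lambda>x. \<integral>\<^sup>+z. ennreal (target_density d n \<mu> Q (x(j := z))) * ennreal ((f (x(j := z)))\<^sup>2) \<partial>M) \<in>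
        borel_measurable ?S'"
      by (intro sigma_finite_measure.borel_measurable_nn_integral[OF sigma_finite_block_space]) (simp
          only: case_prod_unfold)
    then show ?thesis unfolding nn_integral_target[OF g2] by (rule nn_integral_cmult)
  qed
  finally show ?thesis .
qed

theorem L2_opnorm_op_diff: "L2_opnorm (target d n \<mu> Q) (op_diff) \<le> ereal (1 - h * \<psi> / 8600)"
  unfolding L2_opnorm_def
proof (rule SUP_least)
  let ?T = "target d n \<mu> Q" and ?k = "1 - h * \<psi> / 8600"
  have k: "0 \<le> ?k" using h_psi h_pos by simp
  fix f assume "f \<in> {f \<in> L2_functions ?T. L2_norm ?T f \<le> 1}"
  then have f: "f \<in> borel_measurable ?T" "integrable ?T (\<lambda>x. (f x)\<^sup>2)" "(\<integral>x. (f x)\<^sup>2 \<partial>?T) \<le> 1"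
    by (auto simp: L2_functions_def L2_norm_def)
  have sT: "sets ?T = sets S" by (simp add: target_def)
  have fS: "f \<in> borel_measurable S" using f(1) unfolding measurable_cong_sets[OF sT refl] .
  have gm: "op_diff f \<in> borel_measurable ?T"
    using measurable_op_diff[OF fS] unfolding measurable_cong_sets[OF sT refl] .
  have "(\<integral>\<^sup>+x. ennreal ((op_diff f x)\<^sup>2) \<partial>?T) \<le> ennreal (?k\<^sup>2) * (\<integral>\<^sup>+x. ennreal ((f x)\<^sup>2) \<partial>?T)"
    by (rule op_diff_contraction[OF fS])
  also have "\<dots> = ennreal (?k\<^sup>2) * ennreal (\<integral>x. (f x)\<^sup>2 \<partial>?T)" using nn_integral_eq_integral[OF f(2)] by simp
  also have "\<dots> \<le> ennreal (?k\<^sup>2) * 1" using f(3) by (intro mult_left_mono) (auto simp: ennreal_le_1)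
  finally have le: "(\<integral>\<^sup>+x. ennreal ((op_diff f x)\<^sup>2) \<partial>?T) \<le> ennreal (?k\<^sup>2)" by simp
  \<comment> \<open>\<open>L2_opnorm\<close> is infinite as soon as one image leaves L2, so
    membership has to be shown besides the norm bound.\<close>
  have "integrable ?T (\<lambda>x. (op_diff f x)\<^sup>2)"
    using gm le by (intro integrableI_nonneg) (auto intro: le_less_trans)
  then have L: "op_diff f \<in> L2_functions ?T" using gm by (simp add: L2_functions_def)
  have "(\<integral>x. (op_diff f x)\<^sup>2 \<partial>?T) \<le> ?k\<^sup>2"
    by (rule integral_real_bounded[OF _ le]) simp
  then have "L2_norm ?T (op_diff f) \<le> sqrt (?k\<^sup>2)" unfolding L2_norm_def by (rule real_sqrt_le_mono)
  then have "L2_norm ?T (op_diff f) \<le> ?k" using k by simp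
  then show "(if op_diff f \<in> L2_functions ?T then ereal (L2_norm ?T (op_diff f)) else \<infinity>) \<le> ereal ?k"
    using L by simp
qed

end

theorem proposition5p1:
  shows "\<exists>c0::real. c0 > 0 \<and> \<bar>c0 - 31 / 10 ^ 7\<bar> \<le> 5 / 10 ^ 8 \<and>
    (\<forall>(d::nat) (n::nat \<Rightarrow> nat) (\<mu>::nat \<Rightarrow> nat \<Rightarrow> real) (Q::nat \<Rightarrow> nat \<Rightarrow> real mat) (j::nat) (h::real).
       (\<forall>k\<in>{1..d}. n k \<ge> 1) \<longrightarrow>
       block_pos_def d n Q \<longrightarrow>
       j \<in> {1..d} \<longrightarrow>
       h > 0 \<longrightarrow>
       h \<le> 1 / (2 * Max (spectrum (Q j j))) \<longrightarrow>
       h\<^sup>2 \<le> 1 / (10 * mat_trace (Q j j ^\<^sub>m 2)) \<longrightarrow>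
       L2_opnorm (target d n \<mu> Q)
         (\<lambda>f x. mala_op d n \<mu> Q j h f x - gibbs_op d n \<mu> Q j f x)
       \<le> ereal (1 - c0 * h * Min (spectrum (Q j j))))"
\<comment> \<open>The centre of the prescribed interval serves as witness; it is smaller than
  1/8600, and \<open>h * \<psi>\<close> is positive, so the bound obtained is stronger.\<close>
proof (rule exI[of _ "31 / 10 ^ 7"], intro conjI allI impI)
  fix d n \<mu> Q j h
  assume a: "\<forall>k\<in>{1..d}. n k \<ge> 1" "block_pos_def d n Q" "j \<in> {1..d}" "h > 0"
    "h \<le> 1 / (2 * Max (spectrum (Q j j)))" "h\<^sup>2 \<le> 1 / (10 * mat_trace (Q j j ^\<^sub>m 2))"
  interpret block_mala d n \<mu> Q j h
    by standard (use a in auto)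
  have "31 / 10 ^ 7 * h * \<psi> \<le> h * \<psi> / 8600"
    using h_pos psi_pos by simp
  then have "ereal (1 - h * \<psi> / 8600) \<le> ereal (1 - 31 / 10 ^ 7 * h * \<psi>)" by simp
  with L2_opnorm_op_diff show "L2_opnorm (target d n \<mu> Q)
         (\<lambda>f x. mala_op d n \<mu> Q j h f x - gibbs_op d n \<mu> Q j f x)
       \<le> ereal (1 - 31 / 10 ^ 7 * h * Min (spectrum (Q j j)))"
    unfolding op_diff_def[abs_def] by (rule order_trans)
qed simp_all

end
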